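(* Let $A\to B$ be a finite extension of domains and assume $A$ is a noetherian ring. If $A$ is not a real domain, the central seminormalization $A^{s_c,*}_B$ of $A$ in $B$ is $B$. If $A$ is a real domain, $A^{s_c,*}_B$ can be obtained from $B$ by the birational gluing over $A$ followed by a finite number of successive elementary central gluings over central prime ideals of $A$; that is, there are $n\ge 1$, rings $A^{s_c,*}_B=B_n\subset\cdots\subset B_1\subset B$ and central prime ideals $\mathfrak p_1,\ldots,\mathfrak p_{n-1}$ of $A$ such that $B_1=B\cap\mathcal{K}(A)$ (inside $\mathcal{K}(B)$) and $B_{i+1}=A^{s_c,\mathfrak p_i}_{B_i}$ for $1\le i\le n-1$.
   Context: All rings are commutative and contain $\mathbb{Q}$; an extension is an injective ring homomorphism; it is finite if $B$ is a finitely generated $A$-module. For a domain $A$, $\mathcal{K}(A)$ is its fraction field and $\sum\mathcal{K}(A)^2$ the set of finite sums of squares in $\mathcal{K}(A)$. $A$ is a real domain if $-1\notin\sum\mathcal{K}(A)^2$. An ideal $I\subset A$ is central if for all $a\in A$, $b\in\sum\mathcal{K}(A)^2$, $a^2+b\in I$ implies $a\in I$. $\text{C-Spec}\,A$ is the set of central prime ideals of $A$; contraction gives a well-defined map $\text{C-Spec}\,B\to\text{C-Spec}\,A$ for an extension of domains $A\to B$. $A\to B$ is $s_c$-subintegral if it is integral and $\text{C-Spec}\,B\to\text{C-Spec}\,A$ is bijective with isomorphic residue fields ($k(\mathfrak q\cap A)\to k(\mathfrak q)$ is an isomorphism for every $\mathfrak q\in\text{C-Spec}\,B$). The central seminormalization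 $A^{s_c,*}_B$ is the unique maximal element among the intermediate domains $A\subset C\subset B$ such that $A\to C$ is $s_c$-subintegral (it always exists). The birational gluing (= birational closure) of $B$ over $A$ is $\widetilde{A}_B=B\times_{\mathcal{K}(B)}\mathcal{K}(A)$. For a finite extension of domains $A\to B$ with $A$ a real domain and $\mathfrak p\in\text{C-Spec}\,A$, let $\mathfrak q_1,\ldots,\mathfrak q_t$ be the central prime ideals of $B$ lying over $\mathfrak p$. The elementary central gluing of $B$ over $\mathfrak p$ is $A^{s_c,\mathfrak p}_B=B\times_Q k(\mathfrak p)$ with $Q=\prod_{i=1}^t k(\mathfrak q_i)$, i.e. the set of $b\in B$ for which there is $c\in k(\mathfrak p)$ whose image in $k(\mathfrak q_i)$ equals the class of $b$ for every $i=1,\ldots,t$; if $t=0$ one sets $A^{s_c,\mathfrak p}_B=B$. *)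

theory Defs
  imports "HOL-Algebra.Algebra" "HOL-Algebra.Algebraic_Closure_Type"
begin

section \<open>Fraction fields\<close>

definition frac_rel :: "('a, 'm) ring_scheme \<Rightarrow> (('a \<times> 'a) \<times> ('a \<times> 'a)) set" where
  "frac_rel R = {((a, b), (c, d)).
     a \<in> carrier R \<and> b \<in> carrier R - {\<zero>\<^bsub>R\<^esub>} \<and> c \<in> carrier R \<and> d \<in> carrier R - {\<zero>\<^bsub>R\<^esub>} \<and>
     a \<otimes>\<^bsub>R\<^esub> d = c \<otimes>\<^bsub>R\<^esub> b}"

definition fraction :: "('a, 'm) ring_scheme \<Rightarrow> 'a \<Rightarrow> 'a \<Rightarrow> ('a \<times> 'a) set" where
  "fraction R a b = frac_rel R `` {(a, b)}"

text \<open>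
  In this definition, in \<open>frac_map\<close> and in \<open>residue_map\<close> below, a class is computed from
  representatives by a union, all of whose members are equal.
\<close>

definition fraction_field :: "('a, 'm) ring_scheme \<Rightarrow> (('a \<times> 'a) set) ring" where
  "fraction_field R =
    \<lparr>carrier = (carrier R \<times> (carrier R - {\<zero>\<^bsub>R\<^esub>})) // frac_rel R,
     monoid.mult = (\<lambda>u v. \<Union>(a, b)\<in>u. \<Union>(c, d)\<in>v. fraction R (a \<otimes>\<^bsub>R\<^esub> c) (b \<otimes>\<^bsub>R\<^esub> d)),
     monoid.one = fraction R \<one>\<^bsub>R\<^esub> \<one>\<^bsub>R\<^esub>,
     ring.zero = fraction R \<zero>\<^bsub>R\<^esub> \<one>\<^bsub>R\<^esub>,
     ring.add = (\<lambda>u v. \<Union>(a, b)\<in>u. \<Union>(c, d)\<in>v.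
              fraction R (a \<otimes>\<^bsub>R\<^esub> d \<oplus>\<^bsub>R\<^esub> c \<otimes>\<^bsub>R\<^esub> b) (b \<otimes>\<^bsub>R\<^esub> d))\<rparr>"

definition to_frac :: "('a, 'm) ring_scheme \<Rightarrow> 'a \<Rightarrow> ('a \<times> 'a) set" where
  "to_frac R a = fraction R a \<one>\<^bsub>R\<^esub>"

text \<open>The map of fraction fields induced by an injective homomorphism \<open>f\<close> of domains into \<open>S\<close>.\<close>

definition frac_map ::
    "('b, 'n) ring_scheme \<Rightarrow> ('a \<Rightarrow> 'b) \<Rightarrow> ('a \<times> 'a) set \<Rightarrow> ('b \<times> 'b) set" where
  "frac_map S f u = (\<Union>(a, b)\<in>u. fraction S (f a) (f b))"


section \<open>Extensions\<close>

definition contains_rat :: "('a, 'm) ring_scheme \<Rightarrow> bool" where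
  "contains_rat R \<longleftrightarrow> (\<exists>h \<in> ring_hom (ring_of_type_algebra :: rat ring) R. inj h)"

definition ring_extension ::
    "('a, 'm) ring_scheme \<Rightarrow> ('a \<Rightarrow> 'b) \<Rightarrow> ('b, 'n) ring_scheme \<Rightarrow> bool" where
  "ring_extension A \<phi> B \<longleftrightarrow> \<phi> \<in> ring_hom A B \<and> inj_on \<phi> (carrier A)"

definition finite_extension ::
    "('a, 'm) ring_scheme \<Rightarrow> ('a \<Rightarrow> 'b) \<Rightarrow> ('b, 'n) ring_scheme \<Rightarrow> bool" where
  "finite_extension A \<phi> B \<longleftrightarrow> ring_extension A \<phi> B \<and>
     (\<exists>G. finite G \<and> G \<subseteq> carrier B \<and>
       (\<forall>b \<in> carrier B. \<exists>c \<in> G \<rightarrow> carrier A. b = (\<Oplus>\<^bsub>B\<^esub>g\<in>G. \<phi> (c g) \<otimes>\<^bsub>B\<^esub> g)))"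

text \<open>Polynomials are coefficient lists with the leading coefficient first.\<close>

definition integral_extension ::
    "('a, 'm) ring_scheme \<Rightarrow> ('a \<Rightarrow> 'b) \<Rightarrow> ('b, 'n) ring_scheme \<Rightarrow> bool" where
  "integral_extension A \<phi> B \<longleftrightarrow> ring_extension A \<phi> B \<and>
     (\<forall>b \<in> carrier B. \<exists>p. set p \<subseteq> carrier A \<and> p \<noteq> [] \<and> hd p = \<one>\<^bsub>A\<^esub> \<and>
        ring.eval B (map \<phi> p) b = \<zero>\<^bsub>B\<^esub>)"

definition intermediate_domain ::
    "('a, 'm) ring_scheme \<Rightarrow> ('a \<Rightarrow> 'b) \<Rightarrow> ('b, 'n) ring_scheme \<Rightarrow> 'b set \<Rightarrow> bool" where
  "intermediate_domain A \<phi> B C \<longleftrightarrow> subdomain C B \<and> \<phi> ` carrier A \<subseteq> C"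


section \<open>Real domains and central primes\<close>

inductive_set sums_of_squares :: "('a, 'm) ring_scheme \<Rightarrow> 'a set"
  for R (structure) where
  zero: "\<zero> \<in> sums_of_squares R"
| add_square: "\<lbrakk>x \<in> carrier R; s \<in> sums_of_squares R\<rbrakk> \<Longrightarrow> x \<otimes> x \<oplus> s \<in> sums_of_squares R"

definition real_domain :: "('a, 'm) ring_scheme \<Rightarrow> bool" where
  "real_domain A \<longleftrightarrow> domain A \<and>
     \<ominus>\<^bsub>fraction_field A\<^esub> \<one>\<^bsub>fraction_field A\<^esub> \<notin> sums_of_squares (fraction_field A)"

definition central_ideal :: "'a set \<Rightarrow> ('a, 'm) ring_scheme \<Rightarrow> bool" where
  "central_ideal I A \<longleftrightarrow> ideal I A \<and>
     (\<forall>a \<in> carrier A. \<forall>b \<in> sums_of_squares (fraction_field A).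
        to_frac A (a \<otimes>\<^bsub>A\<^esub> a) \<oplus>\<^bsub>fraction_field A\<^esub> b \<in> to_frac A ` I \<longrightarrow> a \<in> I)"

definition C_Spec :: "('a, 'm) ring_scheme \<Rightarrow> 'a set set" where
  "C_Spec A = {p. primeideal p A \<and> central_ideal p A}"

definition contraction :: "('a, 'm) ring_scheme \<Rightarrow> ('a \<Rightarrow> 'b) \<Rightarrow> 'b set \<Rightarrow> 'a set" where
  "contraction A \<phi> q = {a \<in> carrier A. \<phi> a \<in> q}"


section \<open>Residue fields\<close>

definition residue_field :: "('a, 'm) ring_scheme \<Rightarrow> 'a set \<Rightarrow> ('a set \<times> 'a set) set ring" where
  "residue_field R p = fraction_field (R Quot p)"

definition residue_class :: "('a, 'm) ring_scheme \<Rightarrow> 'a set \<Rightarrow> 'a \<Rightarrow> ('a set \<times> 'a set) set" where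
  "residue_class R p a = to_frac (R Quot p) (p +>\<^bsub>R\<^esub> a)"

text \<open>
  The map from the residue field at \<open>contraction A \<phi> q\<close> to the residue field at \<open>q\<close> induced by
  \<open>\<phi>\<close>. The source ring does not occur in it because the domain of the map consists of explicit
  classes of pairs of cosets.
\<close>

definition residue_map ::
    "('a \<Rightarrow> 'b) \<Rightarrow> ('b, 'n) ring_scheme \<Rightarrow> 'b set \<Rightarrow>
     ('a set \<times> 'a set) set \<Rightarrow> ('b set \<times> 'b set) set" where
  "residue_map \<phi> B q = frac_map (B Quot q) (\<lambda>u. \<Union>x\<in>u. q +>\<^bsub>B\<^esub> \<phi> x)"


section \<open>Central seminormalization\<close>

definition sc_subintegral ::
    "('a, 'm) ring_scheme \<Rightarrow> ('a \<Rightarrow> 'b) \<Rightarrow> ('b, 'n) ring_scheme \<Rightarrow> bool" where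
  "sc_subintegral A \<phi> B \<longleftrightarrow> integral_extension A \<phi> B \<and>
     bij_betw (contraction A \<phi>) (C_Spec B) (C_Spec A) \<and>
     (\<forall>q \<in> C_Spec B.
        residue_map \<phi> B q \<in> ring_iso (residue_field A (contraction A \<phi> q)) (residue_field B q))"

definition sc_subintegral_intermediates ::
    "('a, 'm) ring_scheme \<Rightarrow> ('a \<Rightarrow> 'b) \<Rightarrow> ('b, 'n) ring_scheme \<Rightarrow> 'b set set" where
  "sc_subintegral_intermediates A \<phi> B =
     {C. intermediate_domain A \<phi> B C \<and> sc_subintegral A \<phi> (B\<lparr>carrier := C\<rparr>)}"

definition maximal_in :: "'a set set \<Rightarrow> 'a set \<Rightarrow> bool" where
  "maximal_in \<C> C \<longleftrightarrow> C \<in> \<C> \<and> (\<forall>D \<in> \<C>. C \<subseteq> D \<longrightarrow> D = C)"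

definition is_central_seminormalization ::
    "('a, 'm) ring_scheme \<Rightarrow> ('a \<Rightarrow> 'b) \<Rightarrow> ('b, 'n) ring_scheme \<Rightarrow> 'b set \<Rightarrow> bool" where
  "is_central_seminormalization A \<phi> B C \<longleftrightarrow>
     maximal_in (sc_subintegral_intermediates A \<phi> B) C \<and>
     (\<forall>D. maximal_in (sc_subintegral_intermediates A \<phi> B) D \<longrightarrow> D = C)"


section \<open>Gluings\<close>

text \<open>
  The second component in each fibre product is determined by the first one, so both gluings
  are given as subsets of \<open>B\<close>.
\<close>

definition birational_gluing ::
    "('a, 'm) ring_scheme \<Rightarrow> ('a \<Rightarrow> 'b) \<Rightarrow> ('b, 'n) ring_scheme \<Rightarrow> 'b set" where
  "birational_gluing A \<phi> B =
     {b \<in> carrier B. \<exists>c \<in> carrier (fraction_field A). frac_map B \<phi> c = to_frac B b}"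

text \<open>
  If no central prime of \<open>B\<close> lies over \<open>p\<close>, the condition on \<open>q\<close> is void and the gluing is
  all of \<open>B\<close>.
\<close>

definition elementary_central_gluing ::
    "('a, 'm) ring_scheme \<Rightarrow> ('a \<Rightarrow> 'b) \<Rightarrow> ('b, 'n) ring_scheme \<Rightarrow> 'a set \<Rightarrow> 'b set" where
  "elementary_central_gluing A \<phi> B p =
     {b \<in> carrier B. \<exists>c \<in> carrier (residue_field A p).
        \<forall>q \<in> C_Spec B. contraction A \<phi> q = p \<longrightarrow> residue_map \<phi> B q c = residue_class B q b}"

end

(*
  For a domain D write P(D) for the elements of D that are sums of squares in the fraction
  field. A prime q is central iff a^2 + b in q with b in P(D) forces a in q. Let B_1 be the
  birational gluing. For A <= D <= B_1 the fraction fields agree, so P(D) is the intersection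
  of D with P(B_1). Every t in B_1 satisfies a - t^2 in P(B_1) for some a in A; hence the ideal
  generated by a central prime p of A contains no s^2 + b with s in A - p and b in P(D), and
  central primes lie over.

  Let C be the set of all b in B_1 whose residue classes at the central primes over any central
  prime p of A come from one element of k(p). By lying over, C is s_c-subintegral over A and
  contains every s_c-subintegral D. If C is a proper subring of D, the conductor of D in C is
  central. A maximal ideal p among the ideals ((C : D) : d) of A, with d in A not in (C : D), is
  then a central prime, and gluing D over p strictly increases the ideal {a in A. a D <= C}
  because the glued ring is a finite module and each of its elements is moved into C by
  some s in A - p. As A is noetherian, finitely many gluings lead from B_1 to C.
*)

theory Submission
  imports Defs
begin

section \<open>Central prime ideals and the cone of sums of squares\<close>

text \<open>Ordinary lying over does not suffice, since a prime over a central prime need not be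
  central. Central primes are obtained instead as ideals maximal among those that miss all t^2 + b.
  What must then be excluded is t^2 + b in p D, and the bound on squares does this: by (x + y)^2 <=
  2 x^2 + 2 y^2, the square of any element of p D lies below an element of p. The bound itself comes
  from module generators and uses that B_1 is real; B may fail to be real, as the complex numbers
  over the reals do, which is one reason for passing to B_1. The other is that every s_c-subintegral
  D lies in B_1: for real A the ideal 0 is central, the central prime of D over it is 0 by
  integrality, and the residue field isomorphism there says K(A) = K(D). The conductor measures
  progress because its centrality also makes it radical; hence one d satisfies both d p <= (C : D)
  and d not in p, and can serve as a denominator over p. If A is not real, neither A nor B has a
  central prime, and being s_c-subintegral reduces to being integral.\<close>

text \<open>The elements of R that are sums of squares of fractions, with a common denominator d^2
  cleared. Stated inside R so that the argument can stay away from the fraction field;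
  \<open>to_frac_sums_of_squares_iff\<close> is the link.\<close>

definition square_cone :: "('a, 'm) ring_scheme \<Rightarrow> 'a set" where
  "square_cone R = {b \<in> carrier R. \<exists>d \<in> carrier R - {\<zero>\<^bsub>R\<^esub>}.
     d \<otimes>\<^bsub>R\<^esub> d \<otimes>\<^bsub>R\<^esub> b \<in> sums_of_squares R}"

section \<open>Closure properties of sums of squares and of the cone\<close>

context cring
begin

lemma sums_of_squares_carrier:
  assumes "s \<in> sums_of_squares R"
  shows "s \<in> carrier R"
  using assms by induction auto

lemma sums_of_squares_add:
  assumes "s \<in> sums_of_squares R" "t \<in> sums_of_squares R"
  shows "s \<oplus> t \<in> sums_of_squares R"
  using assms(1)
proof induction
  case zero
  then show ?case using assms(2) sums_of_squares_carrier by simp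
next
  case (add_square x s)
  have "x \<otimes> x \<oplus> s \<oplus> t = x \<otimes> x \<oplus> (s \<oplus> t)"
    using add_square assms(2) sums_of_squares_carrier by (simp add: a_assoc)
  then show ?case using add_square sums_of_squares.add_square by metis
qed

lemma square_sums_of_squares:
  assumes "x \<in> carrier R"
  shows "x \<otimes> x \<in> sums_of_squares R"
  using sums_of_squares.add_square[OF assms sums_of_squares.zero] assms by simp

lemma square_mult_sums_of_squares:
  assumes "s \<in> sums_of_squares R" "x \<in> carrier R"
  shows "x \<otimes> x \<otimes> s \<in> sums_of_squares R"
  using assms(1)
proof induction
  case zero
  then show ?case using assms by (simp add: sums_of_squares.zero)
next
  case (add_square y s)
  have c: "s \<in> carrier R" using add_square sums_of_squares_carrier by blast
  have "x \<otimes> x \<otimes> (y \<otimes> y \<oplus> s) = (x \<otimes> y) \<otimes> (x \<otimes> y) \<oplus> x \<otimes> x \<otimes> s"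
    using c add_square(1) assms(2) by algebra
  then show ?case
    using add_square sums_of_squares.add_square[of "x \<otimes> y" R "x \<otimes> x \<otimes> s"] assms(2) by simp
qed

lemma sums_of_squares_mult:
  assumes "s \<in> sums_of_squares R" "t \<in> sums_of_squares R"
  shows "s \<otimes> t \<in> sums_of_squares R"
  using assms(1)
proof induction
  case zero
  then show ?case using assms(2) sums_of_squares_carrier by (simp add: sums_of_squares.zero)
next
  case (add_square x s)
  have "(x \<otimes> x \<oplus> s) \<otimes> t = x \<otimes> x \<otimes> t \<oplus> s \<otimes> t"
    using add_square assms(2) sums_of_squares_carrier by (simp add: l_distr)
  then show ?case
    using add_square assms(2) sums_of_squares_add square_mult_sums_of_squares by simp
qed

end

context domain
begin

lemma square_cone_carrier: "b \<in> square_cone R \<Longrightarrow> b \<in> carrier R"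
  by (simp add: square_cone_def)

lemma square_coneI:
  assumes "b \<in> carrier R" "d \<in> carrier R" "d \<noteq> \<zero>" "d \<otimes> d \<otimes> b \<in> sums_of_squares R"
  shows "b \<in> square_cone R"
  using assms by (auto simp: square_cone_def)

lemma sums_of_squares_square_cone:
  assumes "b \<in> sums_of_squares R"
  shows "b \<in> square_cone R"
  using assms sums_of_squares_carrier by (intro square_coneI[of b \<one>]) auto

lemma square_square_cone: "x \<in> carrier R \<Longrightarrow> x \<otimes> x \<in> square_cone R"
  by (simp add: sums_of_squares_square_cone square_sums_of_squares)

lemma zero_square_cone: "\<zero> \<in> square_cone R"
  by (simp add: sums_of_squares_square_cone sums_of_squares.zero)

lemma square_cone_add:
  assumes "a \<in> square_cone R" "b \<in> square_cone R"
  shows "a \<oplus> b \<in> square_cone R"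
proof -
  obtain d e where d: "d \<in> carrier R" "d \<noteq> \<zero>" "d \<otimes> d \<otimes> a \<in> sums_of_squares R" "a \<in> carrier R"
    and e: "e \<in> carrier R" "e \<noteq> \<zero>" "e \<otimes> e \<otimes> b \<in> sums_of_squares R" "b \<in> carrier R"
    using assms by (auto simp: square_cone_def)
  have "(d \<otimes> e) \<otimes> (d \<otimes> e) \<otimes> (a \<oplus> b) = e \<otimes> e \<otimes> (d \<otimes> d \<otimes> a) \<oplus> d \<otimes> d \<otimes> (e \<otimes> e \<otimes> b)"
    using d(1,4) e(1,4) by algebra
  then show ?thesis
    using d e by (intro square_coneI[of _ "d \<otimes> e"])
      (auto simp: integral_iff intro!: sums_of_squares_add square_mult_sums_of_squares)
qed

lemma square_cone_mult:
  assumes "a \<in> square_cone R" "b \<in> square_cone R"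
  shows "a \<otimes> b \<in> square_cone R"
proof -
  obtain d e where d: "d \<in> carrier R" "d \<noteq> \<zero>" "d \<otimes> d \<otimes> a \<in> sums_of_squares R" "a \<in> carrier R"
    and e: "e \<in> carrier R" "e \<noteq> \<zero>" "e \<otimes> e \<otimes> b \<in> sums_of_squares R" "b \<in> carrier R"
    using assms by (auto simp: square_cone_def)
  have "(d \<otimes> e) \<otimes> (d \<otimes> e) \<otimes> (a \<otimes> b) = (d \<otimes> d \<otimes> a) \<otimes> (e \<otimes> e \<otimes> b)"
    using d(1,4) e(1,4) by algebra
  then show ?thesis
    using d e by (intro square_coneI[of _ "d \<otimes> e"])
      (auto simp: integral_iff intro!: sums_of_squares_mult)
qed

lemma square_cone_cancel_square:
  assumes "d \<in> carrier R" "d \<noteq> \<zero>" "b \<in> carrier R" "d \<otimes> d \<otimes> b \<in> square_cone R"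
  shows "b \<in> square_cone R"
proof -
  obtain e where e: "e \<in> carrier R" "e \<noteq> \<zero>" "e \<otimes> e \<otimes> (d \<otimes> d \<otimes> b) \<in> sums_of_squares R"
    using assms by (auto simp: square_cone_def)
  have "e \<otimes> e \<otimes> (d \<otimes> d \<otimes> b) = (e \<otimes> d) \<otimes> (e \<otimes> d) \<otimes> b"
    using assms e(1) by algebra
  then show ?thesis
    using assms e by (intro square_coneI[of _ "e \<otimes> d"]) (auto simp: integral_iff)
qed

text \<open>Multiplying once more by c gives c^2 b, and nonzero squares can be cancelled.\<close>

lemma square_cone_cancel:
  assumes "c \<in> square_cone R" "c \<noteq> \<zero>" "b \<in> carrier R" "c \<otimes> b \<in> square_cone R"
  shows "b \<in> square_cone R"
proof (rule square_cone_cancel_square[OF _ assms(2,3)])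
  show c: "c \<in> carrier R" using assms(1) by (rule square_cone_carrier)
  show "c \<otimes> c \<otimes> b \<in> square_cone R"
    using square_cone_mult[OF assms(1,4)] c assms(3) by (simp add: m_assoc)
qed

end

section \<open>Ideals and central primes relative to a subset\<close>

text \<open>The ideals of all intermediate rings are kept in one ambient ring, where they can be
  intersected and compared. Negatives come from multiplying by -1 when D is a subring.\<close>

definition ideal_on :: "('a, 'm) ring_scheme \<Rightarrow> 'a set \<Rightarrow> 'a set \<Rightarrow> bool" where
  "ideal_on R D I \<longleftrightarrow> I \<subseteq> D \<and> \<zero>\<^bsub>R\<^esub> \<in> I \<and> (\<forall>x\<in>I. \<forall>y\<in>I. x \<oplus>\<^bsub>R\<^esub> y \<in> I) \<and>
     (\<forall>x\<in>D. \<forall>y\<in>I. x \<otimes>\<^bsub>R\<^esub> y \<in> I)"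

text \<open>The cone is that of the ambient R, not of D. This is centrality in D itself once R and D
  have the same fraction field, see \<open>C_Spec_subring_iff\<close>.\<close>

definition central_prime_on :: "('a, 'm) ring_scheme \<Rightarrow> 'a set \<Rightarrow> 'a set \<Rightarrow> bool" where
  "central_prime_on R D q \<longleftrightarrow> ideal_on R D q \<and> \<one>\<^bsub>R\<^esub> \<notin> q \<and>
     (\<forall>x\<in>D. \<forall>y\<in>D. x \<otimes>\<^bsub>R\<^esub> y \<in> q \<longrightarrow> x \<in> q \<or> y \<in> q) \<and>
     (\<forall>x\<in>D. \<forall>b\<in>D \<inter> square_cone R. x \<otimes>\<^bsub>R\<^esub> x \<oplus>\<^bsub>R\<^esub> b \<in> q \<longrightarrow> x \<in> q)"

lemma ideal_onI:
  assumes "I \<subseteq> D" "\<zero>\<^bsub>R\<^esub> \<in> I" "\<And>x y. x \<in> I \<Longrightarrow> y \<in> I \<Longrightarrow> x \<oplus>\<^bsub>R\<^esub> y \<in> I"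
    "\<And>x y. x \<in> D \<Longrightarrow> y \<in> I \<Longrightarrow> x \<otimes>\<^bsub>R\<^esub> y \<in> I"
  shows "ideal_on R D I"
  using assms by (auto simp: ideal_on_def)

lemma ideal_onD:
  assumes "ideal_on R D I"
  shows "I \<subseteq> D" "\<zero>\<^bsub>R\<^esub> \<in> I" "\<And>x y. x \<in> I \<Longrightarrow> y \<in> I \<Longrightarrow> x \<oplus>\<^bsub>R\<^esub> y \<in> I"
    "\<And>x y. x \<in> D \<Longrightarrow> y \<in> I \<Longrightarrow> x \<otimes>\<^bsub>R\<^esub> y \<in> I"
  using assms by (auto simp: ideal_on_def)

lemma central_prime_onI:
  assumes "ideal_on R D q" "\<one>\<^bsub>R\<^esub> \<notin> q"
    "\<And>x y. x \<in> D \<Longrightarrow> y \<in> D \<Longrightarrow> x \<otimes>\<^bsub>R\<^esub> y \<in> q \<Longrightarrow> x \<notin> q \<Longrightarrow> y \<in> q"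
    "\<And>x b. x \<in> D \<Longrightarrow> b \<in> D \<Longrightarrow> b \<in> square_cone R \<Longrightarrow> x \<otimes>\<^bsub>R\<^esub> x \<oplus>\<^bsub>R\<^esub> b \<in> q \<Longrightarrow> x \<in> q"
  shows "central_prime_on R D q"
  using assms by (auto simp: central_prime_on_def)

lemma central_prime_onD:
  assumes "central_prime_on R D q"
  shows "ideal_on R D q" "q \<subseteq> D" "\<zero>\<^bsub>R\<^esub> \<in> q" "\<And>x y. x \<in> q \<Longrightarrow> y \<in> q \<Longrightarrow> x \<oplus>\<^bsub>R\<^esub> y \<in> q"
    "\<And>x y. x \<in> D \<Longrightarrow> y \<in> q \<Longrightarrow> x \<otimes>\<^bsub>R\<^esub> y \<in> q" "\<one>\<^bsub>R\<^esub> \<notin> q"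
    "\<And>x y. x \<in> D \<Longrightarrow> y \<in> D \<Longrightarrow> x \<otimes>\<^bsub>R\<^esub> y \<in> q \<Longrightarrow> x \<in> q \<or> y \<in> q"
    "\<And>x b. x \<in> D \<Longrightarrow> b \<in> D \<Longrightarrow> b \<in> square_cone R \<Longrightarrow> x \<otimes>\<^bsub>R\<^esub> x \<oplus>\<^bsub>R\<^esub> b \<in> q \<Longrightarrow> x \<in> q"
  using assms by (auto simp: central_prime_on_def ideal_on_def)

context domain
begin

lemma ideal_on_minus:
  assumes "subring D R" "ideal_on R D I" "x \<in> I"
  shows "\<ominus> x \<in> I"
proof -
  have "x \<in> carrier R" using assms subringE(1) ideal_onD(1) by blast
  then have "\<ominus> x = \<ominus> \<one> \<otimes> x" by algebra
  moreover have "\<ominus> \<one> \<in> D" using assms(1) subringE(3,5) by metis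
  ultimately show ?thesis using ideal_onD(4)[OF assms(2)] assms(3) by simp
qed

lemma ideal_on_diff:
  assumes "subring D R" "ideal_on R D I" "x \<in> I" "y \<in> I"
  shows "x \<ominus> y \<in> I"
  using assms ideal_on_minus ideal_onD(3) by (metis a_minus_def)

lemma ideal_on_diff_mem:
  assumes "subring D R" "ideal_on R D I" "x \<in> D" "y \<in> D" "x \<ominus> y \<in> I"
  shows "x \<in> I \<longleftrightarrow> y \<in> I"
proof -
  have c: "x \<in> carrier R" "y \<in> carrier R" using assms subringE(1) by blast+
  have "x = (x \<ominus> y) \<oplus> y" using c by algebra
  moreover have "y = x \<ominus> (x \<ominus> y)" using c by algebra
  ultimately show ?thesis
    using assms ideal_onD(3)[OF assms(2)] ideal_on_diff[OF assms(1,2)] by metis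
qed

text \<open>
  A central Positivstellensatz: an ideal maximal among those that contain no \<open>t\<^sup>2 + b\<close>
  is prime because the elements \<open>t\<^sup>2 + b\<close> form a multiplicative set, and it is central because
  this set absorbs squaring and adding sums of squares.
\<close>

lemma exists_central_prime:
  assumes D: "subring D R" and I: "ideal_on R D I" and T: "T \<subseteq> D" "\<one> \<in> T"
    "\<And>x y. x \<in> T \<Longrightarrow> y \<in> T \<Longrightarrow> x \<otimes> y \<in> T"
    and disj: "\<And>t b. t \<in> T \<Longrightarrow> b \<in> D \<Longrightarrow> b \<in> square_cone R \<Longrightarrow> t \<otimes> t \<oplus> b \<notin> I"
  obtains q where "central_prime_on R D q" "I \<subseteq> q" "q \<inter> T = {}"
proof -
  let ?P = "square_cone R"
  define U where "U = {t \<otimes> t \<oplus> b |t b. t \<in> T \<and> b \<in> D \<and> b \<in> ?P}"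
  define F where "F = {J. ideal_on R D J \<and> I \<subseteq> J \<and> J \<inter> U = {}}"
  have Dc: "D \<subseteq> carrier R" and D0: "\<zero> \<in> D" and D1: "\<one> \<in> D"
    and Dm: "\<And>x y. x \<in> D \<Longrightarrow> y \<in> D \<Longrightarrow> x \<otimes> y \<in> D" and Da: "\<And>x y. x \<in> D \<Longrightarrow> y \<in> D \<Longrightarrow> x \<oplus> y \<in> D"
    by (simp_all add: subringE[OF D])
  have Dcr: "x \<in> carrier R" if "x \<in> D" for x using that Dc by blast
  have UI: "t \<otimes> t \<oplus> b \<in> U" if "t \<in> T" "b \<in> D" "b \<in> ?P" for t b
    using that by (auto simp: U_def)
  have UD: "U \<subseteq> D" using T(1) Dm Da by (auto simp: U_def)
  have Umult: "u \<otimes> v \<in> U" if uv: "u \<in> U" "v \<in> U" for u v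
  proof -
    obtain s a where u: "u = s \<otimes> s \<oplus> a" "s \<in> T" "a \<in> D" "a \<in> ?P"
      using uv unfolding U_def by blast
    obtain t b where v: "v = t \<otimes> t \<oplus> b" "t \<in> T" "b \<in> D" "b \<in> ?P"
      using uv unfolding U_def by blast
    have cD: "s \<in> D" "t \<in> D" using u v T by blast+
    have cc: "s \<in> carrier R" "t \<in> carrier R" "a \<in> carrier R" "b \<in> carrier R"
      using cD u v Dc by blast+
    have "u \<otimes> v = (s \<otimes> t) \<otimes> (s \<otimes> t) \<oplus> (s \<otimes> s \<otimes> b \<oplus> t \<otimes> t \<otimes> a \<oplus> a \<otimes> b)"
      unfolding u v using cc by algebra
    moreover have "s \<otimes> s \<otimes> b \<oplus> t \<otimes> t \<otimes> a \<oplus> a \<otimes> b \<in> ?P"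
      using u v cc by (intro square_cone_add square_cone_mult square_square_cone) auto
    ultimately show ?thesis using u v cD by (simp add: UI T(3) Dm Da)
  qed
  \<comment> \<open>First u^2 is rewritten as s^2 + a, so that the added b only enlarges a. This
    absorption is what makes the maximal ideal central.\<close>
  have Uadd: "u \<otimes> u \<oplus> b \<in> U" if ub: "u \<in> U" "b \<in> D" "b \<in> ?P" for u b
  proof -
    obtain s a where u: "u \<otimes> u = s \<otimes> s \<oplus> a" "s \<in> T" "a \<in> D" "a \<in> ?P"
      using Umult[OF ub(1) ub(1)] unfolding U_def by blast
    have "s \<in> carrier R" "a \<in> carrier R" "b \<in> carrier R" using u ub T(1) Dcr by blast+
    then have "u \<otimes> u \<oplus> b = s \<otimes> s \<oplus> (a \<oplus> b)"
      using u by (simp add: a_assoc)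
    then show ?thesis using u ub by (simp add: UI Da square_cone_add)
  qed
  have TU: "t \<otimes> t \<in> U" if "t \<in> T" for t
  proof -
    have "t \<in> carrier R" using that T(1) Dcr by blast
    then have "t \<otimes> t = t \<otimes> t \<oplus> \<zero>" by simp
    then show ?thesis using UI[OF that D0 zero_square_cone] by simp
  qed
  have "I \<in> F" using I disj by (auto simp: F_def U_def)
  moreover have "\<Union>C \<in> F" if ne: "C \<noteq> {}" and ch: "subset.chain F C" for C
  proof -
    have CF: "C \<subseteq> F" and tot: "\<And>J K. J \<in> C \<Longrightarrow> K \<in> C \<Longrightarrow> J \<subseteq> K \<or> K \<subseteq> J"
      using ch by (auto simp: subset.chain_def)
    have id: "ideal_on R D J" "I \<subseteq> J" "J \<inter> U = {}" if "J \<in> C" for J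
      using that CF by (auto simp: F_def)
    have "ideal_on R D (\<Union>C)"
    proof (rule ideal_onI)
      show "\<Union>C \<subseteq> D" using id(1) ideal_onD(1) by blast
      show "\<zero> \<in> \<Union>C" using ne id(1) ideal_onD(2) by blast
    next
      fix x y assume "x \<in> \<Union>C" "y \<in> \<Union>C"
      then obtain J K where "J \<in> C" "K \<in> C" "x \<in> J" "y \<in> K" by blast
      then show "x \<oplus> y \<in> \<Union>C" using tot[of J K] id(1) ideal_onD(3) by (metis UnionI subsetD)
    next
      fix x y assume "x \<in> D" "y \<in> \<Union>C"
      then show "x \<otimes> y \<in> \<Union>C" using id(1) ideal_onD(4) by (metis UnionE UnionI)
    qed
    then show ?thesis using ne id unfolding F_def by blast
  qed
  ultimately obtain M where M: "M \<in> F" and max: "\<And>J. J \<in> F \<Longrightarrow> M \<subseteq> J \<Longrightarrow> J = M"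
    using subset_Zorn_nonempty[of F] by blast
  have Mid: "ideal_on R D M" and IM: "I \<subseteq> M" and MU: "M \<inter> U = {}" using M by (auto simp: F_def)
  \<comment> \<open>Otherwise f D + M would be a strictly larger member of \<open>F\<close>.\<close>
  have meets: "\<exists>g\<in>D. \<exists>j\<in>M. f \<otimes> g \<oplus> j \<in> U" if f: "f \<in> D" "f \<notin> M" for f
  proof (rule ccontr)
    assume no: "\<not> ?thesis"
    define N where "N = {f \<otimes> g \<oplus> j |g j. g \<in> D \<and> j \<in> M}"
    have NI: "f \<otimes> g \<oplus> j \<in> N" if "g \<in> D" "j \<in> M" for g j
      using that by (auto simp: N_def)
    have "ideal_on R D N"
    proof (rule ideal_onI)
      show "N \<subseteq> D" using f Dm Da ideal_onD(1)[OF Mid] by (auto simp: N_def)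
      have "\<zero> = f \<otimes> \<zero> \<oplus> \<zero>" using f Dcr by simp
      then show "\<zero> \<in> N" using NI[OF D0 ideal_onD(2)[OF Mid]] by simp
    next
      fix x y assume "x \<in> N" "y \<in> N"
      then obtain g j h k where x: "x = f \<otimes> g \<oplus> j" "g \<in> D" "j \<in> M"
        and y: "y = f \<otimes> h \<oplus> k" "h \<in> D" "k \<in> M" unfolding N_def by blast
      have "f \<in> carrier R" "g \<in> carrier R" "h \<in> carrier R" "j \<in> carrier R" "k \<in> carrier R"
        using f x y Dc ideal_onD(1)[OF Mid] by blast+
      then have "x \<oplus> y = f \<otimes> (g \<oplus> h) \<oplus> (j \<oplus> k)" unfolding x y by algebra
      then show "x \<oplus> y \<in> N" using x y by (simp add: NI Da ideal_onD(3)[OF Mid])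
    next
      fix x y assume "x \<in> D" "y \<in> N"
      then obtain h k where y: "y = f \<otimes> h \<oplus> k" "h \<in> D" "k \<in> M" unfolding N_def by blast
      have "f \<in> carrier R" "x \<in> carrier R" "h \<in> carrier R" "k \<in> carrier R"
        using f y \<open>x \<in> D\<close> Dc ideal_onD(1)[OF Mid] by blast+
      then have "x \<otimes> y = f \<otimes> (x \<otimes> h) \<oplus> (x \<otimes> k)" unfolding y by algebra
      then show "x \<otimes> y \<in> N" using \<open>x \<in> D\<close> y by (simp add: NI Dm ideal_onD(4)[OF Mid])
    qed
    moreover have MN: "M \<subseteq> N"
    proof
      fix j assume "j \<in> M"
      then have "f \<in> carrier R" "j \<in> carrier R" using f Dc ideal_onD(1)[OF Mid] by blast+
      then have "j = f \<otimes> \<zero> \<oplus> j" by simp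
      then show "j \<in> N" using NI[OF D0 \<open>j \<in> M\<close>] by simp
    qed
    moreover have "N \<inter> U = {}" using no by (auto simp: N_def)
    ultimately have "N = M" using max[of N] IM by (auto simp: F_def)
    moreover have "f = f \<otimes> \<one> \<oplus> \<zero>" using f Dcr by simp
    then have "f \<in> N" using NI[OF D1 ideal_onD(2)[OF Mid]] by simp
    ultimately show False using f by blast
  qed
  have one: "\<one> \<notin> M" using TU[OF T(2)] MU by auto
  have "central_prime_on R D M"
  proof (rule central_prime_onI[OF Mid one])
    fix x y assume xy: "x \<in> D" "y \<in> D" "x \<otimes> y \<in> M" "x \<notin> M"
    show "y \<in> M"
    proof (rule ccontr)
      assume "y \<notin> M"
      obtain g j h k where g: "g \<in> D" "j \<in> M" "x \<otimes> g \<oplus> j \<in> U"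
        and h: "h \<in> D" "k \<in> M" "y \<otimes> h \<oplus> k \<in> U"
        using meets xy \<open>y \<notin> M\<close> by metis
      have MD: "j \<in> D" "k \<in> D" using g h ideal_onD(1)[OF Mid] by blast+
      have "x \<in> carrier R" "y \<in> carrier R" "g \<in> carrier R" "h \<in> carrier R" "j \<in> carrier R" "k \<in> carrier R"
        using xy g h Dc MD by blast+
      then have "(x \<otimes> g \<oplus> j) \<otimes> (y \<otimes> h \<oplus> k) = g \<otimes> h \<otimes> (x \<otimes> y) \<oplus> ((x \<otimes> g \<oplus> j) \<otimes> k \<oplus> y \<otimes> h \<otimes> j)"
        by algebra
      moreover have "\<dots> \<in> M"
        using xy g h MD by (simp add: ideal_onD(3,4)[OF Mid] Dm Da)
      ultimately show False using Umult[OF g(3) h(3)] MU by auto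
    qed
  next
    fix f b assume f: "f \<in> D" "b \<in> D" "b \<in> ?P" "f \<otimes> f \<oplus> b \<in> M"
    show "f \<in> M"
    proof (rule ccontr)
      assume "f \<notin> M"
      then obtain g j where g: "g \<in> D" "j \<in> M" "f \<otimes> g \<oplus> j \<in> U" using meets f by blast
      have jD: "j \<in> D" using g ideal_onD(1)[OF Mid] by blast
      have c: "f \<in> carrier R" "g \<in> carrier R" "j \<in> carrier R" "b \<in> carrier R"
        using f g jD Dc by blast+
      \<comment> \<open>For u = f g + j in \<open>U\<close> this reads u^2 + g^2 b = g^2 (f^2 + b) +
        (u + f g) j: the left side is in \<open>U\<close>, the right side in M.\<close>
      then have "(f \<otimes> g \<oplus> j) \<otimes> (f \<otimes> g \<oplus> j) \<oplus> g \<otimes> g \<otimes> b =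
          g \<otimes> g \<otimes> (f \<otimes> f \<oplus> b) \<oplus> ((f \<otimes> g \<oplus> j) \<oplus> f \<otimes> g) \<otimes> j"
        by algebra
      moreover have "\<dots> \<in> M"
        using f g jD by (simp add: ideal_onD(3,4)[OF Mid] Dm Da)
      moreover have "(f \<otimes> g \<oplus> j) \<otimes> (f \<otimes> g \<oplus> j) \<oplus> g \<otimes> g \<otimes> b \<in> U"
        using f g c by (intro Uadd Dm square_cone_mult square_square_cone) auto
      ultimately show False using MU by auto
    qed
  qed
  moreover have "M \<inter> T = {}"
  proof -
    have "t \<notin> M" if "t \<in> T" for t
      using TU[OF that] MU ideal_onD(4)[OF Mid, of t t] that T(1) by blast
    then show ?thesis by blast
  qed
  ultimately show thesis using IM that by blast
qed

end

section \<open>Central lying over, gluings and the closure\<close>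

text \<open>Used in two ways: for an ideal p and a ring D it is the extended ideal p D, for a ring A
  and a set of generators it is the A-module that they span.\<close>

inductive_set combinations :: "('a, 'm) ring_scheme \<Rightarrow> 'a set \<Rightarrow> 'a set \<Rightarrow> 'a set"
  for R (structure) and p and D where
  zero: "\<zero> \<in> combinations R p D"
| add_mult: "\<lbrakk>c \<in> p; t \<in> D; x \<in> combinations R p D\<rbrakk> \<Longrightarrow> c \<otimes> t \<oplus> x \<in> combinations R p D"

context domain
begin

lemma combinations_subring:
  assumes D: "subring D R" and p: "p \<subseteq> D" and x: "x \<in> combinations R p D"
  shows "x \<in> D"
  using x by induction (use p in \<open>auto simp: subringE[OF D]\<close>)

lemma ideal_on_combinations:
  assumes D: "subring D R" and p: "p \<subseteq> D"
  shows "ideal_on R D (combinations R p D)"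
proof (rule ideal_onI)
  have cr: "z \<in> carrier R" if "z \<in> D" for z using that subringE(1)[OF D] by blast
  show "combinations R p D \<subseteq> D" using combinations_subring[OF D p] by blast
  show "\<zero> \<in> combinations R p D" by (rule combinations.zero)
  fix y assume y: "y \<in> combinations R p D"
  have yc: "y \<in> carrier R" using combinations_subring[OF D p y] cr by blast
  show "x \<oplus> y \<in> combinations R p D" if "x \<in> combinations R p D" for x
    using that
  proof induction
    case zero then show ?case using y yc by simp
  next
    case (add_mult c t x)
    have "c \<in> carrier R" "t \<in> carrier R" "x \<in> carrier R"
      using add_mult p cr combinations_subring[OF D p] by blast+
    then have "c \<otimes> t \<oplus> x \<oplus> y = c \<otimes> t \<oplus> (x \<oplus> y)" using yc by (simp add: a_assoc)
    then show ?case using combinations.add_mult[OF add_mult(1,2,4)] by simp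
  qed
  show "d \<otimes> y \<in> combinations R p D" if d: "d \<in> D" for d
    using y
  proof induction
    case zero then show ?case using d cr by (simp add: combinations.zero)
  next
    case (add_mult c t x)
    have "c \<in> carrier R" "t \<in> carrier R" "x \<in> carrier R" "d \<in> carrier R"
      using add_mult p cr combinations_subring[OF D p] d by blast+
    then have "d \<otimes> (c \<otimes> t \<oplus> x) = c \<otimes> (d \<otimes> t) \<oplus> d \<otimes> x" by algebra
    then show ?case
      using combinations.add_mult[of c p "d \<otimes> t" D "d \<otimes> x" R] add_mult d
      by (simp add: subringE[OF D])
  qed
qed

lemma subset_combinations:
  assumes D: "subring D R" and p: "p \<subseteq> D"
  shows "p \<subseteq> combinations R p D"
proof
  fix c assume c: "c \<in> p"
  then have "c \<in> carrier R" using p subringE(1)[OF D] by blast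
  then show "c \<in> combinations R p D"
    using combinations.add_mult[OF c subringE(3)[OF D] combinations.zero, where R=R] by simp
qed

lemma central_prime_on_contract:
  assumes "central_prime_on R D q" "subring C R" "C \<subseteq> D"
  shows "central_prime_on R C (q \<inter> C)"
proof (intro central_prime_onI ideal_onI)
  fix x y assume "x \<in> C" "y \<in> C" "x \<otimes> y \<in> q \<inter> C" "x \<notin> q \<inter> C"
  then show "y \<in> q \<inter> C" using central_prime_onD(7)[OF assms(1)] assms(3) by blast
next
  fix x b assume "x \<in> C" "b \<in> C" "b \<in> square_cone R" "x \<otimes> x \<oplus> b \<in> q \<inter> C"
  then show "x \<in> q \<inter> C" using central_prime_onD(8)[OF assms(1)] assms(3) by blast
qed (use assms(3) central_prime_onD(3-6)[OF assms(1)] in \<open>auto simp: subringE[OF assms(2)]\<close>)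

end

text \<open>Write x <= y for y - x in the cone. Then every square in R lies below an element of A,
  which takes the place of integrality in the proof of lying over.\<close>

locale bounded_extension = domain R for R (structure) +
  fixes A
  assumes subring_A: "subring A R"
    and bounded: "t \<in> carrier R \<Longrightarrow> \<exists>a \<in> A \<inter> square_cone R. a \<ominus> t \<otimes> t \<in> square_cone R"
begin

text \<open>From t^2 <= a and x^2 <= e follows (c t + x)^2 <= 2 c^2 t^2 + 2 x^2 <= 2 (c^2 a + e),
  and c^2 a + e is in p because c and e are.\<close>

lemma combinations_bounded:
  assumes D: "subring D R" and C: "subring C R" "A \<subseteq> C" and p: "ideal_on R C p"
    and x: "x \<in> combinations R p D"
  obtains e where "e \<in> p" "e \<ominus> x \<otimes> x \<in> square_cone R"
proof -
  have "x \<in> carrier R \<and> (\<exists>e \<in> p. e \<ominus> x \<otimes> x \<in> square_cone R)"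
    using x
  proof induction
    case zero
    then show ?case
      using ideal_onD(2)[OF p] zero_square_cone by (auto intro!: bexI[of _ \<zero>] simp: a_minus_def)
  next
    case (add_mult c t x)
    obtain e where e: "e \<in> p" "e \<ominus> x \<otimes> x \<in> square_cone R" "x \<in> carrier R"
      using add_mult by blast
    have tc: "t \<in> carrier R" using add_mult(2) subringE(1)[OF D] by blast
    obtain a where a: "a \<in> A" "a \<ominus> t \<otimes> t \<in> square_cone R" using bounded[OF tc] by blast
    have pC: "c \<in> C" "e \<in> C" "a \<in> C" using add_mult(1) e(1) a(1) ideal_onD(1)[OF p] C(2) by blast+
    then have cc: "c \<in> carrier R" "e \<in> carrier R" "a \<in> carrier R"
      using subringE(1)[OF C(1)] by blast+
    let ?f = "(c \<otimes> a) \<otimes> c \<oplus> e"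
    have "?f \<oplus> ?f \<ominus> (c \<otimes> t \<oplus> x) \<otimes> (c \<otimes> t \<oplus> x) =
        c \<otimes> c \<otimes> (a \<ominus> t \<otimes> t) \<oplus> c \<otimes> c \<otimes> (a \<ominus> t \<otimes> t) \<oplus>
        (e \<ominus> x \<otimes> x) \<oplus> (e \<ominus> x \<otimes> x) \<oplus> (c \<otimes> t \<ominus> x) \<otimes> (c \<otimes> t \<ominus> x)"
      using cc tc e(3) by algebra
    also have "\<dots> \<in> square_cone R"
      using cc tc e a by (intro square_cone_add square_cone_mult[OF square_square_cone] square_square_cone) auto
    finally have "?f \<oplus> ?f \<ominus> (c \<otimes> t \<oplus> x) \<otimes> (c \<otimes> t \<oplus> x) \<in> square_cone R" .
    moreover have "?f \<oplus> ?f \<in> p"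
      using pC e(1) add_mult(1) by (intro ideal_onD(3,4)[OF p]) (auto simp: subringE[OF C(1)])
    ultimately show ?case using cc tc e(3) by auto
  qed
  then show thesis using that by blast
qed

text \<open>\<open>exists_central_prime\<close> is applied to p D and the multiplicative set C - p;
  a prime that contains p D and misses C - p contracts to p.\<close>

lemma central_lying_over:
  assumes D: "subring D R" and C: "subring C R" "A \<subseteq> C" "C \<subseteq> D" and p: "central_prime_on R C p"
  obtains q where "central_prime_on R D q" "q \<inter> C = p"
proof -
  note p' = central_prime_onD[OF p]
  have pD: "p \<subseteq> D" using p'(2) C(3) by blast
  have cr: "z \<in> carrier R" if "z \<in> D" for z using that subringE(1)[OF D] by blast
  have disj: "t \<otimes> t \<oplus> b \<notin> combinations R p D"
    if t: "t \<in> C - p" and b: "b \<in> D" "b \<in> square_cone R" for t b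
  proof
    assume "t \<otimes> t \<oplus> b \<in> combinations R p D"
    then obtain e where e: "e \<in> p" "e \<ominus> (t \<otimes> t \<oplus> b) \<otimes> (t \<otimes> t \<oplus> b) \<in> square_cone R"
      using combinations_bounded[OF D C(1,2) p'(1)] by blast
    have c: "t \<in> carrier R" "b \<in> carrier R" "e \<in> carrier R" using t b e(1) C(3) pD cr by blast+
    \<comment> \<open>The square of t^2 + b lies below e; dropping 2 t^2 b + b^2 gives t^4 <= e. Now
      (t^2)^2 + (e - t^4) = e is in p, so centrality of p puts t^2 into p.\<close>
    let ?d = "e \<ominus> (t \<otimes> t) \<otimes> (t \<otimes> t)"
    have "?d = (e \<ominus> (t \<otimes> t \<oplus> b) \<otimes> (t \<otimes> t \<oplus> b)) \<oplus> (t \<otimes> t \<otimes> b \<oplus> t \<otimes> t \<otimes> b \<oplus> b \<otimes> b)"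
      using c by algebra
    also have "\<dots> \<in> square_cone R"
      using c b e by (intro square_cone_add square_cone_mult[OF square_square_cone] square_square_cone) auto
    finally have "?d \<in> square_cone R" .
    moreover have "?d \<in> C" unfolding a_minus_def using t e(1) p'(2) by (auto simp: subringE[OF C(1)])
    moreover have "(t \<otimes> t) \<otimes> (t \<otimes> t) \<oplus> ?d = e" using c by algebra
    ultimately have "t \<otimes> t \<in> p" using p'(8)[of "t \<otimes> t" ?d] t e(1) by (simp add: subringE[OF C(1)])
    then show False using p'(7)[of t t] t by blast
  qed
  have mult: "x \<otimes> y \<in> C - p" if "x \<in> C - p" "y \<in> C - p" for x y
    using that p'(7)[of x y] by (auto simp: subringE[OF C(1)])
  have "\<one> \<in> C - p" using p'(6) by (simp add: subringE[OF C(1)])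
  then obtain q where q: "central_prime_on R D q" "combinations R p D \<subseteq> q" "q \<inter> (C - p) = {}"
    using exists_central_prime[OF D ideal_on_combinations[OF D pD] _ _ mult disj] C(3) by blast
  moreover have "q \<inter> C = p" using q subset_combinations[OF D pD] p'(2) by blast
  ultimately show thesis using that by blast
qed

section \<open>Gluing over one central prime of A\<close>

text \<open>An element of k(p) is a fraction u/s with s outside p, and it equals the class of b at q
  exactly when s b - u is in q. This describes the fibre product without residue fields; the same u
  and s must serve all q over p.\<close>

definition central_gluing :: "'a set \<Rightarrow> 'a set \<Rightarrow> 'a set" where
  "central_gluing D p = {b \<in> D. \<exists>u \<in> A. \<exists>s \<in> A - p. \<forall>q. central_prime_on R D q \<and> q \<inter> A = p \<longrightarrow>
     s \<otimes> b \<ominus> u \<in> q}"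

lemma central_gluingI:
  assumes "b \<in> D" "u \<in> A" "s \<in> A - p"
    "\<And>q. central_prime_on R D q \<Longrightarrow> q \<inter> A = p \<Longrightarrow> s \<otimes> b \<ominus> u \<in> q"
  shows "b \<in> central_gluing D p"
  using assms unfolding central_gluing_def by blast

lemma central_gluingE:
  assumes "b \<in> central_gluing D p"
  obtains u s where "b \<in> D" "u \<in> A" "s \<in> A - p"
    "\<And>q. central_prime_on R D q \<Longrightarrow> q \<inter> A = p \<Longrightarrow> s \<otimes> b \<ominus> u \<in> q"
  using assms unfolding central_gluing_def by blast

lemma A_carrier: "a \<in> A \<Longrightarrow> a \<in> carrier R"
  using subringE(1)[OF subring_A] by blast

lemma subset_central_gluing:
  assumes "subring D R" "A \<subseteq> D" "central_prime_on R A p"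
  shows "A \<subseteq> central_gluing D p"
proof
  fix a assume a: "a \<in> A"
  show "a \<in> central_gluing D p"
  proof (rule central_gluingI)
    show "a \<in> D" "a \<in> A" using a assms(2) by blast+
    show "\<one> \<in> A - p" using central_prime_onD(6)[OF assms(3)] by (simp add: subringE[OF subring_A])
    fix q assume "central_prime_on R D q"
    then show "\<one> \<otimes> a \<ominus> a \<in> q" using central_prime_onD(3) A_carrier[OF a] by (simp add: a_minus_def r_neg)
  qed
qed

lemma subring_central_gluing:
  assumes D: "subring D R" "A \<subseteq> D" and p: "central_prime_on R A p"
  shows "subring (central_gluing D p) R"
proof (rule subringI)
  have cr: "z \<in> carrier R" if "z \<in> D" for z using that subringE(1)[OF D(1)] by blast
  show "central_gluing D p \<subseteq> carrier R" using cr by (auto simp: central_gluing_def)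
  show "\<one> \<in> central_gluing D p" using subset_central_gluing[OF assms] subringE(3)[OF subring_A] by blast
next
  have cr: "z \<in> carrier R" if "z \<in> D" for z using that subringE(1)[OF D(1)] by blast
  fix x assume "x \<in> central_gluing D p"
  then obtain u s where x: "x \<in> D" "u \<in> A" "s \<in> A - p"
    and q: "\<And>q. central_prime_on R D q \<Longrightarrow> q \<inter> A = p \<Longrightarrow> s \<otimes> x \<ominus> u \<in> q"
    by (rule central_gluingE) blast
  have xc: "x \<in> carrier R" "u \<in> carrier R" "s \<in> carrier R" using x cr A_carrier by blast+
  show "\<ominus> x \<in> central_gluing D p"
  proof (rule central_gluingI)
    show "\<ominus> x \<in> D" "\<ominus> u \<in> A" using x by (simp_all add: subringE[OF D(1)] subringE[OF subring_A])
    show "s \<in> A - p" by fact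
    fix q' assume q': "central_prime_on R D q'" "q' \<inter> A = p"
    have "s \<otimes> \<ominus> x \<ominus> \<ominus> u = \<ominus> (s \<otimes> x \<ominus> u)" using xc by algebra
    then show "s \<otimes> \<ominus> x \<ominus> \<ominus> u \<in> q'"
      using ideal_on_minus[OF D(1) central_prime_onD(1)[OF q'(1)] q[OF q']] by simp
  qed
  fix y assume "y \<in> central_gluing D p"
  then obtain v t where y: "y \<in> D" "v \<in> A" "t \<in> A - p"
    and r: "\<And>q. central_prime_on R D q \<Longrightarrow> q \<inter> A = p \<Longrightarrow> t \<otimes> y \<ominus> v \<in> q"
    by (rule central_gluingE) blast
  have yc: "y \<in> carrier R" "v \<in> carrier R" "t \<in> carrier R" using y cr A_carrier by blast+
  have st: "s \<otimes> t \<in> A - p"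
    using x(3) y(3) central_prime_onD(7)[OF p, of s t] by (auto simp: subringE[OF subring_A])
  have inD: "s \<in> D" "t \<in> D" "u \<in> D" using x y D(2) by blast+
  show "x \<otimes> y \<in> central_gluing D p"
  proof (rule central_gluingI[OF _ _ st])
    show "x \<otimes> y \<in> D" "u \<otimes> v \<in> A" using x y by (simp_all add: subringE[OF D(1)] subringE[OF subring_A])
    fix q' assume q': "central_prime_on R D q'" "q' \<inter> A = p"
    have "(s \<otimes> t) \<otimes> (x \<otimes> y) \<ominus> u \<otimes> v = (t \<otimes> y) \<otimes> (s \<otimes> x \<ominus> u) \<oplus> u \<otimes> (t \<otimes> y \<ominus> v)"
      using xc yc by algebra
    then show "(s \<otimes> t) \<otimes> (x \<otimes> y) \<ominus> u \<otimes> v \<in> q'"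
      using q[OF q'] r[OF q'] inD y(1) central_prime_onD(4,5)[OF q'(1)] by (simp add: subringE[OF D(1)])
  qed
  show "x \<oplus> y \<in> central_gluing D p"
  proof (rule central_gluingI[OF _ _ st])
    show "x \<oplus> y \<in> D" "t \<otimes> u \<oplus> s \<otimes> v \<in> A"
      using x y by (simp_all add: subringE[OF D(1)] subringE[OF subring_A])
    fix q' assume q': "central_prime_on R D q'" "q' \<inter> A = p"
    have "(s \<otimes> t) \<otimes> (x \<oplus> y) \<ominus> (t \<otimes> u \<oplus> s \<otimes> v) = t \<otimes> (s \<otimes> x \<ominus> u) \<oplus> s \<otimes> (t \<otimes> y \<ominus> v)"
      using xc yc by algebra
    then show "(s \<otimes> t) \<otimes> (x \<oplus> y) \<ominus> (t \<otimes> u \<oplus> s \<otimes> v) \<in> q'"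
      using q[OF q'] r[OF q'] inD central_prime_onD(4,5)[OF q'(1)] by (simp add: subringE[OF D(1)])
  qed
qed

section \<open>The simultaneous gluing over all central primes of A\<close>

text \<open>A description without any choice or order of primes, against which the successive
  gluings are compared.\<close>

definition central_closure :: "'a set" where
  "central_closure = {b \<in> carrier R. \<forall>p. central_prime_on R A p \<longrightarrow> b \<in> central_gluing (carrier R) p}"

lemma subring_central_closure: "subring central_closure R"
proof -
  have sub: "subring (central_gluing (carrier R) p) R" if "central_prime_on R A p" for p
    using subring_central_gluing[OF carrier_is_subring _ that] A_carrier by blast
  show ?thesis
    by (rule subringI) (auto simp: central_closure_def subringE[OF sub])
qed

lemma A_subset_central_closure: "A \<subseteq> central_closure"
  unfolding central_closure_def
  using subset_central_gluing[OF carrier_is_subring] A_carrier by blast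

text \<open>Every central prime of D over p is the trace of one of R, so a fraction that works at
  all primes of R over p works at those of D. For D the closure itself, this says that gluing it
  over p changes nothing.\<close>

lemma central_closure_subset_gluing:
  assumes D: "subring D R" "central_closure \<subseteq> D" and p: "central_prime_on R A p"
  shows "central_closure \<subseteq> central_gluing D p"
proof
  fix b assume b: "b \<in> central_closure"
  have AD: "A \<subseteq> D" using A_subset_central_closure D(2) by blast
  have "b \<in> central_gluing (carrier R) p" using b p by (auto simp: central_closure_def)
  then obtain u s where us: "u \<in> A" "s \<in> A - p"
    and q: "\<And>q. central_prime_on R (carrier R) q \<Longrightarrow> q \<inter> A = p \<Longrightarrow> s \<otimes> b \<ominus> u \<in> q"
    by (rule central_gluingE) blast
  show "b \<in> central_gluing D p"
  proof (rule central_gluingI[OF _ us])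
    show bD: "b \<in> D" using b D(2) by blast
    fix r assume r: "central_prime_on R D r" "r \<inter> A = p"
    obtain q' where q': "central_prime_on R (carrier R) q'" "q' \<inter> D = r"
      using central_lying_over[OF carrier_is_subring D(1) AD subringE(1)[OF D(1)] r(1)] .
    then have "q' \<inter> A = p" using r(2) AD by blast
    from q[OF q'(1) this] have "s \<otimes> b \<ominus> u \<in> q'" .
    moreover have "s \<otimes> b \<ominus> u \<in> D" unfolding a_minus_def
      using us bD AD by (auto intro!: subringE(5-7)[OF D(1)])
    ultimately show "s \<otimes> b \<ominus> u \<in> r" using q'(2) by blast
  qed
qed

text \<open>A single fraction u/s serves all central primes with the same trace on A as r. At r
  alone it yields surjectivity of the residue field map; at two primes it shows that they
  coincide.\<close>

lemma central_closure_residue: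
  assumes r: "central_prime_on R central_closure r" and b: "b \<in> central_closure"
  obtains u s where "u \<in> A" "s \<in> A - r"
    "\<And>q. central_prime_on R central_closure q \<Longrightarrow> q \<inter> A = r \<inter> A \<Longrightarrow> s \<otimes> b \<ominus> u \<in> q"
proof -
  have "central_prime_on R A (r \<inter> A)"
    by (rule central_prime_on_contract[OF r subring_A A_subset_central_closure])
  then have "b \<in> central_gluing central_closure (r \<inter> A)"
    using central_closure_subset_gluing[OF subring_central_closure] b by blast
  then show thesis using that by (elim central_gluingE) blast
qed

text \<open>For b in r the common numerator u is in r \<inter> A = q \<inter> A, so s b is in q
  although s is not.\<close>

lemma central_closure_prime_subset:
  assumes r: "central_prime_on R central_closure r" and q: "central_prime_on R central_closure q"
    and "r \<inter> A = q \<inter> A"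
  shows "r \<subseteq> q"
proof
  fix b assume b: "b \<in> r"
  have bC: "b \<in> central_closure" using b central_prime_onD(2)[OF r] by blast
  obtain u s where us: "u \<in> A" "s \<in> A - r"
    and all: "\<And>q. central_prime_on R central_closure q \<Longrightarrow> q \<inter> A = r \<inter> A \<Longrightarrow> s \<otimes> b \<ominus> u \<in> q"
    using central_closure_residue[OF r bC] by metis
  have C: "s \<in> central_closure" "u \<in> central_closure" using us A_subset_central_closure by blast+
  have sb: "s \<otimes> b \<in> central_closure" using C bC by (simp add: subringE[OF subring_central_closure])
  have "s \<otimes> b \<in> r" using central_prime_onD(5)[OF r C(1) b] .
  then have "u \<in> r"
    using all[OF r refl] ideal_on_diff_mem[OF subring_central_closure central_prime_onD(1)[OF r] sb C(2)] by blast
  then have "u \<in> q" using us assms(3) by blast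
  then have "s \<otimes> b \<in> q"
    using all[OF q] ideal_on_diff_mem[OF subring_central_closure central_prime_onD(1)[OF q] sb C(2)] assms(3) by simp
  then show "b \<in> q" using central_prime_onD(7)[OF q C(1) bC] us assms(3) by blast
qed

text \<open>Exactly one central prime r of D lies over p. All central primes of R over p therefore
  have trace r on D, and a fraction for b at r works at each of them.\<close>

lemma central_closure_greatest:
  assumes D: "subring D R" "A \<subseteq> D"
    and inj: "\<And>q r. central_prime_on R D q \<Longrightarrow> central_prime_on R D r \<Longrightarrow> q \<inter> A = r \<inter> A \<Longrightarrow> q = r"
    and res: "\<And>r b. central_prime_on R D r \<Longrightarrow> b \<in> D \<Longrightarrow> \<exists>u \<in> A. \<exists>s \<in> A - r. s \<otimes> b \<ominus> u \<in> r"
  shows "D \<subseteq> central_closure"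
proof
  fix b assume b: "b \<in> D"
  have bc: "b \<in> carrier R" using b subringE(1)[OF D(1)] by blast
  have "b \<in> central_gluing (carrier R) p" if p: "central_prime_on R A p" for p
  proof -
    obtain r where r: "central_prime_on R D r" "r \<inter> A = p"
      using central_lying_over[OF D(1) subring_A subset_refl D(2) p] .
    obtain u s where us: "u \<in> A" "s \<in> A - r" "s \<otimes> b \<ominus> u \<in> r" using res[OF r(1) b] by blast
    show ?thesis
    proof (rule central_gluingI[OF bc us(1)])
      show "s \<in> A - p" using us r by blast
      fix q assume q: "central_prime_on R (carrier R) q" "q \<inter> A = p"
      have "central_prime_on R D (q \<inter> D)"
        using central_prime_on_contract[OF q(1) D(1) subringE(1)[OF D(1)]] .
      moreover have "q \<inter> D \<inter> A = r \<inter> A" using q r D(2) by blast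
      ultimately have "q \<inter> D = r" using inj r(1) by blast
      then show "s \<otimes> b \<ominus> u \<in> q" using us(3) by blast
    qed
  qed
  then show "b \<in> central_closure" using bc by (auto simp: central_closure_def)
qed

end

section \<open>Noetherian modules\<close>

definition module_on :: "('a, 'm) ring_scheme \<Rightarrow> 'a set \<Rightarrow> 'a set \<Rightarrow> bool" where
  "module_on R A N \<longleftrightarrow> N \<subseteq> carrier R \<and> \<zero>\<^bsub>R\<^esub> \<in> N \<and> (\<forall>x\<in>N. \<forall>y\<in>N. x \<oplus>\<^bsub>R\<^esub> y \<in> N) \<and>
     (\<forall>a\<in>A. \<forall>x\<in>N. a \<otimes>\<^bsub>R\<^esub> x \<in> N)"

lemma module_onD:
  assumes "module_on R A N"
  shows "N \<subseteq> carrier R" "\<zero>\<^bsub>R\<^esub> \<in> N" "\<And>x y. x \<in> N \<Longrightarrow> y \<in> N \<Longrightarrow> x \<oplus>\<^bsub>R\<^esub> y \<in> N"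
    "\<And>a x. a \<in> A \<Longrightarrow> x \<in> N \<Longrightarrow> a \<otimes>\<^bsub>R\<^esub> x \<in> N"
  using assms by (auto simp: module_on_def)

definition noetherian_on :: "('a, 'm) ring_scheme \<Rightarrow> 'a set \<Rightarrow> bool" where
  "noetherian_on R A \<longleftrightarrow> (\<forall>I. ideal_on R A I \<longrightarrow> (\<exists>F. finite F \<and> F \<subseteq> I \<and> I \<subseteq> combinations R A F))"

lemma combinations_mono:
  assumes "x \<in> combinations R A G" "G \<subseteq> H"
  shows "x \<in> combinations R A H"
  using assms(1) by induction (use assms(2) in \<open>auto intro: combinations.intros\<close>)

lemma combinations_least:
  assumes "module_on R A N" "G \<subseteq> N" "x \<in> combinations R A G"
  shows "x \<in> N"
  using assms(3) by induction (use assms(1,2) module_onD[OF assms(1)] in blast)+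

context cring
begin

lemma module_on_combinations:
  assumes A: "subring A R" and G: "G \<subseteq> carrier R"
  shows "module_on R A (combinations R A G)"
proof -
  have cr: "z \<in> carrier R" if "z \<in> A" for z using that subringE(1)[OF A] by blast
  have c: "x \<in> carrier R" if "x \<in> combinations R A G" for x
    using that by induction (use G cr in auto)
  have add: "x \<oplus> y \<in> combinations R A G"
    if "x \<in> combinations R A G" and y: "y \<in> combinations R A G" for x y
    using that(1)
  proof induction
    case zero then show ?case using y c[OF y] by simp
  next
    case (add_mult a g x)
    have "a \<otimes> g \<oplus> x \<oplus> y = a \<otimes> g \<oplus> (x \<oplus> y)"
      using add_mult(1,2) cr G c[OF add_mult(3)] c[OF y] by (intro a_assoc) auto
    then show ?case using combinations.add_mult[OF add_mult(1,2,4)] by simp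
  qed
  have mult: "d \<otimes> y \<in> combinations R A G" if d: "d \<in> A" and "y \<in> combinations R A G" for d y
    using that(2)
  proof induction
    case zero then show ?case using d cr by (simp add: combinations.zero)
  next
    case (add_mult a g x)
    have "a \<in> carrier R" "g \<in> carrier R" "x \<in> carrier R" "d \<in> carrier R"
      using add_mult cr G c d by blast+
    then have "d \<otimes> (a \<otimes> g \<oplus> x) = (d \<otimes> a) \<otimes> g \<oplus> d \<otimes> x" by algebra
    then show ?case
      using combinations.add_mult[of "d \<otimes> a" A g G "d \<otimes> x" R] add_mult d
      by (simp add: subringE[OF A])
  qed
  show ?thesis unfolding module_on_def using c add mult combinations.zero by blast
qed

lemma generators_combinations:
  assumes A: "subring A R" and G: "G \<subseteq> carrier R"
  shows "G \<subseteq> combinations R A G"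
proof
  fix g assume g: "g \<in> G"
  then have "\<one> \<otimes> g \<oplus> \<zero> \<in> combinations R A G"
    using combinations.add_mult[OF subringE(3)[OF A] g combinations.zero, where R=R] by simp
  then show "g \<in> combinations R A G" using g G by auto
qed

lemma module_on_minus:
  assumes A: "subring A R" and N: "module_on R A N" and x: "x \<in> N"
  shows "\<ominus> x \<in> N"
proof -
  have "x \<in> carrier R" using x module_onD(1)[OF N] by blast
  then have "\<ominus> x = \<ominus> \<one> \<otimes> x" by algebra
  then show ?thesis using module_onD(4)[OF N _ x] by (simp add: subringE[OF A])
qed

lemma combinations_insert:
  assumes A: "subring A R" and G: "G \<subseteq> carrier R" and g: "g \<in> carrier R"
    and x: "x \<in> combinations R A (insert g G)"
  shows "\<exists>a\<in>A. \<exists>y\<in>combinations R A G. x = a \<otimes> g \<oplus> y"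
  using x
proof induction
  case zero
  then show ?case using g subringE(2)[OF A] combinations.zero[of R A G]
    by (intro bexI[of _ \<zero>]) auto
next
  case (add_mult b h x)
  note M = module_onD[OF module_on_combinations[OF A G]]
  obtain a y where ay: "a \<in> A" "y \<in> combinations R A G" "x = a \<otimes> g \<oplus> y" using add_mult by blast
  have c: "a \<in> carrier R" "b \<in> carrier R" "y \<in> carrier R" "h \<in> carrier R"
    using ay add_mult(1,2) subringE(1)[OF A] M(1) G g by blast+
  show ?case
  proof (cases "h = g")
    case True
    have "b \<otimes> h \<oplus> x = (b \<oplus> a) \<otimes> g \<oplus> y" unfolding ay(3) True using c g by algebra
    then show ?thesis using ay add_mult(1) subringE(7)[OF A] by blast
  next
    case False
    then have "h \<in> G" using add_mult(2) by blast
    moreover have "b \<otimes> h \<oplus> x = a \<otimes> g \<oplus> (b \<otimes> h \<oplus> y)" unfolding ay(3) using c g by algebra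
    ultimately show ?thesis using ay add_mult(1) combinations.add_mult by metis
  qed
qed

text \<open>Induction on the generators: the coefficients of the new generator g in elements of N
  form an ideal of A, and the elements of N in the span of the old generators fall under the
  induction hypothesis.\<close>

lemma noetherian_submodule:
  assumes A: "subring A R" "noetherian_on R A" and "finite G"
    and "G \<subseteq> carrier R" "module_on R A N" "N \<subseteq> combinations R A G"
  shows "\<exists>F. finite F \<and> F \<subseteq> N \<and> N \<subseteq> combinations R A F"
  using assms(3-6)
proof (induction G arbitrary: N)
  case empty
  have "x = \<zero>" if "x \<in> combinations R A {}" for x using that by cases auto
  then have "N \<subseteq> combinations R A {}" using empty by blast
  then show ?case by blast
next
  case (insert g G)
  have G: "G \<subseteq> carrier R" and g: "g \<in> carrier R" using insert.prems by auto
  note N = module_onD[OF insert.prems(2)]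
  note M = module_onD[OF module_on_combinations[OF A(1) G]]
  note Mminus = module_on_minus[OF A(1) module_on_combinations[OF A(1) G]]
  note Nminus = module_on_minus[OF A(1) insert.prems(2)]
  have Ac: "a \<in> carrier R" if "a \<in> A" for a using that subringE(1)[OF A(1)] by blast
  have Mc: "x \<in> carrier R" if "x \<in> combinations R A G" for x using that M(1) by blast
  define I where "I = {a \<in> A. \<exists>x \<in> combinations R A G. a \<otimes> g \<oplus> x \<in> N}"
  have "ideal_on R A I"
  proof (rule ideal_onI)
    show "I \<subseteq> A" by (auto simp: I_def)
    have "\<zero> \<otimes> g \<oplus> \<zero> = \<zero>" using g by simp
    then show "\<zero> \<in> I" using N(2) M(2) subringE(2)[OF A(1)] unfolding I_def by force
  next
    fix a b assume "a \<in> I" "b \<in> I"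
    then obtain x y where x: "a \<in> A" "x \<in> combinations R A G" "a \<otimes> g \<oplus> x \<in> N"
      and y: "b \<in> A" "y \<in> combinations R A G" "b \<otimes> g \<oplus> y \<in> N" unfolding I_def by blast
    have "(a \<oplus> b) \<otimes> g \<oplus> (x \<oplus> y) = (a \<otimes> g \<oplus> x) \<oplus> (b \<otimes> g \<oplus> y)"
      using Ac[OF x(1)] Ac[OF y(1)] Mc[OF x(2)] Mc[OF y(2)] g by algebra
    then have "(a \<oplus> b) \<otimes> g \<oplus> (x \<oplus> y) \<in> N" using N(3) x(3) y(3) by simp
    moreover have "x \<oplus> y \<in> combinations R A G" using M(3) x y by blast
    ultimately show "a \<oplus> b \<in> I" using x(1) y(1) unfolding I_def by (auto simp: subringE[OF A(1)])
  next
    fix b a assume b: "b \<in> A" and "a \<in> I"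
    then obtain x where x: "a \<in> A" "x \<in> combinations R A G" "a \<otimes> g \<oplus> x \<in> N" unfolding I_def by blast
    have "(b \<otimes> a) \<otimes> g \<oplus> b \<otimes> x = b \<otimes> (a \<otimes> g \<oplus> x)"
      using Ac[OF x(1)] Ac[OF b] Mc[OF x(2)] g by algebra
    then have "(b \<otimes> a) \<otimes> g \<oplus> b \<otimes> x \<in> N" using N(4)[OF b] x(3) by simp
    moreover have "b \<otimes> x \<in> combinations R A G" using M(4) x b by blast
    ultimately show "b \<otimes> a \<in> I" using x(1) b unfolding I_def by (auto simp: subringE[OF A(1)])
  qed
  then obtain F where F: "finite F" "F \<subseteq> I" "I \<subseteq> combinations R A F"
    using A(2) unfolding noetherian_on_def by blast
  have "\<forall>a\<in>F. \<exists>x \<in> combinations R A G. a \<otimes> g \<oplus> x \<in> N" using F(2) unfolding I_def by blast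
  then obtain e where e: "\<And>a. a \<in> F \<Longrightarrow> e a \<in> combinations R A G"
    "\<And>a. a \<in> F \<Longrightarrow> a \<otimes> g \<oplus> e a \<in> N" by metis
  \<comment> \<open>Elements of N that realise the generators of \<open>I\<close> as coefficients of
    g.\<close>
  define H where "H = (\<lambda>a. a \<otimes> g \<oplus> e a) ` F"
  have H: "finite H" "H \<subseteq> N" using F(1) e by (auto simp: H_def)
  have Hc: "H \<subseteq> carrier R" using H N(1) by blast
  have "module_on R A (N \<inter> combinations R A G)"
    unfolding module_on_def using N M by auto
  then obtain F' where F': "finite F'" "F' \<subseteq> N \<inter> combinations R A G"
    "N \<inter> combinations R A G \<subseteq> combinations R A F'"
    using insert.IH[OF G] by (metis inf_le2)
  have FA: "F \<subseteq> A" using F(2) by (auto simp: I_def)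
  have Amod: "module_on R A A"
    unfolding module_on_def by (auto simp: subringE[OF A(1)] Ac)
  have lift: "\<exists>m \<in> combinations R A H. m \<ominus> a \<otimes> g \<in> combinations R A G" if "a \<in> combinations R A F" for a
    using that
  proof induction
    case zero
    then show ?case using combinations.zero[of R A H] M(2) g by (intro bexI[of _ \<zero>]) (auto simp: a_minus_def)
  next
    case (add_mult b f a)
    then obtain m where m: "m \<in> combinations R A H" "m \<ominus> a \<otimes> g \<in> combinations R A G" by blast
    have mc: "m \<in> carrier R" using m(1) module_onD(1)[OF module_on_combinations[OF A(1) Hc]] by blast
    have ac: "a \<in> A"
      using combinations_least[OF Amod FA add_mult(3)] .
    have f: "f \<in> F" by fact
    have fc: "f \<in> carrier R" "b \<in> carrier R" "a \<in> carrier R" "e f \<in> carrier R"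
      using f FA add_mult(1) ac Ac e(1)[OF f] Mc by blast+
    have "b \<otimes> (f \<otimes> g \<oplus> e f) \<oplus> m \<in> combinations R A H"
      using combinations.add_mult[OF add_mult(1) _ m(1), of "f \<otimes> g \<oplus> e f"] f by (simp add: H_def)
    moreover have "b \<otimes> (f \<otimes> g \<oplus> e f) \<oplus> m \<ominus> (b \<otimes> f \<oplus> a) \<otimes> g = b \<otimes> e f \<oplus> (m \<ominus> a \<otimes> g)"
      using fc mc g by algebra
    moreover have "\<dots> \<in> combinations R A G"
      using M(3,4) e(1)[OF f] m(2) add_mult(1) by blast
    ultimately show ?case by metis
  qed
  have "n \<in> combinations R A (H \<union> F')" if n: "n \<in> N" for n
  proof -
    obtain a x where ax: "a \<in> A" "x \<in> combinations R A G" "n = a \<otimes> g \<oplus> x"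
      using combinations_insert[OF A(1) G g, of n] n insert.prems(3) by blast
    then have "a \<in> I" using n unfolding I_def by blast
    then obtain m where m: "m \<in> combinations R A H" "m \<ominus> a \<otimes> g \<in> combinations R A G"
      using lift F(3) by blast
    have mN: "m \<in> N" using combinations_least[OF insert.prems(2) H(2) m(1)] .
    have c: "m \<in> carrier R" "a \<in> carrier R" "x \<in> carrier R" using mN N(1) Ac ax Mc by blast+
    \<comment> \<open>Subtracting m cancels the coefficient of g, which leaves an element of N in
      the span of G.\<close>
    have "n \<oplus> \<ominus> m \<in> N" using N(3)[OF n Nminus[OF mN]] .
    moreover have "n \<oplus> \<ominus> m = x \<oplus> \<ominus> (m \<ominus> a \<otimes> g)" unfolding ax(3) using c g by algebra
    moreover have "\<dots> \<in> combinations R A G" using M(3) ax(2) Mminus[OF m(2)] by blast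
    ultimately have "n \<oplus> \<ominus> m \<in> combinations R A F'" using F'(3) by auto
    then have 1: "n \<oplus> \<ominus> m \<in> combinations R A (H \<union> F')" by (rule combinations_mono) blast
    have 2: "m \<in> combinations R A (H \<union> F')" using m(1) by (rule combinations_mono) blast
    have "H \<union> F' \<subseteq> carrier R" using H F' N(1) by blast
    from module_onD(3)[OF module_on_combinations[OF A(1) this] 1 2]
    have "n \<oplus> \<ominus> m \<oplus> m \<in> combinations R A (H \<union> F')" .
    moreover have "n \<in> carrier R" using n N(1) by blast
    then have "n \<oplus> \<ominus> m \<oplus> m = n" using c by algebra
    ultimately show ?thesis by simp
  qed
  then show ?case using H F' by (intro exI[of _ "H \<union> F'"]) auto
qed

text \<open>The larger ideal is the smaller element of the relation: recursion climbs, and minimal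
  elements are the maximal members of a family of ideals.\<close>

lemma wf_noetherian_on:
  assumes A: "subring A R" "noetherian_on R A"
  shows "wf {(J, I). ideal_on R A I \<and> ideal_on R A J \<and> I \<subset> J}"
  unfolding wf_iff_no_infinite_down_chain
proof safe
  fix f assume f: "\<forall>i. (f (Suc i), f i) \<in> {(J, I). ideal_on R A I \<and> ideal_on R A J \<and> I \<subset> J}"
  have id: "ideal_on R A (f i)" and st: "f i \<subset> f (Suc i)" for i using f by auto
  have mono: "f i \<subseteq> f j" if "i \<le> j" for i j
    using lift_Suc_mono_le[of f, OF _ that] st by blast
  have "ideal_on R A (\<Union>i. f i)"
  proof (rule ideal_onI)
    show "(\<Union>i. f i) \<subseteq> A" using ideal_onD(1)[OF id] by blast
    show "\<zero> \<in> (\<Union>i. f i)" using ideal_onD(2)[OF id] by blast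
    fix x y assume y: "y \<in> (\<Union>i. f i)"
    show "x \<oplus> y \<in> (\<Union>i. f i)" if x: "x \<in> (\<Union>i. f i)"
    proof -
      obtain i j where "x \<in> f i" "y \<in> f j" using x y by blast
      then have "x \<in> f (max i j)" "y \<in> f (max i j)" using mono max.cobounded1 max.cobounded2 by blast+
      then show ?thesis using ideal_onD(3)[OF id] by blast
    qed
    show "x \<otimes> y \<in> (\<Union>i. f i)" if "x \<in> A" using y that ideal_onD(4)[OF id] by blast
  qed
  then obtain F where F: "finite F" "F \<subseteq> (\<Union>i. f i)" "(\<Union>i. f i) \<subseteq> combinations R A F"
    using A(2) unfolding noetherian_on_def by blast
  have "\<exists>k. F \<subseteq> f k"
    using F(1,2)
  proof (induction F)
    case (insert a F)
    then obtain k j where "F \<subseteq> f k" "a \<in> f j" by auto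
    then show ?case using mono[of k "max k j"] mono[of j "max k j"]
      by (intro exI[of _ "max k j"]) auto
  qed auto
  then obtain k where k: "F \<subseteq> f k" by blast
  have "module_on R A (f k)"
    unfolding module_on_def using ideal_onD[OF id[of k]] subringE(1)[OF A(1)] by blast
  then have "(\<Union>i. f i) \<subseteq> f k" using combinations_least[OF _ k] F(3) by blast
  then show False using st[of k] by blast
qed

end

section \<open>Bounding squares by means of finitely many module generators\<close>

context domain
begin

text \<open>
  For a generating family of which one element is \<open>1\<close>, the sum \<open>\<gamma>\<close> of the squares of its
  elements replaces the determinant trick: the square of every element is dominated by
  \<open>\<alpha> \<gamma>\<close> with \<open>\<alpha>\<close> in \<open>A\<close>. Applied to \<open>t g\<close> for all generators \<open>g\<close>, this gives
  \<open>t\<^sup>2 \<gamma> \<le> \<alpha> \<gamma>\<close>, and \<open>\<gamma>\<close> cancels.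
\<close>

lemma sum_of_generator_squares:
  assumes A: "subring A R" and "finite G" "G \<subseteq> carrier R"
  shows "\<exists>\<gamma>\<in>square_cone R. (\<forall>g\<in>G. \<gamma> \<ominus> g \<otimes> g \<in> square_cone R) \<and>
    (\<forall>t\<in>carrier R. \<forall>d\<in>carrier R.
      (\<forall>g\<in>G. \<exists>\<alpha>\<in>A \<inter> square_cone R. \<alpha> \<otimes> d \<ominus> (t \<otimes> g) \<otimes> (t \<otimes> g) \<in> square_cone R) \<longrightarrow>
      (\<exists>\<alpha>\<in>A \<inter> square_cone R. \<alpha> \<otimes> d \<ominus> t \<otimes> t \<otimes> \<gamma> \<in> square_cone R))"
  using assms(2,3)
proof (induction G)
  case empty
  have "\<zero> \<in> A \<inter> square_cone R" using subringE(2)[OF A] zero_square_cone by blast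
  moreover have "\<zero> \<otimes> d \<ominus> t \<otimes> t \<otimes> \<zero> \<in> square_cone R" if "t \<in> carrier R" "d \<in> carrier R" for t d
    using that zero_square_cone by (simp add: a_minus_def)
  ultimately show ?case
    by (intro bexI[of _ \<zero>] conjI ballI impI) (auto simp: zero_square_cone)
next
  case (insert h G)
  have h: "h \<in> carrier R" using insert.prems by blast
  obtain \<gamma> where g: "\<gamma> \<in> square_cone R" "\<And>g. g \<in> G \<Longrightarrow> \<gamma> \<ominus> g \<otimes> g \<in> square_cone R"
    and t: "\<And>t d. t \<in> carrier R \<Longrightarrow> d \<in> carrier R \<Longrightarrow>
      \<forall>g\<in>G. \<exists>\<alpha>\<in>A \<inter> square_cone R. \<alpha> \<otimes> d \<ominus> (t \<otimes> g) \<otimes> (t \<otimes> g) \<in> square_cone R \<Longrightarrow>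
      \<exists>\<alpha>\<in>A \<inter> square_cone R. \<alpha> \<otimes> d \<ominus> t \<otimes> t \<otimes> \<gamma> \<in> square_cone R"
    using insert.IH insert.prems by auto
  have gc: "\<gamma> \<in> carrier R" using g(1) by (rule square_cone_carrier)
  show ?case
  proof (rule bexI[of _ "h \<otimes> h \<oplus> \<gamma>"], intro conjI ballI impI)
    show "h \<otimes> h \<oplus> \<gamma> \<in> square_cone R" using g(1) h by (simp add: square_cone_add square_square_cone)
    fix f assume f: "f \<in> insert h G"
    have fc: "f \<in> carrier R" using f insert.prems by blast
    show "h \<otimes> h \<oplus> \<gamma> \<ominus> f \<otimes> f \<in> square_cone R"
    proof (cases "f = h")
      case True
      have "h \<otimes> h \<oplus> \<gamma> \<ominus> f \<otimes> f = \<gamma>" unfolding True using h gc by algebra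
      then show ?thesis using g(1) by simp
    next
      case False
      have "h \<otimes> h \<oplus> \<gamma> \<ominus> f \<otimes> f = h \<otimes> h \<oplus> (\<gamma> \<ominus> f \<otimes> f)" using h gc fc by algebra
      then show ?thesis using False f g(2) h by (simp add: square_cone_add square_square_cone)
    qed
  next
    \<comment> \<open>d stays arbitrary during the induction; only afterwards is it replaced by the
      \<gamma> of the full set of generators.\<close>
    fix s d assume s: "s \<in> carrier R" and d: "d \<in> carrier R"
      and all: "\<forall>g\<in>insert h G. \<exists>\<alpha>\<in>A \<inter> square_cone R. \<alpha> \<otimes> d \<ominus> (s \<otimes> g) \<otimes> (s \<otimes> g) \<in> square_cone R"
    obtain \<alpha> where a: "\<alpha> \<in> A" "\<alpha> \<in> square_cone R" "\<alpha> \<otimes> d \<ominus> s \<otimes> s \<otimes> \<gamma> \<in> square_cone R"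
      using t[OF s d] all by blast
    obtain \<beta> where b: "\<beta> \<in> A" "\<beta> \<in> square_cone R" "\<beta> \<otimes> d \<ominus> (s \<otimes> h) \<otimes> (s \<otimes> h) \<in> square_cone R"
      using all by blast
    have "\<alpha> \<in> carrier R" "\<beta> \<in> carrier R" using a b square_cone_carrier by blast+
    then have "(\<beta> \<oplus> \<alpha>) \<otimes> d \<ominus> s \<otimes> s \<otimes> (h \<otimes> h \<oplus> \<gamma>) =
        (\<beta> \<otimes> d \<ominus> (s \<otimes> h) \<otimes> (s \<otimes> h)) \<oplus> (\<alpha> \<otimes> d \<ominus> s \<otimes> s \<otimes> \<gamma>)"
      using s d h gc by algebra
    then have "(\<beta> \<oplus> \<alpha>) \<otimes> d \<ominus> s \<otimes> s \<otimes> (h \<otimes> h \<oplus> \<gamma>) \<in> square_cone R"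
      using a b by (simp add: square_cone_add)
    then show "\<exists>\<alpha>\<in>A \<inter> square_cone R. \<alpha> \<otimes> d \<ominus> s \<otimes> s \<otimes> (h \<otimes> h \<oplus> \<gamma>) \<in> square_cone R"
      using a b by (intro bexI[of _ "\<beta> \<oplus> \<alpha>"]) (auto simp: square_cone_add subringE[OF A])
  qed
qed

lemma bounded_extensionI:
  assumes A: "subring A R" and G: "finite G" "G \<subseteq> carrier R" "carrier R \<subseteq> combinations R A G"
    and real: "\<ominus> \<one> \<notin> square_cone R"
  shows "bounded_extension R A"
proof (intro bounded_extension.intro bounded_extension_axioms.intro domain_axioms)
  show "subring A R" by fact
  fix t assume t: "t \<in> carrier R"
  \<comment> \<open>The extra generator 1 makes \<gamma> nonzero, since \<gamma> = 0 would put -1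
    into the cone.\<close>
  have G1: "finite (insert \<one> G)" "insert \<one> G \<subseteq> carrier R" using G by auto
  obtain \<gamma> where g: "\<gamma> \<in> square_cone R" "\<And>g. g \<in> insert \<one> G \<Longrightarrow> \<gamma> \<ominus> g \<otimes> g \<in> square_cone R"
    and all: "\<And>t d. t \<in> carrier R \<Longrightarrow> d \<in> carrier R \<Longrightarrow>
      \<forall>g\<in>insert \<one> G. \<exists>\<alpha>\<in>A \<inter> square_cone R. \<alpha> \<otimes> d \<ominus> (t \<otimes> g) \<otimes> (t \<otimes> g) \<in> square_cone R \<Longrightarrow>
      \<exists>\<alpha>\<in>A \<inter> square_cone R. \<alpha> \<otimes> d \<ominus> t \<otimes> t \<otimes> \<gamma> \<in> square_cone R"
    using sum_of_generator_squares[OF A G1] by metis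
  have gc: "\<gamma> \<in> carrier R" using g(1) by (rule square_cone_carrier)
  have "\<gamma> \<noteq> \<zero>"
  proof
    assume "\<gamma> = \<zero>"
    then have "\<zero> \<ominus> \<one> \<otimes> \<one> \<in> square_cone R" using g(2)[of \<one>] by simp
    then show False using real by (simp add: a_minus_def)
  qed
  \<comment> \<open>Induction along the combination: h^2 <= \<gamma> and y^2 <= \<alpha> \<gamma>
    give (a h + y)^2 <= 2 (a^2 + \<alpha>) \<gamma>.\<close>
  have dom: "\<exists>\<alpha>\<in>A \<inter> square_cone R. \<alpha> \<otimes> \<gamma> \<ominus> x \<otimes> x \<in> square_cone R" if "x \<in> carrier R" for x
  proof -
    have "x \<in> combinations R A G" using that G(3) by blast
    then have "x \<in> carrier R \<and> (\<exists>\<alpha>\<in>A \<inter> square_cone R. \<alpha> \<otimes> \<gamma> \<ominus> x \<otimes> x \<in> square_cone R)"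
    proof induction
      case zero
      then show ?case using gc subringE(2)[OF A] zero_square_cone
        by (auto intro!: bexI[of _ \<zero>] simp: a_minus_def)
    next
      case (add_mult a h y)
      obtain \<alpha> where al: "\<alpha> \<in> A" "\<alpha> \<in> square_cone R" "\<alpha> \<otimes> \<gamma> \<ominus> y \<otimes> y \<in> square_cone R" "y \<in> carrier R"
        using add_mult by blast
      have h: "\<gamma> \<ominus> h \<otimes> h \<in> square_cone R" using g(2) add_mult(2) by blast
      have c: "a \<in> carrier R" "h \<in> carrier R" "\<alpha> \<in> carrier R"
        using add_mult(1,2) subringE(1)[OF A] G(2) al(1) by blast+
      let ?b = "a \<otimes> a \<oplus> \<alpha>"
      have "(?b \<oplus> ?b) \<otimes> \<gamma> \<ominus> (a \<otimes> h \<oplus> y) \<otimes> (a \<otimes> h \<oplus> y) =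
          a \<otimes> a \<otimes> (\<gamma> \<ominus> h \<otimes> h) \<oplus> a \<otimes> a \<otimes> (\<gamma> \<ominus> h \<otimes> h) \<oplus> (\<alpha> \<otimes> \<gamma> \<ominus> y \<otimes> y) \<oplus> (\<alpha> \<otimes> \<gamma> \<ominus> y \<otimes> y)
            \<oplus> (a \<otimes> h \<ominus> y) \<otimes> (a \<otimes> h \<ominus> y)"
        using c al(4) gc by algebra
      also have "\<dots> \<in> square_cone R"
        using c al h by (intro square_cone_add square_cone_mult[OF square_square_cone] square_square_cone) auto
      finally have "(?b \<oplus> ?b) \<otimes> \<gamma> \<ominus> (a \<otimes> h \<oplus> y) \<otimes> (a \<otimes> h \<oplus> y) \<in> square_cone R" .
      moreover have "?b \<oplus> ?b \<in> A \<inter> square_cone R"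
        using add_mult(1) al c by (auto simp: subringE[OF A] square_cone_add square_square_cone)
      ultimately show ?case using c al(4) by blast
    qed
    then show ?thesis by blast
  qed
  have "\<forall>g\<in>insert \<one> G. \<exists>\<alpha>\<in>A \<inter> square_cone R. \<alpha> \<otimes> \<gamma> \<ominus> (t \<otimes> g) \<otimes> (t \<otimes> g) \<in> square_cone R"
    using dom t G1(2) by blast
  then obtain \<alpha> where al: "\<alpha> \<in> A" "\<alpha> \<in> square_cone R" "\<alpha> \<otimes> \<gamma> \<ominus> t \<otimes> t \<otimes> \<gamma> \<in> square_cone R"
    using all[OF t gc] by blast
  have ac: "\<alpha> \<in> carrier R" using al(2) by (rule square_cone_carrier)
  have "\<gamma> \<otimes> (\<alpha> \<ominus> t \<otimes> t) = \<alpha> \<otimes> \<gamma> \<ominus> t \<otimes> t \<otimes> \<gamma>" using ac t gc by algebra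
  then have "\<alpha> \<ominus> t \<otimes> t \<in> square_cone R"
    using square_cone_cancel[OF g(1) \<open>\<gamma> \<noteq> \<zero>\<close>, of "\<alpha> \<ominus> t \<otimes> t"] al(3) ac t by simp
  then show "\<exists>a\<in>A \<inter> square_cone R. a \<ominus> t \<otimes> t \<in> square_cone R" using al by blast
qed

end

section \<open>Conductors and the gluing sequence\<close>

locale noetherian_bounded_extension = bounded_extension +
  assumes noetherian: "noetherian_on R A"
    and finitely_generated: "\<exists>G. finite G \<and> G \<subseteq> carrier R \<and> carrier R \<subseteq> combinations R A G"
begin

definition conductor :: "'a set \<Rightarrow> 'a set" where
  "conductor D = {x \<in> D. \<forall>y\<in>D. x \<otimes> y \<in> central_closure}"

lemma conductor_ideal:
  assumes D: "subring D R"
  shows "ideal_on R D (conductor D)"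
proof (rule ideal_onI)
  have cr: "z \<in> carrier R" if "z \<in> D" for z using that subringE(1)[OF D] by blast
  note C = subringE[OF subring_central_closure]
  show "conductor D \<subseteq> D" by (auto simp: conductor_def)
  show "\<zero> \<in> conductor D" using cr by (auto simp: conductor_def subringE[OF D] C)
  fix x y assume y: "y \<in> conductor D"
  show "x \<oplus> y \<in> conductor D" if "x \<in> conductor D"
    using that y cr by (auto simp: conductor_def subringE[OF D] C l_distr)
  show "x \<otimes> y \<in> conductor D" if x: "x \<in> D"
  proof -
    have "x \<otimes> y \<otimes> z \<in> central_closure" if z: "z \<in> D" for z
    proof -
      have "x \<otimes> y \<otimes> z = y \<otimes> (x \<otimes> z)" using x z y cr by (auto simp: conductor_def m_ac)
      then show ?thesis using y x z by (auto simp: conductor_def subringE[OF D])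
    qed
    then show ?thesis using x y by (auto simp: conductor_def subringE[OF D])
  qed
qed

lemma conductor_subset:
  assumes D: "subring D R"
  shows "conductor D \<subseteq> central_closure"
proof
  fix x assume x: "x \<in> conductor D"
  then have "x \<otimes> \<one> \<in> central_closure" "x \<in> carrier R"
    using subringE(1,3)[OF D] by (auto simp: conductor_def)
  then show "x \<in> central_closure" by simp
qed

text \<open>
  If some element \<open>h\<close> of the conductor avoids the primes over \<open>p\<close>, then \<open>f = (h f) / h\<close> is a
  quotient of elements of the closure; otherwise \<open>f\<close> lies in all these primes.
\<close>

lemma square_root_conductor_in_closure:
  assumes D: "subring D R" "central_closure \<subseteq> D" and f: "f \<in> D" and b: "b \<in> D" "b \<in> square_cone R"
    and fb: "f \<otimes> f \<oplus> b \<in> conductor D"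
  shows "f \<in> central_closure"
proof -
  have fc: "f \<in> carrier R" "b \<in> carrier R" using f b subringE(1)[OF D(1)] by blast+
  have "f \<in> central_gluing (carrier R) p" if p: "central_prime_on R A p" for p
  proof (cases "\<forall>h \<in> conductor D. \<forall>q. central_prime_on R (carrier R) q \<and> q \<inter> A = p \<longrightarrow> h \<in> q")
    case True
    show ?thesis
    proof (rule central_gluingI)
      show "f \<in> carrier R" by fact
      show "\<zero> \<in> A" "\<one> \<in> A - p"
        using central_prime_onD(6)[OF p] by (simp_all add: subringE[OF subring_A])
      fix q assume q: "central_prime_on R (carrier R) q" "q \<inter> A = p"
      then have "f \<in> q" using True fb central_prime_onD(8)[OF q(1) fc b(2)] by blast
      then show "\<one> \<otimes> f \<ominus> \<zero> \<in> q" using fc by (simp add: a_minus_def)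
    qed
  next
    case False
    then obtain h q0 where h: "h \<in> conductor D" "h \<notin> q0"
      and q0: "central_prime_on R (carrier R) q0" "q0 \<inter> A = p" by blast
    have hD: "h \<in> D" "h \<otimes> f \<in> central_closure" using h f by (auto simp: conductor_def)
    have hC: "h \<in> central_closure" using h(1) conductor_subset[OF D(1)] by blast
    have hc: "h \<in> carrier R" using hD subringE(1)[OF D(1)] by blast
    obtain u s where us: "u \<in> A" "s \<in> A - p"
      and hq: "\<And>q. central_prime_on R (carrier R) q \<Longrightarrow> q \<inter> A = p \<Longrightarrow> s \<otimes> h \<ominus> u \<in> q"
      using hC p unfolding central_closure_def by (auto elim!: central_gluingE)
    obtain v t where vt: "v \<in> A" "t \<in> A - p"
      and hfq: "\<And>q. central_prime_on R (carrier R) q \<Longrightarrow> q \<inter> A = p \<Longrightarrow> t \<otimes> (h \<otimes> f) \<ominus> v \<in> q"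
      using hD(2) p unfolding central_closure_def by (auto elim!: central_gluingE)
    have c: "u \<in> carrier R" "s \<in> carrier R" "v \<in> carrier R" "t \<in> carrier R"
      using us vt A_carrier by blast+
    have sh: "s \<otimes> h \<in> carrier R" using c hc by simp
    \<comment> \<open>By choice h avoids only \<open>q0\<close>, but its class is u/s at every
      central prime over p; u outside p makes it nonzero at all of them.\<close>
    have "u \<notin> p"
    proof
      assume "u \<in> p"
      then have "u \<in> q0" using q0 by blast
      then have "s \<otimes> h \<in> q0"
        using ideal_on_diff_mem[OF carrier_is_subring central_prime_onD(1)[OF q0(1)] sh c(1)] hq[OF q0] by blast
      then show False using central_prime_onD(7)[OF q0(1) c(2) hc] h(2) us q0(2) by blast
    qed
    then have tu: "t \<otimes> u \<in> A - p"
      using us vt central_prime_onD(7)[OF p, of t u] by (auto simp: subringE[OF subring_A])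
    show ?thesis
    \<comment> \<open>The class of f is (v/t) / (u/s) = (s v) / (t u).\<close>
    proof (rule central_gluingI[OF fc(1) _ tu])
      show "s \<otimes> v \<in> A" using us vt by (simp add: subringE[OF subring_A])
      fix q assume q: "central_prime_on R (carrier R) q" "q \<inter> A = p"
      have "t \<otimes> u \<otimes> f \<ominus> s \<otimes> v = s \<otimes> (t \<otimes> (h \<otimes> f) \<ominus> v) \<oplus> (\<ominus> (t \<otimes> f)) \<otimes> (s \<otimes> h \<ominus> u)"
        using c fc hc by algebra
      then show "t \<otimes> u \<otimes> f \<ominus> s \<otimes> v \<in> q"
        using hq[OF q] hfq[OF q] c fc central_prime_onD(4,5)[OF q(1)] by simp
    qed
  qed
  then show ?thesis using fc by (auto simp: central_closure_def)
qed

text \<open>The preceding lemma is applied to f y and y^2 b for each y in D: (f y)^2 + y^2 b = y^2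
  (f^2 + b) stays in the conductor.\<close>

lemma conductor_central:
  assumes D: "subring D R" "central_closure \<subseteq> D" and f: "f \<in> D" and b: "b \<in> D" "b \<in> square_cone R"
    and fb: "f \<otimes> f \<oplus> b \<in> conductor D"
  shows "f \<in> conductor D"
proof -
  have "f \<otimes> y \<in> central_closure" if y: "y \<in> D" for y
  proof (rule square_root_conductor_in_closure[OF D])
    have c: "f \<in> carrier R" "b \<in> carrier R" "y \<in> carrier R" using f b y subringE(1)[OF D(1)] by blast+
    show "f \<otimes> y \<in> D" "y \<otimes> y \<otimes> b \<in> D" using f b y by (simp_all add: subringE[OF D(1)])
    show "y \<otimes> y \<otimes> b \<in> square_cone R" using b c by (simp add: square_cone_mult square_square_cone)
    have "f \<otimes> y \<otimes> (f \<otimes> y) \<oplus> y \<otimes> y \<otimes> b = y \<otimes> y \<otimes> (f \<otimes> f \<oplus> b)" using c by algebra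
    then show "f \<otimes> y \<otimes> (f \<otimes> y) \<oplus> y \<otimes> y \<otimes> b \<in> conductor D"
      using ideal_onD(4)[OF conductor_ideal[OF D(1)] _ fb] y by (simp add: subringE[OF D(1)])
  qed
  then show ?thesis using f by (auto simp: conductor_def)
qed

text \<open>Centrality with b = 0 extracts square roots, and (f^(k+1))^2 = f^k f^(k+2) lowers the
  exponent by one.\<close>

lemma conductor_power:
  assumes D: "subring D R" "central_closure \<subseteq> D" and f: "f \<in> D" and "f [^] Suc k \<in> conductor D"
  shows "f \<in> conductor D"
  using assms(4)
proof (induction k)
  case 0
  then show ?case using f subringE(1)[OF D(1)] by auto
next
  case (Suc k)
  have fc: "f \<in> carrier R" using f subringE(1)[OF D(1)] by blast
  have fk: "f [^] j \<in> D" for j :: nat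
    by (induction j) (use f in \<open>auto simp: subringE[OF D(1)]\<close>)
  have "f [^] Suc k \<otimes> f [^] Suc k \<oplus> \<zero> = f [^] k \<otimes> f [^] Suc (Suc k)"
    using nat_pow_mult[OF fc, of "Suc k" "Suc k"] nat_pow_mult[OF fc, of k "Suc (Suc k)"]
      nat_pow_closed[OF fc] fc by (simp del: nat_pow_Suc)
  also have "\<dots> \<in> conductor D" using ideal_onD(4)[OF conductor_ideal[OF D(1)] fk Suc.prems] .
  finally have "f [^] Suc k \<in> conductor D"
    using conductor_central[OF D fk subringE(2)[OF D(1)] zero_square_cone] by blast
  then show ?case by (rule Suc.IH)
qed

text \<open>Primality is the usual argument for associated primes. That p is central and that d is
  outside p both follow from centrality of the conductor; the second fact makes d a denominator over
  p.\<close>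

lemma conductor_colon_prime:
  assumes D: "subring D R" "central_closure \<subseteq> D" and ne: "D \<noteq> central_closure"
  obtains d p where "d \<in> A" "p = {a \<in> A. a \<otimes> d \<in> conductor D}" "central_prime_on R A p" "d \<notin> p"
    "conductor D \<inter> A \<subseteq> p"
proof -
  note J = ideal_onD[OF conductor_ideal[OF D(1)]]
  have AD: "a \<in> D" if "a \<in> A" for a using that A_subset_central_closure D(2) by blast
  note S = subringE[OF subring_A]
  define colon where "colon = (\<lambda>d. {a \<in> A. a \<otimes> d \<in> conductor D})"
  have one: "\<one> \<notin> conductor D"
  proof
    assume "\<one> \<in> conductor D"
    then have all: "\<And>x. x \<in> D \<Longrightarrow> \<one> \<otimes> x \<in> central_closure" by (auto simp: conductor_def)
    have "x \<in> central_closure" if "x \<in> D" for x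
      using all[OF that] that subringE(1)[OF D(1)] by (simp add: subset_iff)
    then show False using ne D(2) by blast
  qed
  have id: "ideal_on R A (colon d)" if d: "d \<in> A" for d
  proof (rule ideal_onI)
    show "colon d \<subseteq> A" by (auto simp: colon_def)
    show "\<zero> \<in> colon d" using d A_carrier J(2) by (auto simp: colon_def S)
    fix x y assume y: "y \<in> colon d"
    show "x \<oplus> y \<in> colon d" if "x \<in> colon d"
      using that y d A_carrier J(3) by (auto simp: colon_def S l_distr)
    show "x \<otimes> y \<in> colon d" if "x \<in> A"
      using that y d A_carrier AD J(4) by (auto simp: colon_def S m_assoc)
  qed
  let ?F = "colon ` {d \<in> A. d \<notin> conductor D}"
  let ?r = "{(J, I). ideal_on R A I \<and> ideal_on R A J \<and> I \<subset> J}"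
  have cF: "colon \<one> \<in> ?F" using one S(3) by blast
  \<comment> \<open>Minimal for the reversed inclusion, hence maximal among the colon
    ideals.\<close>
  obtain p where p: "p \<in> ?F"
    and max: "\<And>q. (q, p) \<in> ?r \<Longrightarrow> q \<notin> ?F"
    by (rule wfE_min[OF wf_noetherian_on[OF subring_A noetherian] cF]) (rule that)
  then obtain d where d: "d \<in> A" "d \<notin> conductor D" "p = colon d" by blast
  have dc: "d \<in> carrier R" "d \<in> D" using d A_carrier AD by blast+
  have Jp: "conductor D \<inter> A \<subseteq> p"
  proof
    fix a assume a: "a \<in> conductor D \<inter> A"
    then have "d \<otimes> a \<in> conductor D" using J(4) dc by blast
    then show "a \<in> p" using a d dc A_carrier by (auto simp: colon_def m_comm)
  qed
  have "central_prime_on R A p"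
  proof (rule central_prime_onI)
    show "ideal_on R A p" using id d by simp
    show "\<one> \<notin> p" using d dc by (auto simp: colon_def)
  next
    fix x y assume x: "x \<in> A" and y: "y \<in> A" and xy: "x \<otimes> y \<in> p" "x \<notin> p"
    have c: "x \<in> carrier R" "y \<in> carrier R" using x y A_carrier by blast+
    have xd: "x \<otimes> d \<in> A" "x \<otimes> d \<notin> conductor D" using x xy d by (auto simp: colon_def S)
    \<comment> \<open>Since x d is again outside the conductor, maximality turns this inclusion into
      an equality, and y multiplies x d into the conductor.\<close>
    have "p \<subseteq> colon (x \<otimes> d)"
    proof
      fix a assume "a \<in> p"
      then have a: "a \<in> A" "a \<otimes> d \<in> conductor D" by (auto simp: d colon_def)
      have "a \<otimes> (x \<otimes> d) = x \<otimes> (a \<otimes> d)" using a(1) A_carrier c dc by (simp add: m_ac)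
      then show "a \<in> colon (x \<otimes> d)" using a J(4) AD[OF x] by (simp add: colon_def)
    qed
    moreover have "colon (x \<otimes> d) \<in> ?F" using xd by blast
    ultimately have "p = colon (x \<otimes> d)" using max[of "colon (x \<otimes> d)"] id d(1,3) xd(1) by blast
    moreover have "y \<otimes> (x \<otimes> d) = x \<otimes> y \<otimes> d" using c dc by (simp add: m_ac)
    moreover have "x \<otimes> y \<otimes> d \<in> conductor D" using xy(1) by (simp add: d colon_def)
    ultimately show "y \<in> p" using y by (simp add: colon_def)
  next
    fix x b assume x: "x \<in> A" and b: "b \<in> A" "b \<in> square_cone R" and xb: "x \<otimes> x \<oplus> b \<in> p"
    have c: "x \<in> carrier R" "b \<in> carrier R" using x b A_carrier by blast+
    have "(x \<otimes> d) \<otimes> (x \<otimes> d) \<oplus> d \<otimes> d \<otimes> b = d \<otimes> ((x \<otimes> x \<oplus> b) \<otimes> d)" using c dc by algebra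
    also have "\<dots> \<in> conductor D" using xb J(4)[OF dc(2)] by (simp add: d colon_def)
    finally have xd: "x \<otimes> d \<otimes> (x \<otimes> d) \<oplus> d \<otimes> d \<otimes> b \<in> conductor D" .
    have "x \<otimes> d \<in> D" "d \<otimes> d \<otimes> b \<in> D"
      using AD[OF x] AD[OF b(1)] dc by (simp_all add: subringE[OF D(1)])
    moreover have "d \<otimes> d \<otimes> b \<in> square_cone R"
      using b(2) dc by (simp add: square_cone_mult square_square_cone)
    ultimately have "x \<otimes> d \<in> conductor D" using conductor_central[OF D _ _ _ xd] by blast
    then show "x \<in> p" using x by (simp add: d colon_def)
  qed
  \<comment> \<open>Membership would put d^2 into the conductor, and then d by centrality with b =
    0.\<close>
  moreover have "d \<notin> p"
  proof
    assume "d \<in> p"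
    then have "d \<otimes> d \<oplus> \<zero> \<in> conductor D" using dc by (simp add: d colon_def)
    then show False
      using conductor_central[OF D dc(2) subringE(2)[OF D(1)] zero_square_cone] d by blast
  qed
  ultimately show thesis using that[of d p] d Jp by (simp add: colon_def)
qed

text \<open>
  The Positivstellensatz, applied to \<open>p D\<close> and the multiplicative set of all \<open>s z\<^sup>k\<close>, where
  \<open>z = s\<^sub>0 x - u\<close> lies in all central primes over \<open>p\<close>.
\<close>

lemma gluing_denominator:
  assumes D: "subring D R" "central_closure \<subseteq> D"
    and d: "d \<in> A" "d \<notin> p" "p = {a \<in> A. a \<otimes> d \<in> conductor D}" and p: "central_prime_on R A p"
    and x: "x \<in> central_gluing D p"
  shows "\<exists>s\<in>A - p. s \<otimes> x \<in> central_closure"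
proof -
  note J = ideal_onD[OF conductor_ideal[OF D(1)]]
  note S = subringE[OF subring_A] and E = subringE[OF D(1)]
  have AD: "a \<in> D" if "a \<in> A" for a using that A_subset_central_closure D(2) by blast
  have cr: "z \<in> carrier R" if "z \<in> D" for z using that E(1) by blast
  have pD: "p \<subseteq> D" using central_prime_onD(2)[OF p] AD by blast
  obtain u s where us: "x \<in> D" "u \<in> A" "s \<in> A - p"
    and all: "\<And>q. central_prime_on R D q \<Longrightarrow> q \<inter> A = p \<Longrightarrow> s \<otimes> x \<ominus> u \<in> q"
    using x by (rule central_gluingE) blast
  define z where "z = s \<otimes> x \<ominus> u"
  have zD: "z \<in> D" using us AD by (auto simp: z_def a_minus_def E)
  have zc: "z \<in> carrier R" using zD cr by blast
  have zk: "z [^] k \<in> D" for k :: nat by (induction k) (auto simp: E zD)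
  define T where "T = {r \<otimes> z [^] k |r k. r \<in> A - p \<and> (k :: nat) \<in> UNIV}"
  have TI: "r \<otimes> z [^] k \<in> T" if "r \<in> A - p" for r and k :: nat using that by (auto simp: T_def)
  have Ap1: "\<one> \<in> A - p" using central_prime_onD(6)[OF p] by (simp add: S)
  have Apm: "a \<otimes> b \<in> A - p" if "a \<in> A - p" "b \<in> A - p" for a b
    using that central_prime_onD(7)[OF p, of a b] by (auto simp: S)
  \<comment> \<open>Otherwise some central prime over p misses \<open>T\<close>, yet it contains z
    by the gluing condition.\<close>
  have "\<exists>t b. t \<in> T \<and> b \<in> D \<and> b \<in> square_cone R \<and> t \<otimes> t \<oplus> b \<in> combinations R p D"
  proof (rule ccontr)
    assume no: "\<not> ?thesis"
    have "T \<subseteq> D" using AD zk by (auto simp: T_def E)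
    moreover have "\<one> \<in> T" using TI[OF Ap1, of 0] by simp
    moreover have "a \<otimes> b \<in> T" if ab: "a \<in> T" "b \<in> T" for a b
    proof -
      obtain r k r' k' where a: "a = r \<otimes> z [^] (k :: nat)" "r \<in> A - p"
        and b: "b = r' \<otimes> z [^] (k' :: nat)" "r' \<in> A - p"
        using ab unfolding T_def by blast
      have "r \<in> carrier R" "r' \<in> carrier R" using a b A_carrier by blast+
      then have "a \<otimes> b = r \<otimes> r' \<otimes> z [^] (k + k')" using zc unfolding a b
        by (simp add: m_ac flip: nat_pow_mult)
      then show ?thesis using TI Apm a b by metis
    qed
    ultimately obtain q where q: "central_prime_on R D q" "combinations R p D \<subseteq> q" "q \<inter> T = {}"
      using exists_central_prime[OF D(1) ideal_on_combinations[OF D(1) pD], of T] no by metis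
    have "a \<notin> q" if "a \<in> A - p" for a
    proof -
      have "a \<in> carrier R" using that A_carrier by blast
      then have "a \<in> T" using TI[OF that, of 0] by simp
      then show ?thesis using q(3) by blast
    qed
    then have "q \<inter> A = p"
      using q(2) subset_combinations[OF D(1) pD] central_prime_onD(2)[OF p] by blast
    then have "z \<in> q" using all[OF q(1)] z_def by simp
    moreover have "z \<in> T" using TI[OF Ap1, of 1] zc by simp
    ultimately show False using q(3) by blast
  qed
  then obtain r k b where r: "r \<in> A - p" and b: "b \<in> D" "b \<in> square_cone R"
    and comb: "r \<otimes> z [^] (k :: nat) \<otimes> (r \<otimes> z [^] k) \<oplus> b \<in> combinations R p D"
    unfolding T_def by blast
  have dD: "d \<in> D" "d \<in> carrier R" using d AD cr by blast+
  \<comment> \<open>d p lies in the conductor by the choice of p, and the conductor is an ideal of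
    D.\<close>
  have dcomb: "d \<otimes> y \<in> conductor D" if "y \<in> combinations R p D" for y
    using that
  proof induction
    case zero
    then show ?case using dD J(2) by simp
  next
    case (add_mult c t y)
    have c: "c \<in> A" "c \<otimes> d \<in> conductor D" using add_mult(1) d(3) by auto
    have cc: "c \<in> carrier R" "t \<in> carrier R" "y \<in> carrier R"
      using c A_carrier add_mult(2) cr combinations_subring[OF D(1) pD add_mult(3)] by blast+
    have "d \<otimes> (c \<otimes> t \<oplus> y) = t \<otimes> (c \<otimes> d) \<oplus> d \<otimes> y" using cc dD by algebra
    then show ?case using J(3,4) c(2) add_mult(2,4) by simp
  qed
  have rD: "r \<in> D" "r \<in> carrier R" using r AD cr by blast+
  have bc: "b \<in> carrier R" using b cr by blast
  \<comment> \<open>With t = r z^k and w = d t, the element w^2 + d^2 b = d (d (t^2 + b)) is in the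
    conductor, hence so is w by centrality.\<close>
  let ?w = "d \<otimes> r \<otimes> z [^] k"
  have zkc: "z [^] k \<in> carrier R" using zc by simp
  have "?w \<otimes> ?w \<oplus> d \<otimes> d \<otimes> b = d \<otimes> (d \<otimes> (r \<otimes> z [^] k \<otimes> (r \<otimes> z [^] k) \<oplus> b))"
    using dD rD bc zkc by algebra
  also have "\<dots> \<in> conductor D" using J(4)[OF dD(1) dcomb[OF comb]] .
  finally have ww: "?w \<otimes> ?w \<oplus> d \<otimes> d \<otimes> b \<in> conductor D" .
  have "?w \<in> D" "d \<otimes> d \<otimes> b \<in> D" using dD rD b zk by (simp_all add: E)
  moreover have "d \<otimes> d \<otimes> b \<in> square_cone R"
    using b(2) dD by (simp add: square_cone_mult square_square_cone)
  ultimately have w: "?w \<in> conductor D" using conductor_central[OF D _ _ _ ww] by blast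
  have drk: "(d \<otimes> r) [^] k \<in> D" by (induction k) (auto simp: E dD rD)
  have dr: "d \<otimes> r \<in> A - p" using Apm r d by blast
  \<comment> \<open>w contains d and r only once, so it is completed to a power of d r z before
    roots are extracted.\<close>
  have "(d \<otimes> r \<otimes> z) [^] Suc k = (d \<otimes> r) [^] k \<otimes> z \<otimes> ?w"
    using dD rD zc zkc by (simp add: nat_pow_distrib m_ac)
  also have "\<dots> \<in> conductor D" using J(4)[OF _ w] drk zD by (simp add: E)
  finally have "d \<otimes> r \<otimes> z \<in> conductor D"
    using conductor_power[OF D] dD rD zD by (simp add: E)
  then have "d \<otimes> r \<otimes> z \<in> central_closure" using conductor_subset[OF D(1)] by blast
  \<comment> \<open>As z = s x - u, adding d r u, which is in A, turns d r z into d r s x.\<close>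
  moreover have dru: "d \<otimes> r \<otimes> u \<in> central_closure"
    using dr us(2) A_subset_central_closure by (auto simp: S)
  ultimately have "d \<otimes> r \<otimes> z \<oplus> d \<otimes> r \<otimes> u \<in> central_closure"
    using subringE(7)[OF subring_central_closure] by blast
  moreover have "u \<in> carrier R" "s \<in> carrier R" "x \<in> carrier R" using us A_carrier cr by blast+
  then have "d \<otimes> r \<otimes> z \<oplus> d \<otimes> r \<otimes> u = (d \<otimes> r \<otimes> s) \<otimes> x"
    unfolding z_def using dD rD by algebra
  moreover have "d \<otimes> r \<otimes> s \<in> A - p" using Apm dr us(3) by blast
  ultimately show ?thesis by auto
qed

text \<open>A product s of denominators for finitely many module generators moves the whole glued
  ring into the closure. It is outside p, whereas the old conductor meets A inside p; hence the
  strict inclusion.\<close>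

lemma conductor_gluing:
  assumes D: "subring D R" "central_closure \<subseteq> D" and ne: "D \<noteq> central_closure"
  obtains p where "central_prime_on R A p" "conductor D \<inter> A \<subset> conductor (central_gluing D p) \<inter> A"
proof -
  obtain d p where d: "d \<in> A" "p = {a \<in> A. a \<otimes> d \<in> conductor D}"
    and p: "central_prime_on R A p" and dp: "d \<notin> p" and Jp: "conductor D \<inter> A \<subseteq> p"
    by (rule conductor_colon_prime[OF assms])
  note S = subringE[OF subring_A] and C = subringE[OF subring_central_closure]
  have AC: "a \<in> central_closure" if "a \<in> A" for a using that A_subset_central_closure by blast
  let ?E = "central_gluing D p"
  have AD: "A \<subseteq> D" using A_subset_central_closure D(2) by blast
  have E: "subring ?E R" by (rule subring_central_gluing[OF D(1) AD p])
  have AE: "A \<subseteq> ?E" by (rule subset_central_gluing[OF D(1) AD p])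
  obtain G where G: "finite G" "G \<subseteq> carrier R" "carrier R \<subseteq> combinations R A G"
    using finitely_generated by blast
  have EG: "?E \<subseteq> combinations R A G" using G(3) subringE(1)[OF E] by (rule subset_trans[rotated])
  have Emod: "module_on R A ?E"
    unfolding module_on_def using subringE(1,2)[OF E] AE
    by (auto intro: subringE(6,7)[OF E])
  obtain F where F: "finite F" "F \<subseteq> ?E" "?E \<subseteq> combinations R A F"
    using noetherian_submodule[OF subring_A noetherian G(1,2) Emod EG] by auto
  \<comment> \<open>Denominators of single generators exist by \<open>gluing_denominator\<close>;
    their product stays outside the prime p.\<close>
  have "\<exists>s\<in>A - p. \<forall>x\<in>F. s \<otimes> x \<in> central_closure"
    using F(1,2)
  proof (induction F)
    case empty
    then show ?case using central_prime_onD(6)[OF p] S(3) by auto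
  next
    case (insert x F)
    then obtain s where s: "s \<in> A - p" "\<forall>y\<in>F. s \<otimes> y \<in> central_closure" by blast
    obtain t where t: "t \<in> A - p" "t \<otimes> x \<in> central_closure"
      using gluing_denominator[OF D d(1) dp d(2) p] insert.prems by blast
    have c: "s \<in> carrier R" "t \<in> carrier R" using s t A_carrier by blast+
    have F: "y \<in> carrier R" if "y \<in> insert x F" for y using that insert.prems subringE(1)[OF E] by blast
    have "s \<otimes> t \<in> A - p" using s t central_prime_onD(7)[OF p, of s t] by (auto simp: S)
    moreover have "s \<otimes> t \<otimes> y \<in> central_closure" if y: "y \<in> insert x F" for y
    proof (cases "y = x")
      case True
      have "s \<otimes> t \<otimes> y = s \<otimes> (t \<otimes> y)" using c F[OF y] by (simp add: m_assoc)
      then show ?thesis using True t s AC C(6) by simp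
    next
      case False
      have "s \<otimes> t \<otimes> y = t \<otimes> (s \<otimes> y)" using c F[OF y] by (simp add: m_ac)
      then show ?thesis using False y t s AC C(6) by simp
    qed
    ultimately show ?case by blast
  qed
  then obtain s where s: "s \<in> A - p" "\<And>x. x \<in> F \<Longrightarrow> s \<otimes> x \<in> central_closure" by blast
  have sc: "s \<in> carrier R" using s A_carrier by blast
  have "s \<otimes> x \<in> central_closure" if "x \<in> combinations R A F" for x
  proof -
    have M: "module_on R A {x \<in> carrier R. s \<otimes> x \<in> central_closure}"
      unfolding module_on_def
    proof (intro conjI ballI)
      fix a x assume a: "a \<in> A" and x: "x \<in> {x \<in> carrier R. s \<otimes> x \<in> central_closure}"
      have "s \<otimes> (a \<otimes> x) = a \<otimes> (s \<otimes> x)" using a x A_carrier sc by (simp add: m_ac)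
      then show "a \<otimes> x \<in> {x \<in> carrier R. s \<otimes> x \<in> central_closure}"
        using a x A_carrier AC C(6) by simp
    qed (use sc in \<open>auto simp: r_distr C\<close>)
    have "F \<subseteq> carrier R" using F(2) subringE(1)[OF E] by (rule subset_trans)
    then have "F \<subseteq> {x \<in> carrier R. s \<otimes> x \<in> central_closure}" using s(2) by auto
    from combinations_least[OF M this that] show ?thesis by simp
  qed
  then have 1: "s \<in> conductor ?E \<inter> A"
    unfolding conductor_def using F(3) s(1) AE by blast
  have 2: "s \<notin> conductor D \<inter> A" using Jp s(1) by blast
  have "?E \<subseteq> D" by (auto simp: central_gluing_def)
  then have 3: "conductor D \<inter> A \<subseteq> conductor ?E \<inter> A"
    unfolding conductor_def using AE by blast
  have "conductor D \<inter> A \<subset> conductor ?E \<inter> A" using 1 2 3 by (metis psubsetI)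
  with p show thesis by (rule that)
qed

text \<open>Recursion on the ideal formed by the conductor within A, which grows with every gluing
  until D is the closure. A chain of n rings takes n - 1 gluings.\<close>

lemma gluing_chain:
  assumes "subring D R" "central_closure \<subseteq> D"
  shows "\<exists>(n::nat) Ds p. 1 \<le> n \<and> Ds 1 = D \<and> Ds n = central_closure \<and>
    (\<forall>i\<in>{1..n}. subring (Ds i) R \<and> A \<subseteq> Ds i) \<and>
    (\<forall>i\<in>{1..<n}. central_prime_on R A (p i) \<and> Ds (i + 1) = central_gluing (Ds i) (p i))"
  using assms
proof (induction "conductor D \<inter> A" arbitrary: D rule: wf_induct_rule[OF wf_noetherian_on[OF subring_A noetherian]])
  case (1 D)
  note D = "1.prems"
  have AD: "A \<subseteq> D" using A_subset_central_closure D(2) by blast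
  show ?case
  proof (cases "D = central_closure")
    case True
    then show ?thesis using D AD by (intro exI[of _ 1] exI[of _ "\<lambda>_. D"]) auto
  next
    case False
    obtain p where p: "central_prime_on R A p"
      "conductor D \<inter> A \<subset> conductor (central_gluing D p) \<inter> A"
      using conductor_gluing[OF D False] .
    let ?E = "central_gluing D p"
    have E: "subring ?E R" by (rule subring_central_gluing[OF D(1) AD p(1)])
    have CE: "central_closure \<subseteq> ?E" by (rule central_closure_subset_gluing[OF D p(1)])
    have id: "ideal_on R A (conductor K \<inter> A)" if "subring K R" "A \<subseteq> K" for K
      using ideal_onD[OF conductor_ideal[OF that(1)]] that(2)
      by (intro ideal_onI) (auto simp: subringE[OF subring_A])
    have "A \<subseteq> ?E" using A_subset_central_closure CE by blast
    then obtain n :: nat and Ds q where n: "1 \<le> n" "Ds 1 = ?E" "Ds n = central_closure"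
      and sub: "\<And>i. i \<in> {1..n} \<Longrightarrow> subring (Ds i) R \<and> A \<subseteq> Ds i"
      and glue: "\<And>i. i \<in> {1..<n} \<Longrightarrow> central_prime_on R A (q i) \<and> Ds (i + 1) = central_gluing (Ds i) (q i)"
      using "1.hyps"[OF _ E CE] id[OF D(1) AD] id[OF E] p(2) by blast
    \<comment> \<open>D is put in front of the chain that starts with its gluing, which shifts all
      indices by one.\<close>
    let ?Ds = "\<lambda>i. if i = 1 then D else Ds (i - 1)" and ?q = "\<lambda>i. if i = 1 then p else q (i - 1)"
    have "subring (?Ds i) R \<and> A \<subseteq> ?Ds i" if "i \<in> {1..Suc n}" for i
    proof (cases "i = 1")
      case False
      then have "i - 1 \<in> {1..n}" using that by auto
      then show ?thesis using sub False by simp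
    qed (use D(1) AD in simp)
    moreover have "central_prime_on R A (?q i) \<and> ?Ds (i + 1) = central_gluing (?Ds i) (?q i)"
      if "i \<in> {1..<Suc n}" for i
    proof (cases "i = 1")
      case False
      then have "i - 1 \<in> {1..<n}" using that by auto
      then show ?thesis using glue[of "i - 1"] False that by simp
    qed (use p(1) n(2) in simp)
    ultimately show ?thesis using n(1,3) by (intro exI[of _ "Suc n"] exI[of _ ?Ds] exI[of _ ?q]) auto
  qed
qed

end

section \<open>Fraction fields and central prime ideals\<close>

context domain
begin

lemma equiv_frac_rel: "equiv (carrier R \<times> (carrier R - {\<zero>})) (frac_rel R)"
proof (rule equivI)
  show "frac_rel R \<subseteq> (carrier R \<times> (carrier R - {\<zero>})) \<times> (carrier R \<times> (carrier R - {\<zero>}))"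
    by (auto simp: frac_rel_def)
  show "refl_on (carrier R \<times> (carrier R - {\<zero>})) (frac_rel R)"
    by (auto simp: refl_on_def frac_rel_def)
  show "sym (frac_rel R)" by (auto simp: sym_def frac_rel_def)
  show "trans (frac_rel R)"
  proof (rule transI)
    fix u v w assume "(u, v) \<in> frac_rel R" "(v, w) \<in> frac_rel R"
    then obtain a b c d e f where u: "u = (a, b)" "v = (c, d)" "w = (e, f)"
      and c: "a \<in> carrier R" "b \<in> carrier R" "b \<noteq> \<zero>" "c \<in> carrier R" "d \<in> carrier R" "d \<noteq> \<zero>"
        "e \<in> carrier R" "f \<in> carrier R" "f \<noteq> \<zero>"
      and eq: "a \<otimes> d = c \<otimes> b" "c \<otimes> f = e \<otimes> d"
      by (auto simp: frac_rel_def)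
    have "d \<otimes> (a \<otimes> f) = f \<otimes> (a \<otimes> d)" using c by (simp add: m_ac)
    also have "\<dots> = b \<otimes> (c \<otimes> f)" using c eq(1) by (simp add: m_ac)
    also have "\<dots> = d \<otimes> (e \<otimes> b)" using c eq(2) by (simp add: m_ac)
    finally have "a \<otimes> f = e \<otimes> b" using c by (simp add: m_lcancel)
    then show "(u, w) \<in> frac_rel R" using c u by (auto simp: frac_rel_def)
  qed
qed

lemma fraction_eq_iff:
  assumes "a \<in> carrier R" "b \<in> carrier R" "b \<noteq> \<zero>" "c \<in> carrier R" "d \<in> carrier R" "d \<noteq> \<zero>"
  shows "fraction R a b = fraction R c d \<longleftrightarrow> a \<otimes> d = c \<otimes> b"
  using eq_equiv_class_iff[OF equiv_frac_rel, of "(a, b)" "(c, d)"] assms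
  by (auto simp: fraction_def frac_rel_def)

lemma mem_fraction_iff:
  assumes "a \<in> carrier R" "b \<in> carrier R" "b \<noteq> \<zero>"
  shows "(c, d) \<in> fraction R a b \<longleftrightarrow> c \<in> carrier R \<and> d \<in> carrier R \<and> d \<noteq> \<zero> \<and> a \<otimes> d = c \<otimes> b"
  using assms by (auto simp: fraction_def frac_rel_def)

lemma fraction_carrier:
  assumes "a \<in> carrier R" "b \<in> carrier R" "b \<noteq> \<zero>"
  shows "fraction R a b \<in> carrier (fraction_field R)"
  using assms by (auto simp: fraction_field_def fraction_def intro!: quotientI)

lemma fraction_fieldE:
  assumes "x \<in> carrier (fraction_field R)"
  obtains a b where "a \<in> carrier R" "b \<in> carrier R" "b \<noteq> \<zero>" "x = fraction R a b"
  using assms by (auto simp: fraction_field_def fraction_def elim!: quotientE)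

lemma Union_fraction:
  assumes "a \<in> carrier R" "b \<in> carrier R" "b \<noteq> \<zero>"
    and "\<And>a' b'. (a', b') \<in> fraction R a b \<Longrightarrow> f a' b' = z"
  shows "(\<Union>(a', b')\<in>fraction R a b. f a' b') = z"
proof (rule UN_constant_eq[of "(a, b)"])
  show "(a, b) \<in> fraction R a b" using assms(1-3) by (simp add: mem_fraction_iff)
  show "\<forall>x\<in>fraction R a b. (case x of (a', b') \<Rightarrow> f a' b') = z" using assms(4) by auto
qed

lemma fraction_mult:
  assumes "a \<in> carrier R" "b \<in> carrier R" "b \<noteq> \<zero>" "c \<in> carrier R" "d \<in> carrier R" "d \<noteq> \<zero>"
  shows "fraction R a b \<otimes>\<^bsub>fraction_field R\<^esub> fraction R c d = fraction R (a \<otimes> c) (b \<otimes> d)"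
  unfolding fraction_field_def monoid.simps ring.simps
proof (rule Union_fraction[OF assms(1-3)], rule Union_fraction[OF assms(4-6)])
  fix a' b' c' d' assume "(a', b') \<in> fraction R a b" "(c', d') \<in> fraction R c d"
  then have m: "a' \<in> carrier R" "b' \<in> carrier R" "b' \<noteq> \<zero>" "a \<otimes> b' = a' \<otimes> b"
    "c' \<in> carrier R" "d' \<in> carrier R" "d' \<noteq> \<zero>" "c \<otimes> d' = c' \<otimes> d"
    using assms by (auto simp: mem_fraction_iff)
  have "a' \<otimes> c' \<otimes> (b \<otimes> d) = (a' \<otimes> b) \<otimes> (c' \<otimes> d)" using assms m by (simp add: m_ac)
  also have "\<dots> = a \<otimes> c \<otimes> (b' \<otimes> d')" unfolding m(4)[symmetric] m(8)[symmetric] using assms m(1-3,5-7) by (simp add: m_ac)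
  finally show "fraction R (a' \<otimes> c') (b' \<otimes> d') = fraction R (a \<otimes> c) (b \<otimes> d)"
    using assms m by (simp add: fraction_eq_iff integral_iff)
qed

lemma fraction_add:
  assumes "a \<in> carrier R" "b \<in> carrier R" "b \<noteq> \<zero>" "c \<in> carrier R" "d \<in> carrier R" "d \<noteq> \<zero>"
  shows "fraction R a b \<oplus>\<^bsub>fraction_field R\<^esub> fraction R c d = fraction R (a \<otimes> d \<oplus> c \<otimes> b) (b \<otimes> d)"
  unfolding fraction_field_def monoid.simps ring.simps
proof (rule Union_fraction[OF assms(1-3)], rule Union_fraction[OF assms(4-6)])
  fix a' b' c' d' assume "(a', b') \<in> fraction R a b" "(c', d') \<in> fraction R c d"
  then have m: "a' \<in> carrier R" "b' \<in> carrier R" "b' \<noteq> \<zero>" "a \<otimes> b' = a' \<otimes> b"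
    "c' \<in> carrier R" "d' \<in> carrier R" "d' \<noteq> \<zero>" "c \<otimes> d' = c' \<otimes> d"
    using assms by (auto simp: mem_fraction_iff)
  have "(a' \<otimes> d' \<oplus> c' \<otimes> b') \<otimes> (b \<otimes> d) = d \<otimes> d' \<otimes> (a' \<otimes> b) \<oplus> b \<otimes> b' \<otimes> (c' \<otimes> d)"
    using assms(1,2,4,5) m(1,2,5,6) by algebra
  also have "\<dots> = (a \<otimes> d \<oplus> c \<otimes> b) \<otimes> (b' \<otimes> d')"
    unfolding m(4)[symmetric] m(8)[symmetric] using assms(1,2,4,5) m(1,2,5,6) by algebra
  finally show "fraction R (a' \<otimes> d' \<oplus> c' \<otimes> b') (b' \<otimes> d') = fraction R (a \<otimes> d \<oplus> c \<otimes> b) (b \<otimes> d)"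
    using assms m by (simp add: fraction_eq_iff integral_iff)
qed

lemma fraction_field_zero: "\<zero>\<^bsub>fraction_field R\<^esub> = fraction R \<zero> \<one>"
  and fraction_field_one: "\<one>\<^bsub>fraction_field R\<^esub> = fraction R \<one> \<one>"
  by (simp_all add: fraction_field_def)

text \<open>The inverse is identified by uniqueness in the definite description behind
  \<open>a_inv\<close>, using only the formula for adding fractions.\<close>

lemma fraction_field_minus_one: "\<ominus>\<^bsub>fraction_field R\<^esub> \<one>\<^bsub>fraction_field R\<^esub> = to_frac R (\<ominus> \<one>)"
proof -
  let ?M = "add_monoid (fraction_field R)"
  have "inv\<^bsub>?M\<^esub> \<one>\<^bsub>fraction_field R\<^esub> = to_frac R (\<ominus> \<one>)"
    unfolding m_inv_def
  proof (rule the_equality)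
    show "to_frac R (\<ominus> \<one>) \<in> carrier ?M \<and>
      \<one>\<^bsub>fraction_field R\<^esub> \<otimes>\<^bsub>?M\<^esub> to_frac R (\<ominus> \<one>) = \<one>\<^bsub>?M\<^esub> \<and>
      to_frac R (\<ominus> \<one>) \<otimes>\<^bsub>?M\<^esub> \<one>\<^bsub>fraction_field R\<^esub> = \<one>\<^bsub>?M\<^esub>"
      by (simp add: to_frac_def fraction_field_one fraction_field_zero fraction_add fraction_carrier
          r_neg l_neg)
  next
    fix y assume y: "y \<in> carrier ?M \<and> \<one>\<^bsub>fraction_field R\<^esub> \<otimes>\<^bsub>?M\<^esub> y = \<one>\<^bsub>?M\<^esub> \<and>
      y \<otimes>\<^bsub>?M\<^esub> \<one>\<^bsub>fraction_field R\<^esub> = \<one>\<^bsub>?M\<^esub>"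
    then obtain a b where ab: "a \<in> carrier R" "b \<in> carrier R" "b \<noteq> \<zero>" "y = fraction R a b"
      by (auto elim: fraction_fieldE)
    have "fraction R (b \<oplus> a) b = fraction R \<zero> \<one>"
      using y ab by (simp add: fraction_field_one fraction_field_zero fraction_add)
    then have "b \<oplus> a = \<zero>" using ab by (simp add: fraction_eq_iff)
    then have "a = \<ominus> b" using ab minus_equality[of a b] by (simp add: a_comm)
    then have "a \<otimes> \<one> = \<ominus> \<one> \<otimes> b" using ab(2) by algebra
    then show "y = to_frac R (\<ominus> \<one>)"
      unfolding to_frac_def ab(4) using ab(1-3) by (simp add: fraction_eq_iff)
  qed
  then show ?thesis unfolding a_inv_def[of "fraction_field R"] .
qed

section \<open>Sums of squares of fractions, real domains and central ideals\<close>

text \<open>(a/b)^2 + n/d^2 = ((a d)^2 + b^2 n) / (b d)^2, so the common denominator remains a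
  square.\<close>

lemma sums_of_squares_fraction_fieldE:
  assumes "s \<in> sums_of_squares (fraction_field R)"
  shows "\<exists>n\<in>sums_of_squares R. \<exists>d\<in>carrier R - {\<zero>}. s = fraction R n (d \<otimes> d)"
  using assms
proof induction
  case zero
  then show ?case
    by (intro bexI[of _ \<zero>] bexI[of _ \<one>]) (auto simp: fraction_field_zero sums_of_squares.zero)
next
  case (add_square x s)
  obtain n d where n: "n \<in> sums_of_squares R" "d \<in> carrier R" "d \<noteq> \<zero>" "s = fraction R n (d \<otimes> d)"
    using add_square by blast
  obtain a b where ab: "a \<in> carrier R" "b \<in> carrier R" "b \<noteq> \<zero>" "x = fraction R a b"
    using add_square(1) by (rule fraction_fieldE)
  have nc: "n \<in> carrier R" using n(1) by (rule sums_of_squares_carrier)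
  have "x \<otimes>\<^bsub>fraction_field R\<^esub> x \<oplus>\<^bsub>fraction_field R\<^esub> s =
      fraction R (a \<otimes> a \<otimes> (d \<otimes> d) \<oplus> n \<otimes> (b \<otimes> b)) (b \<otimes> b \<otimes> (d \<otimes> d))"
    using ab n nc by (simp add: fraction_mult fraction_add integral_iff)
  also have "a \<otimes> a \<otimes> (d \<otimes> d) \<oplus> n \<otimes> (b \<otimes> b) = (a \<otimes> d) \<otimes> (a \<otimes> d) \<oplus> b \<otimes> b \<otimes> n"
    using ab(1,2) n(2) nc by algebra
  also have "b \<otimes> b \<otimes> (d \<otimes> d) = (b \<otimes> d) \<otimes> (b \<otimes> d)" using ab(2) n(2) by (simp add: m_ac)
  finally have "x \<otimes>\<^bsub>fraction_field R\<^esub> x \<oplus>\<^bsub>fraction_field R\<^esub> s =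
      fraction R ((a \<otimes> d) \<otimes> (a \<otimes> d) \<oplus> b \<otimes> b \<otimes> n) ((b \<otimes> d) \<otimes> (b \<otimes> d))" .
  moreover have "(a \<otimes> d) \<otimes> (a \<otimes> d) \<oplus> b \<otimes> b \<otimes> n \<in> sums_of_squares R"
    using sums_of_squares.add_square[OF _ square_mult_sums_of_squares[OF n(1) ab(2)]] ab n by simp
  moreover have "b \<otimes> d \<in> carrier R - {\<zero>}" using ab n by (simp add: integral_iff)
  ultimately show ?case by blast
qed

lemma fraction_sums_of_squares:
  assumes "n \<in> sums_of_squares R" and d: "d \<in> carrier R" "d \<noteq> \<zero>"
  shows "fraction R n (d \<otimes> d) \<in> sums_of_squares (fraction_field R)"
  using assms(1)
proof induction
  case zero
  have "fraction R \<zero> (d \<otimes> d) = fraction R \<zero> \<one>" using d by (simp add: fraction_eq_iff integral_iff)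
  then show ?case using sums_of_squares.zero[of "fraction_field R"] by (simp add: fraction_field_zero)
next
  case (add_square x n)
  have c: "n \<in> carrier R" "x \<in> carrier R" using add_square sums_of_squares_carrier by blast+
  have "fraction R x d \<otimes>\<^bsub>fraction_field R\<^esub> fraction R x d \<oplus>\<^bsub>fraction_field R\<^esub> fraction R n (d \<otimes> d) =
     fraction R (x \<otimes> x \<otimes> (d \<otimes> d) \<oplus> n \<otimes> (d \<otimes> d)) (d \<otimes> d \<otimes> (d \<otimes> d))"
    using c d by (simp add: fraction_mult fraction_add integral_iff)
  also have "\<dots> = fraction R (x \<otimes> x \<oplus> n) (d \<otimes> d)"
  proof -
    have "(x \<otimes> x \<otimes> (d \<otimes> d) \<oplus> n \<otimes> (d \<otimes> d)) \<otimes> (d \<otimes> d) = (x \<otimes> x \<oplus> n) \<otimes> (d \<otimes> d \<otimes> (d \<otimes> d))"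
      using c d(1) by algebra
    then show ?thesis using c d by (simp add: fraction_eq_iff integral_iff)
  qed
  finally show ?case
    using sums_of_squares.add_square[OF _ add_square(3)] fraction_carrier[OF c(2) d] by metis
qed

lemma to_frac_sums_of_squares_iff:
  assumes b: "b \<in> carrier R"
  shows "to_frac R b \<in> sums_of_squares (fraction_field R) \<longleftrightarrow> b \<in> square_cone R"
proof
  assume "to_frac R b \<in> sums_of_squares (fraction_field R)"
  then obtain n d where n: "n \<in> sums_of_squares R" "d \<in> carrier R" "d \<noteq> \<zero>"
    "fraction R b \<one> = fraction R n (d \<otimes> d)"
    using sums_of_squares_fraction_fieldE unfolding to_frac_def by blast
  then have "d \<otimes> d \<otimes> b = n"
    using b sums_of_squares_carrier[OF n(1)] by (simp add: fraction_eq_iff integral_iff m_comm)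
  then show "b \<in> square_cone R" using n b by (auto intro: square_coneI)
next
  assume "b \<in> square_cone R"
  then obtain d where d: "d \<in> carrier R" "d \<noteq> \<zero>" "d \<otimes> d \<otimes> b \<in> sums_of_squares R"
    by (auto simp: square_cone_def)
  have "to_frac R b = fraction R (d \<otimes> d \<otimes> b) (d \<otimes> d)"
    unfolding to_frac_def using b d by (simp add: fraction_eq_iff integral_iff m_ac)
  then show "to_frac R b \<in> sums_of_squares (fraction_field R)"
    using fraction_sums_of_squares[OF d(3,1,2)] by simp
qed

lemma real_domain_iff: "real_domain R \<longleftrightarrow> \<ominus> \<one> \<notin> square_cone R"
  by (simp add: real_domain_def domain_axioms fraction_field_minus_one to_frac_sums_of_squares_iff)

text \<open>If a^2 + b equals an element x of I, then b = x - a^2 already lies in R. Only those sums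
  of squares of fractions that belong to R matter.\<close>

lemma central_ideal_iff:
  assumes I: "ideal I R"
  shows "central_ideal I R \<longleftrightarrow> (\<forall>a\<in>carrier R. \<forall>b\<in>square_cone R. a \<otimes> a \<oplus> b \<in> I \<longrightarrow> a \<in> I)"
proof
  assume c: "central_ideal I R"
  show "\<forall>a\<in>carrier R. \<forall>b\<in>square_cone R. a \<otimes> a \<oplus> b \<in> I \<longrightarrow> a \<in> I"
  proof (intro ballI impI)
    fix a b assume a: "a \<in> carrier R" and b: "b \<in> square_cone R" and ab: "a \<otimes> a \<oplus> b \<in> I"
    have bc: "b \<in> carrier R" using b by (rule square_cone_carrier)
    have "to_frac R (a \<otimes> a) \<oplus>\<^bsub>fraction_field R\<^esub> to_frac R b = to_frac R (a \<otimes> a \<oplus> b)"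
      using a bc by (simp add: to_frac_def fraction_add)
    then show "a \<in> I"
      using c a ab b to_frac_sums_of_squares_iff[OF bc] unfolding central_ideal_def by blast
  qed
next
  assume c: "\<forall>a\<in>carrier R. \<forall>b\<in>square_cone R. a \<otimes> a \<oplus> b \<in> I \<longrightarrow> a \<in> I"
  show "central_ideal I R"
    unfolding central_ideal_def
  proof (intro conjI I ballI impI)
    fix a b assume a: "a \<in> carrier R" and b: "b \<in> sums_of_squares (fraction_field R)"
      and "to_frac R (a \<otimes> a) \<oplus>\<^bsub>fraction_field R\<^esub> b \<in> to_frac R ` I"
    then obtain x where x: "x \<in> I" "to_frac R (a \<otimes> a) \<oplus>\<^bsub>fraction_field R\<^esub> b = to_frac R x" by blast
    have xc: "x \<in> carrier R" using x(1) ideal.Icarr[OF I] by blast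
    obtain n d where n: "n \<in> sums_of_squares R" "d \<in> carrier R" "d \<noteq> \<zero>" "b = fraction R n (d \<otimes> d)"
      using sums_of_squares_fraction_fieldE[OF b] by blast
    have nc: "n \<in> carrier R" using n(1) by (rule sums_of_squares_carrier)
    have "fraction R (a \<otimes> a \<otimes> (d \<otimes> d) \<oplus> n) (d \<otimes> d) = fraction R x \<one>"
      using x(2) a n nc by (simp add: to_frac_def fraction_add integral_iff)
    then have e: "a \<otimes> a \<otimes> (d \<otimes> d) \<oplus> n = x \<otimes> (d \<otimes> d)"
      using a n nc xc by (simp add: fraction_eq_iff integral_iff)
    have "n = (a \<otimes> a \<otimes> (d \<otimes> d) \<oplus> n) \<ominus> a \<otimes> a \<otimes> (d \<otimes> d)" using a n(2) nc by algebra
    also have "\<dots> = d \<otimes> d \<otimes> (x \<ominus> a \<otimes> a)" unfolding e using a n(2) xc by algebra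
    finally have "x \<ominus> a \<otimes> a \<in> square_cone R"
      using n a xc by (intro square_coneI[of _ d]) auto
    moreover have "a \<otimes> a \<oplus> (x \<ominus> a \<otimes> a) = x" using a xc by algebra
    ultimately show "a \<in> I" using c a x(1) by metis
  qed
qed

lemma ideal_on_carrier_iff: "ideal_on R (carrier R) I \<longleftrightarrow> ideal I R"
proof
  assume I: "ideal_on R (carrier R) I"
  note J = ideal_onD[OF I]
  show "ideal I R"
  proof (rule idealI[OF ring_axioms])
    show "subgroup I (add_monoid R)"
      by (rule add.subgroupI) (use J ideal_on_minus[OF carrier_is_subring I] in \<open>auto simp flip: a_inv_def\<close>)
    show "x \<otimes> a \<in> I" if "a \<in> I" "x \<in> carrier R" for a x using J(4) that by blast
    then show "a \<otimes> x \<in> I" if "a \<in> I" "x \<in> carrier R" for a x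
      using that J(1) m_comm[of a x] by (metis subsetD)
  qed
next
  assume "ideal I R"
  then interpret ideal I R .
  show "ideal_on R (carrier R) I" by (rule ideal_onI) (auto simp: I_l_closed Icarr)
qed

lemma C_Spec_iff: "q \<in> C_Spec R \<longleftrightarrow> central_prime_on R (carrier R) q"
proof
  assume "q \<in> C_Spec R"
  then have p: "primeideal q R" and c: "central_ideal q R" by (auto simp: C_Spec_def)
  interpret primeideal q R by fact
  show "central_prime_on R (carrier R) q"
  proof (rule central_prime_onI)
    show "ideal_on R (carrier R) q" using ideal_on_carrier_iff is_ideal by blast
    show "\<one> \<notin> q" using one_imp_carrier I_notcarr by blast
    show "y \<in> q" if "x \<in> carrier R" "y \<in> carrier R" "x \<otimes> y \<in> q" "x \<notin> q" for x y
      using I_prime that by blast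
    show "x \<in> q" if "x \<in> carrier R" "b \<in> square_cone R" "x \<otimes> x \<oplus> b \<in> q" for x b
      using c that central_ideal_iff[OF is_ideal] by blast
  qed
next
  assume q: "central_prime_on R (carrier R) q"
  have I: "ideal q R" using central_prime_onD(1)[OF q] ideal_on_carrier_iff by blast
  have "primeideal q R"
  proof (rule primeidealI[OF I is_cring])
    show "carrier R \<noteq> q" using central_prime_onD(6)[OF q] by blast
    show "a \<in> q \<or> b \<in> q" if "a \<in> carrier R" "b \<in> carrier R" "a \<otimes> b \<in> q" for a b
      using central_prime_onD(7)[OF q] that by blast
  qed
  moreover have "central_ideal q R"
    using central_ideal_iff[OF I] central_prime_onD(8)[OF q] square_cone_carrier by blast
  ultimately show "q \<in> C_Spec R" by (simp add: C_Spec_def)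
qed

text \<open>Here -1 is in the cone, and 1^2 + (-1) = 0 would put 1 into any central prime.\<close>

lemma C_Spec_not_real:
  assumes "\<not> real_domain R"
  shows "C_Spec R = {}"
proof -
  have "\<not> central_prime_on R (carrier R) q" for q
  proof
    assume q: "central_prime_on R (carrier R) q"
    have "\<one> \<otimes> \<one> \<oplus> \<ominus> \<one> \<in> q" using central_prime_onD(3)[OF q] by (simp add: r_neg)
    then show False
      using central_prime_onD(6,8)[OF q] assms one_closed unfolding real_domain_iff
      by (metis a_inv_closed)
  qed
  then show ?thesis using C_Spec_iff by blast
qed

text \<open>From a^2 + b = 0 with a nonzero follows b = a^2 (-1), and cancelling the square puts -1
  into the cone.\<close>

lemma zero_C_Spec:
  assumes "real_domain R"
  shows "{\<zero>} \<in> C_Spec R"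
proof -
  have "central_ideal {\<zero>} R"
    unfolding central_ideal_iff[OF zeroideal]
  proof (intro ballI impI)
    fix a b assume a: "a \<in> carrier R" and b: "b \<in> square_cone R" and ab: "a \<otimes> a \<oplus> b \<in> {\<zero>}"
    show "a \<in> {\<zero>}"
    proof (rule ccontr)
      assume "a \<notin> {\<zero>}"
      have bc: "b \<in> carrier R" using b by (rule square_cone_carrier)
      have "b = (a \<otimes> a \<oplus> b) \<oplus> a \<otimes> a \<otimes> \<ominus> \<one>" using a bc by algebra
      then have "a \<otimes> a \<otimes> \<ominus> \<one> \<in> square_cone R" using ab a b by simp
      then show False
        using square_cone_cancel_square[of a "\<ominus> \<one>"] a \<open>a \<notin> {\<zero>}\<close> assms by (simp add: real_domain_iff)
    qed
  qed
  then show ?thesis using zeroprimeideal by (simp add: C_Spec_def)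
qed

end

section \<open>Residue fields\<close>

text \<open>A carrier update keeps sum and product, but negatives are chosen within the carrier, so
  subtraction needs an argument.\<close>

lemma (in ring) a_minus_subring:
  assumes D: "subring D R" and "x \<in> D" "y \<in> D"
  shows "x \<ominus>\<^bsub>R\<lparr>carrier := D\<rparr>\<^esub> y = x \<ominus> y"
proof -
  interpret D: ring "R\<lparr>carrier := D\<rparr>" by (rule subring_is_ring[OF D])
  have c: "y \<in> carrier R" "\<ominus>\<^bsub>R\<lparr>carrier := D\<rparr>\<^esub> y \<in> D"
    using assms subringE(1)[OF D] D.a_inv_closed[of y] by auto
  have "\<ominus>\<^bsub>R\<lparr>carrier := D\<rparr>\<^esub> y \<oplus> y = \<zero>" using D.l_neg[of y] assms by simp
  then have "\<ominus> y = \<ominus>\<^bsub>R\<lparr>carrier := D\<rparr>\<^esub> y"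
    using minus_equality[of "\<ominus>\<^bsub>R\<lparr>carrier := D\<rparr>\<^esub> y" y] c subringE(1)[OF D] by blast
  then show ?thesis by (simp add: a_minus_def)
qed

lemma (in cring) sums_of_squares_subring:
  assumes "s \<in> sums_of_squares (R\<lparr>carrier := D\<rparr>)" "D \<subseteq> carrier R"
  shows "s \<in> sums_of_squares R"
  using assms(1) by induction (use assms(2) in \<open>auto intro: sums_of_squares.intros\<close>)

text \<open>The hypothesis \<open>frac\<close> says that R lies in the fraction field of A. Clearing
  denominators with squares of elements of A turns a sum of squares of R into one of D.\<close>

lemma (in domain) square_cone_subring:
  assumes A: "subring A R" and frac: "\<And>x. x \<in> carrier R \<Longrightarrow> \<exists>s\<in>A - {\<zero>}. s \<otimes> x \<in> A"
    and D: "subring D R" "A \<subseteq> D"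
  shows "square_cone (R\<lparr>carrier := D\<rparr>) = D \<inter> square_cone R"
proof
  interpret D: domain "R\<lparr>carrier := D\<rparr>" by (rule subring_is_domain[OF D(1)])
  have Dc: "x \<in> carrier R" if "x \<in> D" for x using that subringE(1)[OF D(1)] by blast
  show "square_cone (R\<lparr>carrier := D\<rparr>) \<subseteq> D \<inter> square_cone R"
    using sums_of_squares_subring[OF _ subringE(1)[OF D(1)]] Dc
    by (auto simp: square_cone_def)
  have common: "\<exists>t\<in>A - {\<zero>}. t \<otimes> t \<otimes> n \<in> sums_of_squares (R\<lparr>carrier := D\<rparr>)"
    if "n \<in> sums_of_squares R" for n
    using that
  proof induction
    case zero
    then show ?case
      using sums_of_squares.zero[of "R\<lparr>carrier := D\<rparr>"] subringE(3)[OF A] by (intro bexI[of _ \<one>]) auto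
  next
    case (add_square x n)
    obtain t where t: "t \<in> A" "t \<noteq> \<zero>" "t \<otimes> t \<otimes> n \<in> sums_of_squares (R\<lparr>carrier := D\<rparr>)"
      using add_square by blast
    obtain s where s: "s \<in> A" "s \<noteq> \<zero>" "s \<otimes> x \<in> A" using frac[OF add_square(1)] by blast
    have c: "s \<in> carrier R" "t \<in> carrier R" "x \<in> carrier R" "n \<in> carrier R"
      using s t add_square sums_of_squares_carrier subringE(1)[OF A] by blast+
    have "(s \<otimes> t) \<otimes> (s \<otimes> t) \<otimes> (x \<otimes> x \<oplus> n) =
        (t \<otimes> (s \<otimes> x)) \<otimes> (t \<otimes> (s \<otimes> x)) \<oplus> s \<otimes> s \<otimes> (t \<otimes> t \<otimes> n)"
      using c by algebra
    moreover have "s \<otimes> s \<otimes> (t \<otimes> t \<otimes> n) \<in> sums_of_squares (R\<lparr>carrier := D\<rparr>)"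
      using D.square_mult_sums_of_squares[OF t(3), of s] s(1) D(2) by auto
    moreover have "t \<otimes> (s \<otimes> x) \<in> D" using t s D(2) subringE(6)[OF A] by blast
    ultimately have "(s \<otimes> t) \<otimes> (s \<otimes> t) \<otimes> (x \<otimes> x \<oplus> n) \<in> sums_of_squares (R\<lparr>carrier := D\<rparr>)"
      using sums_of_squares.add_square[of "t \<otimes> (s \<otimes> x)" "R\<lparr>carrier := D\<rparr>"] by simp
    moreover have "s \<otimes> t \<in> A - {\<zero>}" using s t c by (auto simp: integral_iff subringE[OF A])
    ultimately show ?case by blast
  qed
  show "D \<inter> square_cone R \<subseteq> square_cone (R\<lparr>carrier := D\<rparr>)"
  proof
    fix b assume b: "b \<in> D \<inter> square_cone R"
    then obtain d where d: "d \<in> carrier R" "d \<noteq> \<zero>" "d \<otimes> d \<otimes> b \<in> sums_of_squares R"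
      by (auto simp: square_cone_def)
    obtain t where t: "t \<in> A" "t \<noteq> \<zero>" "t \<otimes> t \<otimes> (d \<otimes> d \<otimes> b) \<in> sums_of_squares (R\<lparr>carrier := D\<rparr>)"
      using common[OF d(3)] by blast
    \<comment> \<open>The witness d need not lie in D; multiplying it by s brings it into A, and t s
      d is the new witness.\<close>
    obtain s where s: "s \<in> A" "s \<noteq> \<zero>" "s \<otimes> d \<in> A" using frac[OF d(1)] by blast
    have c: "s \<in> carrier R" "t \<in> carrier R" "b \<in> carrier R" using s t b subringE(1)[OF A] Dc by blast+
    have "(t \<otimes> (s \<otimes> d)) \<otimes> (t \<otimes> (s \<otimes> d)) \<otimes> b = s \<otimes> s \<otimes> (t \<otimes> t \<otimes> (d \<otimes> d \<otimes> b))"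
      using c d(1) by algebra
    moreover have "s \<otimes> s \<otimes> (t \<otimes> t \<otimes> (d \<otimes> d \<otimes> b)) \<in> sums_of_squares (R\<lparr>carrier := D\<rparr>)"
      using D.square_mult_sums_of_squares[OF t(3), of s] s(1) D(2) by auto
    moreover have "t \<otimes> (s \<otimes> d) \<in> D" using t s D(2) subringE(6)[OF A] by blast
    moreover have "t \<otimes> (s \<otimes> d) \<noteq> \<zero>" using c d s t by (simp add: integral_iff)
    ultimately show "b \<in> square_cone (R\<lparr>carrier := D\<rparr>)"
      using D.square_coneI[of b "t \<otimes> (s \<otimes> d)"] b by simp
  qed
qed

lemma (in domain) C_Spec_subring_iff:
  assumes A: "subring A R" and frac: "\<And>x. x \<in> carrier R \<Longrightarrow> \<exists>s\<in>A - {\<zero>}. s \<otimes> x \<in> A"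
    and D: "subring D R" "A \<subseteq> D"
  shows "q \<in> C_Spec (R\<lparr>carrier := D\<rparr>) \<longleftrightarrow> central_prime_on R D q"
proof -
  interpret D: domain "R\<lparr>carrier := D\<rparr>" by (rule subring_is_domain[OF D(1)])
  show ?thesis
    by (simp add: D.C_Spec_iff central_prime_on_def ideal_on_def square_cone_subring[OF assms])
qed

locale domain_embedding = R?: domain R + S?: domain S for R (structure) and S (structure) +
  fixes h
  assumes hom: "h \<in> ring_hom R S" and inj: "inj_on h (carrier R)"
begin

sublocale ring_hom_cring R S h
  by unfold_locales (rule hom)

lemma h_eq_zero_iff: "x \<in> carrier R \<Longrightarrow> h x = \<zero>\<^bsub>S\<^esub> \<longleftrightarrow> x = \<zero>"
  using inj_onD[OF inj, of x \<zero>] by auto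

lemma frac_map_fraction:
  assumes "a \<in> carrier R" "b \<in> carrier R" "b \<noteq> \<zero>"
  shows "frac_map S h (fraction R a b) = fraction S (h a) (h b)"
  unfolding frac_map_def
proof (rule R.Union_fraction[OF assms])
  fix c d assume "(c, d) \<in> fraction R a b"
  then have m: "c \<in> carrier R" "d \<in> carrier R" "d \<noteq> \<zero>" "a \<otimes> d = c \<otimes> b"
    using assms by (auto simp: R.mem_fraction_iff)
  then have "h c \<otimes>\<^bsub>S\<^esub> h b = h a \<otimes>\<^bsub>S\<^esub> h d" using assms by (simp flip: hom_mult)
  then show "fraction S (h c) (h d) = fraction S (h a) (h b)"
    using assms m by (simp add: S.fraction_eq_iff h_eq_zero_iff)
qed

lemma frac_map_ring_hom: "frac_map S h \<in> ring_hom (fraction_field R) (fraction_field S)"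
proof (rule ring_hom_memI)
  fix x assume "x \<in> carrier (fraction_field R)"
  then obtain a b where x: "a \<in> carrier R" "b \<in> carrier R" "b \<noteq> \<zero>" "x = fraction R a b"
    by (rule R.fraction_fieldE)
  then show "frac_map S h x \<in> carrier (fraction_field S)"
    by (simp add: frac_map_fraction S.fraction_carrier h_eq_zero_iff)
  fix y assume "y \<in> carrier (fraction_field R)"
  then obtain c d where y: "c \<in> carrier R" "d \<in> carrier R" "d \<noteq> \<zero>" "y = fraction R c d"
    by (rule R.fraction_fieldE)
  show "frac_map S h (x \<otimes>\<^bsub>fraction_field R\<^esub> y) = frac_map S h x \<otimes>\<^bsub>fraction_field S\<^esub> frac_map S h y"
    "frac_map S h (x \<oplus>\<^bsub>fraction_field R\<^esub> y) = frac_map S h x \<oplus>\<^bsub>fraction_field S\<^esub> frac_map S h y"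
    using x y by (simp_all add: frac_map_fraction R.fraction_mult S.fraction_mult R.fraction_add
        S.fraction_add h_eq_zero_iff R.integral_iff)
qed (simp add: R.fraction_field_one S.fraction_field_one frac_map_fraction)

lemma inj_on_frac_map: "inj_on (frac_map S h) (carrier (fraction_field R))"
proof (rule inj_onI)
  fix x y assume "x \<in> carrier (fraction_field R)" "y \<in> carrier (fraction_field R)"
    and eq: "frac_map S h x = frac_map S h y"
  then obtain a b c d where x: "a \<in> carrier R" "b \<in> carrier R" "b \<noteq> \<zero>" "x = fraction R a b"
    and y: "c \<in> carrier R" "d \<in> carrier R" "d \<noteq> \<zero>" "y = fraction R c d"
    by (meson R.fraction_fieldE)
  have "h (a \<otimes> d) = h (c \<otimes> b)"
    using eq x y by (simp add: frac_map_fraction S.fraction_eq_iff h_eq_zero_iff)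
  then have "a \<otimes> d = c \<otimes> b" using inj_onD[OF inj] x y by simp
  then show "x = y" using x y by (simp add: R.fraction_eq_iff)
qed

lemma frac_map_eq_to_frac_iff:
  assumes "a \<in> carrier R" "b \<in> carrier R" "b \<noteq> \<zero>" "x \<in> carrier S"
  shows "frac_map S h (fraction R a b) = to_frac S x \<longleftrightarrow> h b \<otimes>\<^bsub>S\<^esub> x = h a"
  using assms by (auto simp: frac_map_fraction to_frac_def S.fraction_eq_iff h_eq_zero_iff S.m_comm)

lemma sums_of_squares_image:
  "sums_of_squares (S\<lparr>carrier := h ` carrier R\<rparr>) = h ` sums_of_squares R"
proof
  show "sums_of_squares (S\<lparr>carrier := h ` carrier R\<rparr>) \<subseteq> h ` sums_of_squares R"
  proof
    fix x assume "x \<in> sums_of_squares (S\<lparr>carrier := h ` carrier R\<rparr>)"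
    then show "x \<in> h ` sums_of_squares R"
    proof induction
      case zero
      then show ?case using sums_of_squares.zero[of R] by force
    next
      case (add_square x n)
      then obtain y m where "y \<in> carrier R" "x = h y" "m \<in> sums_of_squares R" "n = h m" by auto
      moreover from this have "h (y \<otimes> y \<oplus> m) = x \<otimes>\<^bsub>S\<^esub> x \<oplus>\<^bsub>S\<^esub> n"
        using R.sums_of_squares_carrier by simp
      ultimately show ?case using sums_of_squares.add_square[of y R m] by force
    qed
  qed
  show "h ` sums_of_squares R \<subseteq> sums_of_squares (S\<lparr>carrier := h ` carrier R\<rparr>)"
  proof clarify
    fix n assume "n \<in> sums_of_squares R"
    then show "h n \<in> sums_of_squares (S\<lparr>carrier := h ` carrier R\<rparr>)"
    proof induction
      case zero
      then show ?case using sums_of_squares.zero[of "S\<lparr>carrier := h ` carrier R\<rparr>"] by simp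
    next
      case (add_square y m)
      then show ?case
        using sums_of_squares.add_square[of "h y" "S\<lparr>carrier := h ` carrier R\<rparr>" "h m"]
          R.sums_of_squares_carrier by simp
    qed
  qed
qed

lemma square_cone_image: "square_cone (S\<lparr>carrier := h ` carrier R\<rparr>) = h ` square_cone R"
proof -
  have "h d \<otimes>\<^bsub>S\<^esub> h d \<otimes>\<^bsub>S\<^esub> h b \<in> h ` sums_of_squares R \<longleftrightarrow> d \<otimes> d \<otimes> b \<in> sums_of_squares R"
    if "d \<in> carrier R" "b \<in> carrier R" for d b
  proof -
    have "h d \<otimes>\<^bsub>S\<^esub> h d \<otimes>\<^bsub>S\<^esub> h b = h (d \<otimes> d \<otimes> b)" using that by simp
    then show ?thesis
      using inj_on_image_mem_iff[OF inj, of "d \<otimes> d \<otimes> b" "sums_of_squares R"] that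
        R.sums_of_squares_carrier by auto
  qed
  note iff = this
  show ?thesis
  proof (intro equalityI subsetI)
    fix x assume "x \<in> square_cone (S\<lparr>carrier := h ` carrier R\<rparr>)"
    then obtain b d where "x = h b" "b \<in> carrier R" "d \<in> carrier R" "h d \<noteq> \<zero>\<^bsub>S\<^esub>"
      "h d \<otimes>\<^bsub>S\<^esub> h d \<otimes>\<^bsub>S\<^esub> h b \<in> h ` sums_of_squares R"
      by (auto simp: square_cone_def sums_of_squares_image)
    moreover from this have "b \<in> square_cone R"
      using iff[of d b] h_eq_zero_iff[of d] by (intro R.square_coneI[of b d]) simp_all
    ultimately show "x \<in> h ` square_cone R" by blast
  next
    fix x assume "x \<in> h ` square_cone R"
    then obtain b d where b: "x = h b" "b \<in> carrier R" "d \<in> carrier R" "d \<noteq> \<zero>"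
      "d \<otimes> d \<otimes> b \<in> sums_of_squares R"
      by (auto simp: square_cone_def)
    then have "h d \<in> h ` carrier R - {\<zero>\<^bsub>S\<^esub>}" by (simp add: h_eq_zero_iff)
    then show "x \<in> square_cone (S\<lparr>carrier := h ` carrier R\<rparr>)"
      unfolding square_cone_def sums_of_squares_image using b iff[of d b] by auto
  qed
qed

text \<open>The base ring lives on a type of its own. Replacing it by its image makes all rings of
  the argument subrings of one ring.\<close>

lemma central_prime_on_image_iff:
  assumes q: "q \<subseteq> carrier R"
  shows "central_prime_on (S\<lparr>carrier := h ` carrier R\<rparr>) (h ` carrier R) (h ` q) \<longleftrightarrow>
    central_prime_on R (carrier R) q"
proof -
  have mem: "h x \<in> h ` q \<longleftrightarrow> x \<in> q" if "x \<in> carrier R" for x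
    using inj_on_image_mem_iff[OF inj that q] .
  have qc: "x \<in> carrier R" if "x \<in> q" for x using that q by blast
  have cone: "h ` carrier R \<inter> h ` square_cone R = h ` square_cone R"
    using R.square_cone_carrier by blast
  have cone': "carrier R \<inter> square_cone R = square_cone R" using R.square_cone_carrier by blast
  have 0: "\<zero>\<^bsub>S\<^esub> \<in> h ` q \<longleftrightarrow> \<zero> \<in> q" "\<one>\<^bsub>S\<^esub> \<in> h ` q \<longleftrightarrow> \<one> \<in> q"
    using mem[of \<zero>] mem[of \<one>] by simp_all
  have add: "h x \<oplus>\<^bsub>S\<^esub> h y \<in> h ` q \<longleftrightarrow> x \<oplus> y \<in> q" if "x \<in> carrier R" "y \<in> carrier R" for x y
    using mem[of "x \<oplus> y"] that by simp
  have mult: "h x \<otimes>\<^bsub>S\<^esub> h y \<in> h ` q \<longleftrightarrow> x \<otimes> y \<in> q" if "x \<in> carrier R" "y \<in> carrier R" for x y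
    using mem[of "x \<otimes> y"] that by simp
  have central: "h x \<otimes>\<^bsub>S\<^esub> h x \<oplus>\<^bsub>S\<^esub> h b \<in> h ` q \<longleftrightarrow> x \<otimes> x \<oplus> b \<in> q"
    if "x \<in> carrier R" "b \<in> square_cone R" for x b
    using mem[of "x \<otimes> x \<oplus> b"] that R.square_cone_carrier by simp
  have sub: "h ` q \<subseteq> h ` carrier R \<longleftrightarrow> q \<subseteq> carrier R" using q by blast
  show ?thesis
    unfolding central_prime_on_def ideal_on_def square_cone_image
    by (simp add: cone cone' 0 sub add mult central mem qc cong: ball_cong)
qed

lemma contraction_eq_iff:
  assumes "p \<subseteq> carrier R"
  shows "contraction R h q = p \<longleftrightarrow> q \<inter> h ` carrier R = h ` p"
proof
  show "q \<inter> h ` carrier R = h ` p" if "contraction R h q = p"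
    using that by (auto simp: contraction_def)
  assume e: "q \<inter> h ` carrier R = h ` p"
  show "contraction R h q = p"
  proof (intro equalityI subsetI)
    fix x assume "x \<in> contraction R h q"
    then have x: "x \<in> carrier R" "h x \<in> h ` p" using e by (auto simp: contraction_def)
    then show "x \<in> p" using inj_on_image_mem_iff[OF inj x(1) assms] by blast
  next
    fix x assume "x \<in> p"
    then have "x \<in> carrier R" "h x \<in> q" using assms e by blast+
    then show "x \<in> contraction R h q" by (simp add: contraction_def)
  qed
qed

end

section \<open>Cosets of a prime and their fractions\<close>

context primeideal
begin

lemma quotient_carrier: "carrier (R Quot I) = (+>) I ` carrier R"
  by (auto simp: FactRing_def A_RCOSETS_defs a_r_coset_def)

lemma quotient_zero: "\<zero>\<^bsub>R Quot I\<^esub> = I"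
  and quotient_one: "\<one>\<^bsub>R Quot I\<^esub> = I +> \<one>"
  by (simp_all add: FactRing_def)

lemma quotient_mult:
  "x \<in> carrier R \<Longrightarrow> y \<in> carrier R \<Longrightarrow> (I +> x) \<otimes>\<^bsub>R Quot I\<^esub> (I +> y) = I +> (x \<otimes> y)"
  by (simp add: FactRing_def rcoset_mult_add)

lemma quotient_add:
  "x \<in> carrier R \<Longrightarrow> y \<in> carrier R \<Longrightarrow> (I +> x) \<oplus>\<^bsub>R Quot I\<^esub> (I +> y) = I +> (x \<oplus> y)"
  by (simp add: FactRing_def a_rcos_sum)

lemma coset_eq_iff:
  "x \<in> carrier R \<Longrightarrow> y \<in> carrier R \<Longrightarrow> I +> x = I +> y \<longleftrightarrow> x \<ominus> y \<in> I"
  using quotient_eq_iff_same_a_r_cos[OF is_ideal] by blast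

lemma coset_eq_zero_iff:
  "x \<in> carrier R \<Longrightarrow> I +> x = I \<longleftrightarrow> x \<in> I"
  using a_rcos_const rcos_const_imp_mem by blast

lemma residue_fieldE:
  assumes "c \<in> carrier (residue_field R I)"
  obtains a s where "a \<in> carrier R" "s \<in> carrier R" "s \<notin> I" "c = fraction (R Quot I) (I +> a) (I +> s)"
proof -
  interpret Q: domain "R Quot I" by (rule quotient_is_domain)
  have "c \<in> carrier (fraction_field (R Quot I))" using assms by (simp add: residue_field_def)
  then obtain u v where u: "u \<in> carrier (R Quot I)" "v \<in> carrier (R Quot I)"
    "v \<noteq> \<zero>\<^bsub>R Quot I\<^esub>" "c = fraction (R Quot I) u v"
    by (rule Q.fraction_fieldE)
  then obtain a s where "a \<in> carrier R" "u = I +> a" "s \<in> carrier R" "v = I +> s"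
    unfolding quotient_carrier by blast
  then show thesis using that[of a s] u(3,4) coset_eq_zero_iff[of s] by (simp add: quotient_zero)
qed

lemma residue_field_fraction:
  assumes "a \<in> carrier R" "s \<in> carrier R" "s \<notin> I"
  shows "fraction (R Quot I) (I +> a) (I +> s) \<in> carrier (residue_field R I)"
proof -
  interpret Q: domain "R Quot I" by (rule quotient_is_domain)
  show ?thesis
    unfolding residue_field_def
    by (rule Q.fraction_carrier) (use assms coset_eq_zero_iff in \<open>auto simp: quotient_carrier quotient_zero\<close>)
qed

lemma residue_fraction_eq_iff:
  assumes "a \<in> carrier R" "s \<in> carrier R" "s \<notin> I" "b \<in> carrier R" "t \<in> carrier R" "t \<notin> I"
  shows "fraction (R Quot I) (I +> a) (I +> s) = fraction (R Quot I) (I +> b) (I +> t) \<longleftrightarrow>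
    a \<otimes> t \<ominus> b \<otimes> s \<in> I"
proof -
  interpret Q: domain "R Quot I" by (rule quotient_is_domain)
  have "I +> a \<in> carrier (R Quot I)" "I +> s \<in> carrier (R Quot I)" "I +> s \<noteq> \<zero>\<^bsub>R Quot I\<^esub>"
    "I +> b \<in> carrier (R Quot I)" "I +> t \<in> carrier (R Quot I)" "I +> t \<noteq> \<zero>\<^bsub>R Quot I\<^esub>"
    using assms by (auto simp: quotient_carrier quotient_zero coset_eq_zero_iff)
  from Q.fraction_eq_iff[OF this] show ?thesis
    using assms by (simp add: quotient_mult coset_eq_iff)
qed

end

section \<open>The induced map of residue fields\<close>

locale residue_embedding = domain_embedding + q: primeideal q S for q
begin

abbreviation "p \<equiv> contraction R h q"

lemma primeideal_contraction: "primeideal p R"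
proof (rule primeidealI)
  show "ideal p R"
  proof (rule idealI[OF R.ring_axioms])
    show "subgroup p (add_monoid R)"
      by (rule R.add.subgroupI)
        (use q.zero_closed q.a_inv_closed q.a_closed in \<open>auto simp: contraction_def simp flip: a_inv_def\<close>)
  qed (auto simp: contraction_def q.I_l_closed q.I_r_closed)
  show "cring R" by (rule R.is_cring)
  have "h \<one> \<notin> q" using q.one_imp_carrier q.I_notcarr by auto
  then show "carrier R \<noteq> p" using R.one_closed unfolding contraction_def by blast
  show "a \<in> p \<or> b \<in> p" if "a \<in> carrier R" "b \<in> carrier R" "a \<otimes> b \<in> p" for a b
    using that q.I_prime[of "h a" "h b"] by (auto simp: contraction_def)
qed

sublocale p: primeideal p R by (rule primeideal_contraction)

text \<open>Together with the definition of the contraction this rule makes the simplifier loop.\<close>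

declare p.a_Hcarr [simp del]

text \<open>The induced map from R modulo the contraction to S modulo q, in the union form in which
  it occurs inside \<open>residue_map\<close>.\<close>

definition coset_map :: "'a set \<Rightarrow> 'c set" where
  "coset_map u = (\<Union>x\<in>u. q +>\<^bsub>S\<^esub> h x)"

lemma coset_map_coset:
  assumes a: "a \<in> carrier R"
  shows "coset_map (p +> a) = q +>\<^bsub>S\<^esub> h a"
  unfolding coset_map_def
proof (rule UN_constant_eq[of a])
  show "a \<in> p +> a" using p.a_rcos_self[OF a] .
  show "\<forall>x\<in>p +> a. q +>\<^bsub>S\<^esub> h x = q +>\<^bsub>S\<^esub> h a"
  proof
    fix x assume "x \<in> p +> a"
    then obtain y where y: "y \<in> p" "x = y \<oplus> a" by (auto simp: a_r_coset_def')
    have "y \<in> carrier R" "h y \<in> q" using y(1) by (auto simp: contraction_def)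
    moreover from this have "h x \<ominus>\<^bsub>S\<^esub> h a = h y"
      using a S.add.inv_solve_right[of "h y" "h x" "h a"] unfolding y(2)
      by (simp add: a_minus_def a_inv_def)
    ultimately show "q +>\<^bsub>S\<^esub> h x = q +>\<^bsub>S\<^esub> h a" using a y(2) by (simp add: q.coset_eq_iff)
  qed
qed

text \<open>Injectivity holds because p is the full preimage of q.\<close>

lemma domain_embedding_coset_map: "domain_embedding (R Quot p) (S Quot q) coset_map"
proof (intro domain_embedding.intro domain_embedding_axioms.intro p.quotient_is_domain q.quotient_is_domain)
  show "coset_map \<in> ring_hom (R Quot p) (S Quot q)"
    by (rule ring_hom_memI)
      (auto simp: p.quotient_carrier q.quotient_carrier coset_map_coset p.quotient_mult
        q.quotient_mult p.quotient_add q.quotient_add p.quotient_one q.quotient_one)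
  show "inj_on coset_map (carrier (R Quot p))"
  proof (rule inj_onI)
    fix u v assume "u \<in> carrier (R Quot p)" "v \<in> carrier (R Quot p)" and eq: "coset_map u = coset_map v"
    then obtain a b where ab: "a \<in> carrier R" "u = p +> a" "b \<in> carrier R" "v = p +> b"
      unfolding p.quotient_carrier by blast
    have "h (a \<ominus> b) \<in> q" using eq ab by (simp add: coset_map_coset q.coset_eq_iff a_minus_def)
    then have "a \<ominus> b \<in> p" using ab by (simp add: contraction_def)
    then show "u = v" using ab by (simp add: p.coset_eq_iff)
  qed
qed

lemma residue_map_eq: "residue_map h S q = frac_map (S Quot q) coset_map"
  by (simp add: residue_map_def coset_map_def[abs_def])

lemma residue_map_fraction:
  assumes "a \<in> carrier R" "s \<in> carrier R" "s \<notin> p"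
  shows "residue_map h S q (fraction (R Quot p) (p +> a) (p +> s)) =
    fraction (S Quot q) (q +>\<^bsub>S\<^esub> h a) (q +>\<^bsub>S\<^esub> h s)"
proof -
  interpret Q: domain_embedding "R Quot p" "S Quot q" coset_map by (rule domain_embedding_coset_map)
  have "p +> a \<in> carrier (R Quot p)" "p +> s \<in> carrier (R Quot p)" "p +> s \<noteq> \<zero>\<^bsub>R Quot p\<^esub>"
    using assms by (auto simp: p.quotient_carrier p.quotient_zero p.coset_eq_zero_iff)
  then show ?thesis using assms by (simp add: residue_map_eq Q.frac_map_fraction coset_map_coset)
qed

text \<open>Cross multiplication modulo q in a/s = b/1. This is the bridge between residue fields
  and the condition in \<open>central_gluing\<close>.\<close>

lemma residue_map_eq_residue_class_iff:
  assumes "a \<in> carrier R" "s \<in> carrier R" "s \<notin> p" "b \<in> carrier S"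
  shows "residue_map h S q (fraction (R Quot p) (p +> a) (p +> s)) = residue_class S q b \<longleftrightarrow>
    h s \<otimes>\<^bsub>S\<^esub> b \<ominus>\<^bsub>S\<^esub> h a \<in> q"
proof -
  have s: "h s \<notin> q" using assms by (simp add: contraction_def)
  have one: "\<one>\<^bsub>S\<^esub> \<notin> q" using q.one_imp_carrier q.I_notcarr by auto
  have "residue_map h S q (fraction (R Quot p) (p +> a) (p +> s)) = residue_class S q b \<longleftrightarrow>
    h a \<otimes>\<^bsub>S\<^esub> \<one>\<^bsub>S\<^esub> \<ominus>\<^bsub>S\<^esub> b \<otimes>\<^bsub>S\<^esub> h s \<in> q"
    using assms s one unfolding residue_map_fraction[OF assms(1-3)] residue_class_def to_frac_def
      q.quotient_one by (intro q.residue_fraction_eq_iff) auto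
  also have "h a \<otimes>\<^bsub>S\<^esub> \<one>\<^bsub>S\<^esub> \<ominus>\<^bsub>S\<^esub> b \<otimes>\<^bsub>S\<^esub> h s = \<ominus>\<^bsub>S\<^esub> (h s \<otimes>\<^bsub>S\<^esub> b \<ominus>\<^bsub>S\<^esub> h a)"
    using hom_closed[OF assms(1)] hom_closed[OF assms(2)] assms(4) by algebra
  also have "\<dots> \<in> q \<longleftrightarrow> h s \<otimes>\<^bsub>S\<^esub> b \<ominus>\<^bsub>S\<^esub> h a \<in> q"
    using q.a_inv_closed[of "h s \<otimes>\<^bsub>S\<^esub> b \<ominus>\<^bsub>S\<^esub> h a"]
      q.a_inv_closed[of "\<ominus>\<^bsub>S\<^esub> (h s \<otimes>\<^bsub>S\<^esub> b \<ominus>\<^bsub>S\<^esub> h a)"] assms by auto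
  finally show ?thesis .
qed

text \<open>The map is induced by an embedding of domains and hence injective, so only surjectivity
  is at stake; it suffices to reach the classes of elements of S.\<close>

lemma residue_map_iso_iff:
  "residue_map h S q \<in> ring_iso (residue_field R p) (residue_field S q) \<longleftrightarrow>
    (\<forall>b\<in>carrier S. \<exists>a\<in>carrier R. \<exists>s\<in>carrier R - p. h s \<otimes>\<^bsub>S\<^esub> b \<ominus>\<^bsub>S\<^esub> h a \<in> q)"
proof
  assume iso: "residue_map h S q \<in> ring_iso (residue_field R p) (residue_field S q)"
  show "\<forall>b\<in>carrier S. \<exists>a\<in>carrier R. \<exists>s\<in>carrier R - p. h s \<otimes>\<^bsub>S\<^esub> b \<ominus>\<^bsub>S\<^esub> h a \<in> q"
  proof
    fix b assume b: "b \<in> carrier S"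
    have "residue_class S q b \<in> carrier (residue_field S q)"
      unfolding residue_class_def to_frac_def q.quotient_one
      using q.residue_field_fraction[OF b S.one_closed] q.one_imp_carrier q.I_notcarr by blast
    then obtain c where c: "c \<in> carrier (residue_field R p)" "residue_map h S q c = residue_class S q b"
      using ring_iso_memE(5)[OF iso] unfolding bij_betw_def by (metis imageE)
    obtain a s where "a \<in> carrier R" "s \<in> carrier R" "s \<notin> p" "c = fraction (R Quot p) (p +> a) (p +> s)"
      using c(1) by (rule p.residue_fieldE)
    then show "\<exists>a\<in>carrier R. \<exists>s\<in>carrier R - p. h s \<otimes>\<^bsub>S\<^esub> b \<ominus>\<^bsub>S\<^esub> h a \<in> q"
      using c(2) residue_map_eq_residue_class_iff b by blast
  qed
next
  assume all: "\<forall>b\<in>carrier S. \<exists>a\<in>carrier R. \<exists>s\<in>carrier R - p. h s \<otimes>\<^bsub>S\<^esub> b \<ominus>\<^bsub>S\<^esub> h a \<in> q"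
  interpret Q: domain_embedding "R Quot p" "S Quot q" coset_map by (rule domain_embedding_coset_map)
  have hom: "residue_map h S q \<in> ring_hom (residue_field R p) (residue_field S q)"
    unfolding residue_map_eq residue_field_def by (rule Q.frac_map_ring_hom)
  have surj: "x \<in> residue_map h S q ` carrier (residue_field R p)"
    if xS: "x \<in> carrier (residue_field S q)" for x
  proof -
    obtain b t where x: "b \<in> carrier S" "t \<in> carrier S" "t \<notin> q"
      "x = fraction (S Quot q) (q +>\<^bsub>S\<^esub> b) (q +>\<^bsub>S\<^esub> t)"
      using xS by (rule q.residue_fieldE)
    obtain u s where u: "u \<in> carrier R" "s \<in> carrier R" "s \<notin> p" "h s \<otimes>\<^bsub>S\<^esub> b \<ominus>\<^bsub>S\<^esub> h u \<in> q"
      using all x(1) by blast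
    obtain v r where v: "v \<in> carrier R" "r \<in> carrier R" "r \<notin> p" "h r \<otimes>\<^bsub>S\<^esub> t \<ominus>\<^bsub>S\<^esub> h v \<in> q"
      using all x(2) by blast
    have c: "h u \<in> carrier S" "h s \<in> carrier S" "h v \<in> carrier S" "h r \<in> carrier S"
      using u v by simp_all
    \<comment> \<open>With b = u/s and t = v/r modulo q, the fraction b/t is (u r) / (s v); its
      denominator is outside p because t is outside q.\<close>
    have "v \<notin> p"
    proof
      assume "v \<in> p"
      then have "h v \<in> q" by (simp add: contraction_def)
      moreover have "h r \<otimes>\<^bsub>S\<^esub> t = (h r \<otimes>\<^bsub>S\<^esub> t \<ominus>\<^bsub>S\<^esub> h v) \<oplus>\<^bsub>S\<^esub> h v" using c x(2) by algebra
      ultimately have "h r \<otimes>\<^bsub>S\<^esub> t \<in> q" using q.a_closed[OF v(4)] by metis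
      then show False using q.I_prime[OF c(4) x(2)] x(3) v(2,3) by (auto simp: contraction_def)
    qed
    then have sv: "s \<otimes> v \<in> carrier R" "s \<otimes> v \<notin> p" using u v p.I_prime by auto
    have ur: "u \<otimes> r \<in> carrier R" using u v by simp
    have "h (u \<otimes> r) \<otimes>\<^bsub>S\<^esub> t \<ominus>\<^bsub>S\<^esub> b \<otimes>\<^bsub>S\<^esub> h (s \<otimes> v) =
        (h s \<otimes>\<^bsub>S\<^esub> b) \<otimes>\<^bsub>S\<^esub> (h r \<otimes>\<^bsub>S\<^esub> t \<ominus>\<^bsub>S\<^esub> h v) \<oplus>\<^bsub>S\<^esub> (\<ominus>\<^bsub>S\<^esub> (h r \<otimes>\<^bsub>S\<^esub> t)) \<otimes>\<^bsub>S\<^esub> (h s \<otimes>\<^bsub>S\<^esub> b \<ominus>\<^bsub>S\<^esub> h u)"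
      unfolding hom_mult[OF u(1) v(2)] hom_mult[OF u(2) v(1)] using c x(1,2) by algebra
    also have "\<dots> \<in> q"
      using u(4) v(4) c x(1,2) by (intro q.a_closed q.I_l_closed) auto
    finally have "fraction (S Quot q) (q +>\<^bsub>S\<^esub> h (u \<otimes> r)) (q +>\<^bsub>S\<^esub> h (s \<otimes> v)) = x"
      unfolding x(4) using x sv ur
      by (subst q.residue_fraction_eq_iff) (auto simp: contraction_def)
    then have "residue_map h S q (fraction (R Quot p) (p +> (u \<otimes> r)) (p +> (s \<otimes> v))) = x"
      using residue_map_fraction[OF ur sv] by simp
    then show ?thesis using p.residue_field_fraction[OF ur sv] by blast
  qed
  have "inj_on (residue_map h S q) (carrier (residue_field R p))"
    unfolding residue_map_eq residue_field_def by (rule Q.inj_on_frac_map)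
  then show "residue_map h S q \<in> ring_iso (residue_field R p) (residue_field S q)"
    using hom surj ring_hom_memE(1)[OF hom] unfolding ring_iso_def bij_betw_def by blast
qed

end

section \<open>Finite extensions\<close>

lemma combinations_carrier_update: "combinations (R\<lparr>carrier := D\<rparr>) A G = combinations R A G"
proof
  show "combinations (R\<lparr>carrier := D\<rparr>) A G \<subseteq> combinations R A G"
  proof
    fix x assume "x \<in> combinations (R\<lparr>carrier := D\<rparr>) A G"
    then show "x \<in> combinations R A G" by induction (auto intro: combinations.intros)
  qed
  show "combinations R A G \<subseteq> combinations (R\<lparr>carrier := D\<rparr>) A G"
  proof
    fix x assume "x \<in> combinations R A G"
    then show "x \<in> combinations (R\<lparr>carrier := D\<rparr>) A G"
    proof induction
      case zero
      then show ?case using combinations.zero[of "R\<lparr>carrier := D\<rparr>"] by simp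
    next
      case (add_mult a g x)
      then show ?case using combinations.add_mult[of a A g G x "R\<lparr>carrier := D\<rparr>"] by simp
    qed
  qed
qed

lemma noetherian_on_carrier_update: "noetherian_on (R\<lparr>carrier := D\<rparr>) A \<longleftrightarrow> noetherian_on R A"
  by (simp add: noetherian_on_def ideal_on_def combinations_carrier_update)

lemma (in cring) finsum_combinations:
  assumes A: "subring A R" and "finite G" "G \<subseteq> carrier R" "c \<in> G \<rightarrow> A"
  shows "(\<Oplus>g\<in>G. c g \<otimes> g) \<in> combinations R A G"
  using assms(2-4)
proof (induction G)
  case empty
  then show ?case by (simp add: combinations.zero)
next
  case (insert g G)
  have c: "c x \<in> carrier R" if "x \<in> insert g G" for x
    using that insert.prems subringE(1)[OF A] by blast
  have "(\<Oplus>x\<in>insert g G. c x \<otimes> x) = c g \<otimes> g \<oplus> (\<Oplus>x\<in>G. c x \<otimes> x)"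
    using insert c by (intro finsum_insert) auto
  moreover have "(\<Oplus>x\<in>G. c x \<otimes> x) \<in> combinations R A (insert g G)"
    using insert by (intro combinations_mono[of _ _ _ G "insert g G"] insert.IH) auto
  ultimately show ?case using combinations.add_mult[of "c g" A g "insert g G" _ R] insert.prems by auto
qed

context domain_embedding
begin

abbreviation "K \<equiv> h ` carrier R"

lemma subring_K: "subring K S"
  by (rule ring_hom_ring.img_is_subring[OF ring_hom_ringI2[OF R.ring_axioms S.ring_axioms hom]
        R.carrier_is_subring])

text \<open>Ideals of the image are pulled back along h. The elements of R whose image is spanned by
  the images of F form an ideal containing F, hence containing the ideal generated by F.\<close>

lemma noetherian_on_K:
  assumes "noetherian_ring R"
  shows "noetherian_on S K"
  unfolding noetherian_on_def
proof (intro allI impI)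
  fix I assume I: "ideal_on S K I"
  note J = ideal_onD[OF I]
  define J where "J = {a \<in> carrier R. h a \<in> I}"
  have "ideal_on R (carrier R) J"
    by (rule ideal_onI) (use J in \<open>auto simp: J_def\<close>)
  then obtain F where F: "F \<subseteq> carrier R" "finite F" "J = genideal R F"
    using noetherian_ring.finetely_gen[OF assms] R.ideal_on_carrier_iff by blast
  have hF: "h ` F \<subseteq> carrier S" using F(1) by auto
  note M = module_onD[OF S.module_on_combinations[OF subring_K hF]]
  let ?L = "{a \<in> carrier R. h a \<in> combinations S K (h ` F)}"
  have "ideal_on R (carrier R) ?L"
  proof (rule ideal_onI)
    show "\<zero> \<in> ?L" using M(2) by simp
    fix x y assume y: "y \<in> ?L"
    show "x \<oplus> y \<in> ?L" if "x \<in> ?L" using that y M(3) by simp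
    show "x \<otimes> y \<in> ?L" if "x \<in> carrier R" using that y M(4) by simp
  qed auto
  moreover have "F \<subseteq> ?L" using F(1) S.generators_combinations[OF subring_K hF] by blast
  ultimately have "J \<subseteq> ?L" using R.genideal_minimal R.ideal_on_carrier_iff F(3) by metis
  then have "I \<subseteq> combinations S K (h ` F)" using J(1) by (auto simp: J_def)
  moreover have "h ` F \<subseteq> I" using R.genideal_self[OF F(1)] F(3) by (auto simp: J_def)
  ultimately show "\<exists>F. finite F \<and> F \<subseteq> I \<and> I \<subseteq> combinations S K F" using F(2) by blast
qed

section \<open>Integrality of finite extensions\<close>

lemma combinations_powers_eval:
  assumes b: "b \<in> carrier S" and "x \<in> combinations S K ((\<lambda>k::nat. b [^]\<^bsub>S\<^esub> k) ` {..<m})"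
  shows "\<exists>p. set p \<subseteq> carrier R \<and> length p = m \<and> S.eval (map h p) b = x"
  using assms(2)
proof (induction m arbitrary: x)
  case 0
  then show ?case by (auto elim: combinations.cases)
next
  case (Suc m)
  have pc: "(\<lambda>k::nat. b [^]\<^bsub>S\<^esub> k) ` {..<m} \<subseteq> carrier S" "b [^]\<^bsub>S\<^esub> m \<in> carrier S"
    using b by auto
  have "x \<in> combinations S K (insert (b [^]\<^bsub>S\<^esub> m) ((\<lambda>k::nat. b [^]\<^bsub>S\<^esub> k) ` {..<m}))"
    using Suc.prems by (simp add: lessThan_Suc)
  then obtain a y where ay: "a \<in> K" "y \<in> combinations S K ((\<lambda>k::nat. b [^]\<^bsub>S\<^esub> k) ` {..<m})"
    "x = a \<otimes>\<^bsub>S\<^esub> b [^]\<^bsub>S\<^esub> m \<oplus>\<^bsub>S\<^esub> y"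
    using S.combinations_insert[OF subring_K pc] by blast
  obtain p where "set p \<subseteq> carrier R" "length p = m" "S.eval (map h p) b = y"
    using Suc.IH[OF ay(2)] by blast
  moreover from ay(1) obtain c where "c \<in> carrier R" "a = h c" by (rule imageE)
  \<comment> \<open>The head of a coefficient list is weighted by b to the length of the tail, which
    is why the length is tracked.\<close>
  ultimately show ?case using ay(3) by (intro exI[of _ "c # p"]) auto
qed

lemma combinations_powers_finite:
  assumes "x \<in> combinations S K (range (\<lambda>k::nat. b [^]\<^bsub>S\<^esub> k))"
  shows "\<exists>m. x \<in> combinations S K ((\<lambda>k::nat. b [^]\<^bsub>S\<^esub> k) ` {..<m})"
  using assms
proof induction
  case zero
  then show ?case using combinations.zero by blast
next
  case (add_mult a g x)
  then obtain k :: nat and m where g: "g = b [^]\<^bsub>S\<^esub> k"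
    and x: "x \<in> combinations S K ((\<lambda>k::nat. b [^]\<^bsub>S\<^esub> k) ` {..<m})" by blast
  let ?G = "(\<lambda>k::nat. b [^]\<^bsub>S\<^esub> k) ` {..<max m (Suc k)}"
  have "x \<in> combinations S K ?G" using x by (rule combinations_mono) auto
  moreover have "g \<in> ?G" using g by auto
  ultimately have "a \<otimes>\<^bsub>S\<^esub> g \<oplus>\<^bsub>S\<^esub> x \<in> combinations S K ?G"
    by (intro combinations.add_mult[OF add_mult(1)])
  then show ?case by (rule exI)
qed

text \<open>The span of all powers of b is a submodule of a finite module over a noetherian ring.
  Finitely many powers therefore span it, and some b^m is a combination of lower powers.\<close>

lemma finite_imp_integral_element:
  assumes noeth: "noetherian_on S K" and G: "finite G" "G \<subseteq> carrier S" "carrier S \<subseteq> combinations S K G"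
    and b: "b \<in> carrier S"
  shows "\<exists>p. set p \<subseteq> carrier R \<and> p \<noteq> [] \<and> hd p = \<one> \<and> S.eval (map h p) b = \<zero>\<^bsub>S\<^esub>"
proof -
  let ?pow = "\<lambda>k::nat. b [^]\<^bsub>S\<^esub> k"
  let ?N = "combinations S K (range ?pow)"
  have pc: "?pow ` M \<subseteq> carrier S" for M using b by auto
  have N: "module_on S K ?N" using S.module_on_combinations[OF subring_K pc] .
  have "?N \<subseteq> combinations S K G" using module_onD(1)[OF N] G(3) by (rule subset_trans)
  then obtain F where F: "finite F" "F \<subseteq> ?N" "?N \<subseteq> combinations S K F"
    using S.noetherian_submodule[OF subring_K noeth G(1,2) N] by auto
  have "\<exists>m. F \<subseteq> combinations S K (?pow ` {..<m})"
    using F(1,2)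
  proof (induction F)
    case (insert x F)
    then obtain m k where m: "F \<subseteq> combinations S K (?pow ` {..<m})"
      and k: "x \<in> combinations S K (?pow ` {..<k})"
      using combinations_powers_finite[of x b] by blast
    have sub: "?pow ` {..<m} \<subseteq> ?pow ` {..<max m k}" "?pow ` {..<k} \<subseteq> ?pow ` {..<max m k}"
      by auto
    have "y \<in> combinations S K (?pow ` {..<max m k})" if "y \<in> insert x F" for y
      using that m combinations_mono[OF k sub(2)] combinations_mono[OF _ sub(1), of y] by auto
    then show ?case by (intro exI[of _ "max m k"]) (rule subsetI)
  qed auto
  then obtain m where m: "F \<subseteq> combinations S K (?pow ` {..<m})" by blast
  note M = S.module_on_combinations[OF subring_K pc[of "{..<m}"]]
  have "?pow m \<in> ?N" using S.generators_combinations[OF subring_K pc[of UNIV]] by blast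
  then have "?pow m \<in> combinations S K F" using F(3) by blast
  then have "?pow m \<in> combinations S K (?pow ` {..<m})" by (rule combinations_least[OF M m])
  from S.module_on_minus[OF subring_K M this]
  obtain p where p: "set p \<subseteq> carrier R" "length p = m" "S.eval (map h p) b = \<ominus>\<^bsub>S\<^esub> ?pow m"
    using combinations_powers_eval[OF b] by blast
  have "S.eval (map h (\<one> # p)) b = \<zero>\<^bsub>S\<^esub>" using p b by (simp add: S.r_neg)
  then show ?thesis using p(1) by (intro exI[of _ "\<one> # p"]) auto
qed

text \<open>For nonzero b in q the constant coefficient of a monic equation lies in the contraction
  of q, hence vanishes, and b can be cancelled. Repeating this would end with the leading
  coefficient 1 equal to 0.\<close>

lemma integral_contraction_zero:
  assumes q: "primeideal q S" "contraction R h q = {\<zero>}"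
    and int: "\<And>b. b \<in> carrier S \<Longrightarrow> \<exists>p. set p \<subseteq> carrier R \<and> p \<noteq> [] \<and> hd p = \<one> \<and> S.eval (map h p) b = \<zero>\<^bsub>S\<^esub>"
  shows "q = {\<zero>\<^bsub>S\<^esub>}"
proof -
  interpret q: primeideal q S by (rule q)
  have "b = \<zero>\<^bsub>S\<^esub>" if b: "b \<in> q" for b
  proof (rule ccontr)
    assume nz: "b \<noteq> \<zero>\<^bsub>S\<^esub>"
    have bc: "b \<in> carrier S" using b q.a_Hcarr by blast
    have "\<not> (set p \<subseteq> carrier R \<and> p \<noteq> [] \<and> hd p = \<one> \<and> S.eval (map h p) b = \<zero>\<^bsub>S\<^esub>)" for p
    \<comment> \<open>The constant coefficient is the last entry of the list.\<close>
    proof (induction p rule: rev_induct)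
      case (snoc a p)
      show ?case
      proof
        assume p: "set (p @ [a]) \<subseteq> carrier R \<and> p @ [a] \<noteq> [] \<and> hd (p @ [a]) = \<one> \<and>
          S.eval (map h (p @ [a])) b = \<zero>\<^bsub>S\<^esub>"
        have pc: "set (map h p) \<subseteq> carrier S" "a \<in> carrier R" using p by auto
        have ec: "S.eval (map h p) b \<in> carrier S" using S.eval_in_carrier[OF pc(1) bc] .
        have e: "S.eval (map h p) b \<otimes>\<^bsub>S\<^esub> b \<oplus>\<^bsub>S\<^esub> h a = \<zero>\<^bsub>S\<^esub>"
          using S.eval_append_aux[OF pc(1) hom_closed[OF pc(2)] bc] p by simp
        then have "h a = \<ominus>\<^bsub>S\<^esub> (S.eval (map h p) b \<otimes>\<^bsub>S\<^esub> b)"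
          using S.minus_equality[of "h a" "S.eval (map h p) b \<otimes>\<^bsub>S\<^esub> b"] ec bc pc(2)
          by (simp add: S.a_comm)
        also have "\<dots> \<in> q" using q.a_inv_closed q.I_l_closed[OF b ec] by blast
        finally have "a \<in> contraction R h q" using pc(2) by (simp add: contraction_def)
        then have a: "a = \<zero>" using q(2) by simp
        \<comment> \<open>Otherwise a would be the leading coefficient, which is 1.\<close>
        then have "p \<noteq> []" using p by auto
        moreover have "S.eval (map h p) b = \<zero>\<^bsub>S\<^esub>"
          using e ec bc nz a by (simp add: S.integral_iff)
        ultimately show False using snoc p by auto
      qed
    qed simp
    then show False using int[OF bc] by blast
  qed
  then show ?thesis using q.zero_closed by blast
qed

section \<open>The birational gluing and intermediate rings\<close>

lemma birational_gluing_iff: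
  "b \<in> birational_gluing R h S \<longleftrightarrow>
    b \<in> carrier S \<and> (\<exists>u\<in>carrier R. \<exists>s\<in>carrier R - {\<zero>}. h s \<otimes>\<^bsub>S\<^esub> b = h u)"
proof
  assume "b \<in> birational_gluing R h S"
  then obtain c where c: "b \<in> carrier S" "c \<in> carrier (fraction_field R)" "frac_map S h c = to_frac S b"
    by (auto simp: birational_gluing_def)
  obtain u s where "u \<in> carrier R" "s \<in> carrier R" "s \<noteq> \<zero>" "c = fraction R u s"
    using c(2) by (rule R.fraction_fieldE)
  then show "b \<in> carrier S \<and> (\<exists>u\<in>carrier R. \<exists>s\<in>carrier R - {\<zero>}. h s \<otimes>\<^bsub>S\<^esub> b = h u)"
    using c frac_map_eq_to_frac_iff by blast
next
  assume "b \<in> carrier S \<and> (\<exists>u\<in>carrier R. \<exists>s\<in>carrier R - {\<zero>}. h s \<otimes>\<^bsub>S\<^esub> b = h u)"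
  then obtain u s where "b \<in> carrier S" "u \<in> carrier R" "s \<in> carrier R" "s \<noteq> \<zero>" "h s \<otimes>\<^bsub>S\<^esub> b = h u"
    by blast
  then show "b \<in> birational_gluing R h S"
    using frac_map_eq_to_frac_iff[of u s b] R.fraction_carrier[of u s] by (auto simp: birational_gluing_def)
qed

lemma K_subset_birational_gluing: "K \<subseteq> birational_gluing R h S"
proof
  fix x assume "x \<in> K"
  then obtain a where "a \<in> carrier R" "x = h a" by blast
  then show "x \<in> birational_gluing R h S"
    unfolding birational_gluing_iff by (intro conjI bexI[of _ a] bexI[of _ \<one>]) auto
qed

lemma subring_birational_gluing: "subring (birational_gluing R h S) S"
proof (rule S.subringI)
  show "birational_gluing R h S \<subseteq> carrier S" by (auto simp: birational_gluing_iff)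
  show "\<one>\<^bsub>S\<^esub> \<in> birational_gluing R h S" using K_subset_birational_gluing subringE(3)[OF subring_K] by blast
  fix x assume "x \<in> birational_gluing R h S"
  then obtain u s where x: "x \<in> carrier S" "u \<in> carrier R" "s \<in> carrier R" "s \<noteq> \<zero>" "h s \<otimes>\<^bsub>S\<^esub> x = h u"
    unfolding birational_gluing_iff by blast
  have "h s \<otimes>\<^bsub>S\<^esub> \<ominus>\<^bsub>S\<^esub> x = h (\<ominus> u)" using x by (simp add: S.r_minus)
  then show "\<ominus>\<^bsub>S\<^esub> x \<in> birational_gluing R h S"
    unfolding birational_gluing_iff using x by (intro conjI bexI[of _ "\<ominus> u"] bexI[of _ s]) auto
  fix y assume "y \<in> birational_gluing R h S"
  then obtain v t where y: "y \<in> carrier S" "v \<in> carrier R" "t \<in> carrier R" "t \<noteq> \<zero>" "h t \<otimes>\<^bsub>S\<^esub> y = h v"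
    unfolding birational_gluing_iff by blast
  have c: "h s \<in> carrier S" "h t \<in> carrier S" using x y by simp_all
  have "h (s \<otimes> t) \<otimes>\<^bsub>S\<^esub> (x \<otimes>\<^bsub>S\<^esub> y) = (h s \<otimes>\<^bsub>S\<^esub> x) \<otimes>\<^bsub>S\<^esub> (h t \<otimes>\<^bsub>S\<^esub> y)"
    unfolding hom_mult[OF x(3) y(3)] using c x(1) y(1) by (simp add: S.m_ac)
  also have "\<dots> = h (u \<otimes> v)" using x y by simp
  finally show "x \<otimes>\<^bsub>S\<^esub> y \<in> birational_gluing R h S"
    unfolding birational_gluing_iff using x y
    by (intro conjI bexI[of _ "u \<otimes> v"] bexI[of _ "s \<otimes> t"]) (auto simp: R.integral_iff)
  have "h (s \<otimes> t) \<otimes>\<^bsub>S\<^esub> (x \<oplus>\<^bsub>S\<^esub> y) = h t \<otimes>\<^bsub>S\<^esub> (h s \<otimes>\<^bsub>S\<^esub> x) \<oplus>\<^bsub>S\<^esub> h s \<otimes>\<^bsub>S\<^esub> (h t \<otimes>\<^bsub>S\<^esub> y)"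
    unfolding hom_mult[OF x(3) y(3)] using c x(1) y(1) by algebra
  also have "\<dots> = h (t \<otimes> u \<oplus> s \<otimes> v)" using x y by simp
  finally show "x \<oplus>\<^bsub>S\<^esub> y \<in> birational_gluing R h S"
    unfolding birational_gluing_iff using x y
    by (intro conjI bexI[of _ "t \<otimes> u \<oplus> s \<otimes> v"] bexI[of _ "s \<otimes> t"]) (auto simp: R.integral_iff)
qed

lemma domain_embedding_subring:
  assumes "subring D S" "K \<subseteq> D"
  shows "domain_embedding R (S\<lparr>carrier := D\<rparr>) h"
proof (intro domain_embedding.intro domain_embedding_axioms.intro R.domain_axioms S.subring_is_domain assms(1) inj)
  show "h \<in> ring_hom R (S\<lparr>carrier := D\<rparr>)"
    by (rule ring_hom_memI) (use assms in auto)
qed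

lemma intermediate_domain_iff: "intermediate_domain R h S D \<longleftrightarrow> subring D S \<and> K \<subseteq> D"
  unfolding intermediate_domain_def
  using S.subdomainI' subcring.axioms(1) subdomain.axioms(1) by blast

lemma not_real_domain:
  assumes "\<not> real_domain R"
  shows "\<not> real_domain S"
proof -
  have "\<ominus> \<one> \<in> square_cone R" using assms R.real_domain_iff by blast
  then have "h (\<ominus> \<one>) \<in> square_cone (S\<lparr>carrier := K\<rparr>)" unfolding square_cone_image by blast
  then have "\<ominus>\<^bsub>S\<^esub> \<one>\<^bsub>S\<^esub> \<in> square_cone S"
    using S.sums_of_squares_subring[of _ K] by (auto simp: square_cone_def)
  then show ?thesis using S.real_domain_iff by blast
qed

end

text \<open>A greatest member is maximal and is the only maximal one, which settles existence and
  uniqueness together.\<close>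

lemma is_central_seminormalizationI:
  assumes "C \<in> sc_subintegral_intermediates A \<phi> B"
    and "\<And>D. D \<in> sc_subintegral_intermediates A \<phi> B \<Longrightarrow> D \<subseteq> C"
  shows "is_central_seminormalization A \<phi> B C"
  unfolding is_central_seminormalization_def maximal_in_def using assms by blast

section \<open>The central seminormalization\<close>

locale finite_real_extension = domain_embedding +
  assumes noetherian_base: "noetherian_ring R"
    and finite_over_K: "\<exists>G. finite G \<and> G \<subseteq> carrier S \<and> carrier S \<subseteq> combinations S (h ` carrier R) G"
    and real: "real_domain R"
begin

text \<open>B_1 as a ring. It differs from \<open>S\<close> only in its carrier, so sums and
  products agree.\<close>

abbreviation "T \<equiv> S\<lparr>carrier := birational_gluing R h S\<rparr>"

lemma birational_subset: "birational_gluing R h S \<subseteq> carrier S"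
  using subringE(1)[OF subring_birational_gluing] .

sublocale T: domain_embedding R T h
  by (rule domain_embedding_subring[OF subring_birational_gluing K_subset_birational_gluing])

lemma subring_T_iff: "subring D T \<longleftrightarrow> subring D S \<and> D \<subseteq> birational_gluing R h S"
proof (cases "D \<subseteq> birational_gluing R h S")
  case True
  then have "D \<subseteq> carrier T" "D \<subseteq> carrier S" using birational_subset by auto
  then show ?thesis using True T.S.subring_iff[of D] S.subring_iff[of D] by simp
next
  case False
  then show ?thesis using subringE(1)[of D T] by auto
qed

lemma frac_T:
  assumes "x \<in> carrier T"
  shows "\<exists>s\<in>K - {\<zero>\<^bsub>T\<^esub>}. s \<otimes>\<^bsub>T\<^esub> x \<in> K"
proof -
  obtain u s where "u \<in> carrier R" "s \<in> carrier R" "s \<noteq> \<zero>" "h s \<otimes>\<^bsub>S\<^esub> x = h u"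
    using assms birational_gluing_iff by auto
  then show ?thesis by (intro bexI[of _ "h s"]) (auto simp: h_eq_zero_iff)
qed

lemma subring_K_T: "subring K T"
  using subring_T_iff subring_K K_subset_birational_gluing by blast

lemma C_Spec_intermediate_iff:
  assumes "subring D T" "K \<subseteq> D"
  shows "q \<in> C_Spec (S\<lparr>carrier := D\<rparr>) \<longleftrightarrow> central_prime_on T D q"
  using T.S.C_Spec_subring_iff[OF subring_K_T frac_T assms] by simp

lemma C_Spec_base_iff:
  assumes "p \<subseteq> carrier R"
  shows "p \<in> C_Spec R \<longleftrightarrow> central_prime_on T K (h ` p)"
proof -
  interpret K: domain "S\<lparr>carrier := K\<rparr>" by (rule S.subring_is_domain[OF subring_K])
  show ?thesis
    using C_Spec_intermediate_iff[OF subring_K_T subset_refl, of "h ` p"] K.C_Spec_iff[of "h ` p"]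
      central_prime_on_image_iff[OF assms] R.C_Spec_iff[of p] by simp
qed

lemma C_Spec_base_subset: "p \<in> C_Spec R \<Longrightarrow> p \<subseteq> carrier R"
  using R.C_Spec_iff central_prime_onD(2) by blast

lemma central_prime_on_KE:
  assumes "central_prime_on T K P"
  obtains p where "p \<in> C_Spec R" "P = h ` p"
proof -
  have "P = h ` contraction R h P" using central_prime_onD(2)[OF assms] by (auto simp: contraction_def)
  moreover have "contraction R h P \<subseteq> carrier R" by (auto simp: contraction_def)
  ultimately show thesis using that C_Spec_base_iff assms by metis
qed

text \<open>T has the fraction field of R, so an element of R in the cone of T is already in the
  cone of R. This may fail for S, as for the complex numbers over the reals.\<close>

lemma minus_one_T: "\<ominus>\<^bsub>T\<^esub> \<one>\<^bsub>T\<^esub> \<notin> square_cone T"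
proof
  assume "\<ominus>\<^bsub>T\<^esub> \<one>\<^bsub>T\<^esub> \<in> square_cone T"
  then have "h (\<ominus> \<one>) \<in> square_cone T" using T.hom_a_inv[OF R.one_closed] T.hom_one by metis
  moreover have "h (\<ominus> \<one>) \<in> K" by (intro imageI R.a_inv_closed R.one_closed)
  moreover have "square_cone (S\<lparr>carrier := K\<rparr>) = K \<inter> square_cone T"
    using T.S.square_cone_subring[OF subring_K_T frac_T subring_K_T subset_refl] by simp
  ultimately have "h (\<ominus> \<one>) \<in> h ` square_cone R" unfolding square_cone_image by blast
  then have "\<ominus> \<one> \<in> square_cone R"
    using inj_on_image_mem_iff[OF inj, of "\<ominus> \<one>" "square_cone R"] R.square_cone_carrier by auto
  then show False using real R.real_domain_iff by blast
qed

lemma noetherian_on_S: "noetherian_on S K"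
  by (rule noetherian_on_K[OF noetherian_base])

text \<open>T is a submodule of the finite K-module S, hence finite itself since K is noetherian;
  with its realness this gives the bound on squares.\<close>

sublocale B: noetherian_bounded_extension T K
proof -
  obtain G where G: "finite G" "G \<subseteq> carrier S" "carrier S \<subseteq> combinations S K G"
    using finite_over_K by blast
  have N: "module_on S K (birational_gluing R h S)"
    unfolding module_on_def
    using subringE(1,2)[OF subring_birational_gluing] K_subset_birational_gluing
    by (auto intro: subringE(6,7)[OF subring_birational_gluing])
  have "birational_gluing R h S \<subseteq> combinations S K G" using birational_subset G(3) by (rule subset_trans)
  then obtain F where F: "finite F" "F \<subseteq> birational_gluing R h S"
    "birational_gluing R h S \<subseteq> combinations S K F"
    using S.noetherian_submodule[OF subring_K noetherian_on_S G(1,2) N] by auto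
  have F': "finite F" "F \<subseteq> carrier T" "carrier T \<subseteq> combinations T K F"
    using F by (simp_all add: combinations_carrier_update)
  show "noetherian_bounded_extension T K"
  proof (intro noetherian_bounded_extension.intro noetherian_bounded_extension_axioms.intro)
    show "bounded_extension T K" by (rule T.S.bounded_extensionI[OF subring_K_T F' minus_one_T])
    show "noetherian_on T K" using noetherian_on_S by (simp add: noetherian_on_carrier_update)
    show "\<exists>G. finite G \<and> G \<subseteq> carrier T \<and> carrier T \<subseteq> combinations T K G" using F' by blast
  qed
qed

lemma residue_embedding_intermediate:
  assumes D: "subring D T" "K \<subseteq> D" and q: "q \<in> C_Spec (S\<lparr>carrier := D\<rparr>)"
  shows "residue_embedding R (S\<lparr>carrier := D\<rparr>) h q"
proof (rule residue_embedding.intro)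
  show "domain_embedding R (S\<lparr>carrier := D\<rparr>) h"
    using domain_embedding_subring D subring_T_iff by blast
  show "primeideal q (S\<lparr>carrier := D\<rparr>)" using q by (simp add: C_Spec_def)
qed

lemma minus_intermediate:
  assumes D: "subring D T" "x \<in> D" "y \<in> D"
  shows "x \<ominus>\<^bsub>S\<lparr>carrier := D\<rparr>\<^esub> y = x \<ominus>\<^bsub>T\<^esub> y"
  using T.S.a_minus_subring[OF assms] by simp

text \<open>An element of k(p) is represented by numerator and denominator, and p is replaced by its
  image in K; both descriptions then ask that s b - u lie in every q over p.\<close>

lemma elementary_central_gluing_eq:
  assumes D: "subring D T" "K \<subseteq> D" and p: "p \<in> C_Spec R"
  shows "elementary_central_gluing R h (S\<lparr>carrier := D\<rparr>) p = B.central_gluing D (h ` p)"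
proof -
  have pR: "p \<subseteq> carrier R" by (rule C_Spec_base_subset[OF p])
  interpret p: primeideal p R using p by (simp add: C_Spec_def)
  have key: "residue_map h (S\<lparr>carrier := D\<rparr>) q (fraction (R Quot p) (p +> u) (p +> s)) =
      residue_class (S\<lparr>carrier := D\<rparr>) q b \<longleftrightarrow> h s \<otimes>\<^bsub>T\<^esub> b \<ominus>\<^bsub>T\<^esub> h u \<in> q"
    if b: "b \<in> D" and us: "u \<in> carrier R" "s \<in> carrier R" "s \<notin> p"
      and q: "q \<in> C_Spec (S\<lparr>carrier := D\<rparr>)" "contraction R h q = p" for b u s q
  proof -
    interpret q: residue_embedding R "S\<lparr>carrier := D\<rparr>" h q
      by (rule residue_embedding_intermediate[OF D q(1)])
    have "h s \<in> D" "h u \<in> D" using us D(2) by blast+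
    then have "h s \<otimes>\<^bsub>S\<^esub> b \<in> D" "h u \<in> D" using b subringE(6)[OF D(1)] by auto
    from minus_intermediate[OF D(1) this] show ?thesis
      using q.residue_map_eq_residue_class_iff[of u s b] us b q(2) by simp
  qed
  have spec: "q \<in> C_Spec (S\<lparr>carrier := D\<rparr>) \<and> contraction R h q = p \<longleftrightarrow>
      central_prime_on T D q \<and> q \<inter> K = h ` p" for q
    using C_Spec_intermediate_iff[OF D] contraction_eq_iff[OF pR] by blast
  have mem: "h s \<in> h ` p \<longleftrightarrow> s \<in> p" if "s \<in> carrier R" for s
    using inj_on_image_mem_iff[OF inj that pR] .
  show ?thesis
  proof (intro equalityI subsetI)
    fix b assume "b \<in> elementary_central_gluing R h (S\<lparr>carrier := D\<rparr>) p"
    then obtain c where b: "b \<in> D" and c: "c \<in> carrier (residue_field R p)"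
      and all: "\<And>q. q \<in> C_Spec (S\<lparr>carrier := D\<rparr>) \<Longrightarrow> contraction R h q = p \<Longrightarrow>
        residue_map h (S\<lparr>carrier := D\<rparr>) q c = residue_class (S\<lparr>carrier := D\<rparr>) q b"
      unfolding elementary_central_gluing_def by auto
    obtain u s where us: "u \<in> carrier R" "s \<in> carrier R" "s \<notin> p"
      "c = fraction (R Quot p) (p +> u) (p +> s)"
      using c by (rule p.residue_fieldE)
    show "b \<in> B.central_gluing D (h ` p)"
    proof (rule B.central_gluingI[OF b])
      show "h u \<in> K" "h s \<in> K - h ` p" using us mem by auto
      fix q assume "central_prime_on T D q" "q \<inter> K = h ` p"
      then have q: "q \<in> C_Spec (S\<lparr>carrier := D\<rparr>)" "contraction R h q = p" using spec by blast+
      show "h s \<otimes>\<^bsub>T\<^esub> b \<ominus>\<^bsub>T\<^esub> h u \<in> q" using key[OF b us(1-3) q] all[OF q] us(4) by simp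
    qed
  next
    fix b assume "b \<in> B.central_gluing D (h ` p)"
    then have "b \<in> D \<and> (\<exists>u'\<in>K. \<exists>s'\<in>K - h ` p. \<forall>q. central_prime_on T D q \<and> q \<inter> K = h ` p \<longrightarrow>
        s' \<otimes>\<^bsub>T\<^esub> b \<ominus>\<^bsub>T\<^esub> u' \<in> q)"
      unfolding B.central_gluing_def mem_Collect_eq .
    then obtain u' s' where b: "b \<in> D" and us': "u' \<in> K" "s' \<in> K - h ` p"
      and all: "\<forall>q. central_prime_on T D q \<and> q \<inter> K = h ` p \<longrightarrow> s' \<otimes>\<^bsub>T\<^esub> b \<ominus>\<^bsub>T\<^esub> u' \<in> q"
      by (elim conjE bexE) (rule that)
    obtain u s where us: "u \<in> carrier R" "u' = h u" "s \<in> carrier R" "s' = h s" "s \<notin> p"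
      using us' by blast
    have "residue_map h (S\<lparr>carrier := D\<rparr>) q (fraction (R Quot p) (p +> u) (p +> s)) =
        residue_class (S\<lparr>carrier := D\<rparr>) q b"
      if q: "q \<in> C_Spec (S\<lparr>carrier := D\<rparr>)" "contraction R h q = p" for q
      using key[OF b us(1,3,5) q] all[rule_format, of q] spec[of q] q us(2,4) by simp
    then show "b \<in> elementary_central_gluing R h (S\<lparr>carrier := D\<rparr>) p"
      unfolding elementary_central_gluing_def using b
      by (auto intro!: bexI[OF _ p.residue_field_fraction[OF us(1,3,5)]])
  qed
qed

lemma integral_extension_intermediate:
  assumes D: "subring D S" "K \<subseteq> D"
  shows "integral_extension R h (S\<lparr>carrier := D\<rparr>)"
proof -
  interpret D: domain_embedding R "S\<lparr>carrier := D\<rparr>" h by (rule domain_embedding_subring[OF D])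
  obtain G where G: "finite G" "G \<subseteq> carrier S" "carrier S \<subseteq> combinations S K G"
    using finite_over_K by blast
  have "\<exists>p. set p \<subseteq> carrier R \<and> p \<noteq> [] \<and> hd p = \<one> \<and> S.eval (map h p) b = \<zero>\<^bsub>S\<^esub>" if "b \<in> D" for b
    using finite_imp_integral_element[OF noetherian_on_S G] that subringE(1)[OF D(1)] by blast
  then show ?thesis
    unfolding integral_extension_def ring_extension_def using D.hom inj S.eval_consistent[OF D(1)] by auto
qed

text \<open>Puts the residue field condition into the form that
  \<open>B.central_closure_greatest\<close> expects, with fractions of elements of K.\<close>

lemma residue_map_intermediate_iso_iff:
  assumes D: "subring D T" "K \<subseteq> D" and q: "q \<in> C_Spec (S\<lparr>carrier := D\<rparr>)"
  shows "residue_map h (S\<lparr>carrier := D\<rparr>) q \<in>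
      ring_iso (residue_field R (contraction R h q)) (residue_field (S\<lparr>carrier := D\<rparr>) q) \<longleftrightarrow>
    (\<forall>b\<in>D. \<exists>u\<in>K. \<exists>s\<in>K - q. s \<otimes>\<^bsub>T\<^esub> b \<ominus>\<^bsub>T\<^esub> u \<in> q)"
proof -
  interpret q: residue_embedding R "S\<lparr>carrier := D\<rparr>" h q
    by (rule residue_embedding_intermediate[OF D q])
  have "h s \<otimes>\<^bsub>S\<^esub> b \<ominus>\<^bsub>S\<lparr>carrier := D\<rparr>\<^esub> h a = h s \<otimes>\<^bsub>S\<^esub> b \<ominus>\<^bsub>T\<^esub> h a"
    if "b \<in> D" "a \<in> carrier R" "s \<in> carrier R" for a s b
    using minus_intermediate[OF D(1), of "h s \<otimes>\<^bsub>S\<^esub> b" "h a"] subringE(6)[OF D(1), of "h s" b] that D(2)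
    by auto
  moreover have "K - q = h ` (carrier R - contraction R h q)" by (auto simp: contraction_def)
  ultimately show ?thesis unfolding q.residue_map_iso_iff by auto
qed

text \<open>Injectivity on central primes is \<open>B.central_closure_prime_subset\<close> in both
  directions, surjectivity is lying over, and the residue fields are handled by the common
  fractions.\<close>

lemma central_closure_sc_subintegral:
  "B.central_closure \<in> sc_subintegral_intermediates R h S"
proof -
  let ?C = "B.central_closure"
  have C: "subring ?C T" "K \<subseteq> ?C" by (rule B.subring_central_closure, rule B.A_subset_central_closure)
  have CS: "subring ?C S" using C(1) subring_T_iff by blast
  note spec = C_Spec_intermediate_iff[OF C]
  have contr: "contraction R h q \<in> C_Spec R" "q \<inter> K = h ` contraction R h q"
    if q: "q \<in> C_Spec (S\<lparr>carrier := ?C\<rparr>)" for q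
  proof -
    have "central_prime_on T K (q \<inter> K)"
      using T.S.central_prime_on_contract[OF _ subring_K_T C(2)] q spec by blast
    then obtain p where p: "p \<in> C_Spec R" "q \<inter> K = h ` p" by (rule central_prime_on_KE)
    then have "contraction R h q = p" using contraction_eq_iff[OF C_Spec_base_subset] by blast
    then show "contraction R h q \<in> C_Spec R" "q \<inter> K = h ` contraction R h q" using p by simp_all
  qed
  have "bij_betw (contraction R h) (C_Spec (S\<lparr>carrier := ?C\<rparr>)) (C_Spec R)"
  proof (rule bij_betw_imageI)
    show "inj_on (contraction R h) (C_Spec (S\<lparr>carrier := ?C\<rparr>))"
    proof (rule inj_onI)
      fix q r assume q: "q \<in> C_Spec (S\<lparr>carrier := ?C\<rparr>)" and r: "r \<in> C_Spec (S\<lparr>carrier := ?C\<rparr>)"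
        and "contraction R h q = contraction R h r"
      then have "q \<inter> K = r \<inter> K" using contr(2) by simp
      then show "q = r"
        using B.central_closure_prime_subset[of q r] B.central_closure_prime_subset[of r q] q r
        unfolding spec by (simp add: subset_antisym)
    qed
    show "contraction R h ` C_Spec (S\<lparr>carrier := ?C\<rparr>) = C_Spec R"
    proof (intro equalityI subsetI)
      fix p assume p: "p \<in> C_Spec R"
      have pR: "p \<subseteq> carrier R" by (rule C_Spec_base_subset[OF p])
      have "central_prime_on T K (h ` p)" using C_Spec_base_iff[OF pR] p by blast
      then obtain q where q: "central_prime_on T ?C q" "q \<inter> K = h ` p"
        using B.central_lying_over[OF C(1) subring_K_T subset_refl C(2)] by metis
      have "contraction R h q = p" using q(2) contraction_eq_iff[OF pR] by blast
      then show "p \<in> contraction R h ` C_Spec (S\<lparr>carrier := ?C\<rparr>)" using q(1) spec by blast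
    qed (use contr(1) in blast)
  qed
  moreover have "residue_map h (S\<lparr>carrier := ?C\<rparr>) q \<in>
      ring_iso (residue_field R (contraction R h q)) (residue_field (S\<lparr>carrier := ?C\<rparr>) q)"
    if q: "q \<in> C_Spec (S\<lparr>carrier := ?C\<rparr>)" for q
    unfolding residue_map_intermediate_iso_iff[OF C q]
  proof
    fix b assume b: "b \<in> ?C"
    have q': "central_prime_on T ?C q" using q spec by blast
    show "\<exists>u\<in>K. \<exists>s\<in>K - q. s \<otimes>\<^bsub>T\<^esub> b \<ominus>\<^bsub>T\<^esub> u \<in> q"
      using B.central_closure_residue[OF q' b] q' by metis
  qed
  ultimately show ?thesis
    unfolding sc_subintegral_intermediates_def sc_subintegral_def
    using intermediate_domain_iff CS C(2) integral_extension_intermediate[OF CS C(2)] by blast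
qed

text \<open>Since R is real, its zero ideal is central and has a central prime q of D over it;
  integrality forces q = 0. The residue field isomorphism at q then writes every b in D as u/s with
  u, s from R.\<close>

lemma sc_subintegral_subset_birational:
  assumes D: "D \<in> sc_subintegral_intermediates R h S"
  shows "D \<subseteq> birational_gluing R h S"
proof
  fix b assume b: "b \<in> D"
  have DS: "subring D S" "K \<subseteq> D" and sc: "sc_subintegral R h (S\<lparr>carrier := D\<rparr>)"
    using D intermediate_domain_iff by (auto simp: sc_subintegral_intermediates_def)
  have "contraction R h ` C_Spec (S\<lparr>carrier := D\<rparr>) = C_Spec R"
    using sc unfolding sc_subintegral_def bij_betw_def by (elim conjE)
  then have "{\<zero>} \<in> contraction R h ` C_Spec (S\<lparr>carrier := D\<rparr>)" using R.zero_C_Spec[OF real] by simp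
  then obtain q where q: "q \<in> C_Spec (S\<lparr>carrier := D\<rparr>)" "contraction R h q = {\<zero>}"
    by (elim imageE) simp
  interpret q: residue_embedding R "S\<lparr>carrier := D\<rparr>" h q
    using domain_embedding_subring[OF DS] q(1) by (simp add: residue_embedding_def C_Spec_def)
  have "q = {\<zero>\<^bsub>S\<lparr>carrier := D\<rparr>\<^esub>}"
    using q.integral_contraction_zero[OF q.q.primeideal q(2)] sc
    unfolding sc_subintegral_def integral_extension_def by auto
  then have q0: "q = {\<zero>\<^bsub>S\<^esub>}" by simp
  have "\<forall>b\<in>D. \<exists>a\<in>carrier R. \<exists>s\<in>carrier R - {\<zero>}. h s \<otimes>\<^bsub>S\<^esub> b \<ominus>\<^bsub>S\<lparr>carrier := D\<rparr>\<^esub> h a \<in> q"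
  proof -
    have "residue_map h (S\<lparr>carrier := D\<rparr>) q \<in>
        ring_iso (residue_field R (contraction R h q)) (residue_field (S\<lparr>carrier := D\<rparr>) q)"
      using sc q(1) unfolding sc_subintegral_def by blast
    from iffD1[OF q.residue_map_iso_iff this] show ?thesis using q(2) by simp
  qed
  then obtain u s where us: "u \<in> carrier R" "s \<in> carrier R" "s \<noteq> \<zero>"
    "h s \<otimes>\<^bsub>S\<^esub> b \<ominus>\<^bsub>S\<lparr>carrier := D\<rparr>\<^esub> h u \<in> q"
    using b by blast
  have bS: "b \<in> carrier S" using b subringE(1)[OF DS(1)] by blast
  have "h s \<otimes>\<^bsub>S\<^esub> b \<in> D" "h u \<in> D" using us b DS subringE(6)[OF DS(1), of "h s" b] by auto
  then have "h s \<otimes>\<^bsub>S\<^esub> b \<ominus>\<^bsub>S\<^esub> h u = \<zero>\<^bsub>S\<^esub>" using S.a_minus_subring[OF DS(1)] us(4) q0 by simp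
  then have "h s \<otimes>\<^bsub>S\<^esub> b = h u" using S.r_right_minus_eq[of "h s \<otimes>\<^bsub>S\<^esub> b" "h u"] us bS by simp
  then show "b \<in> birational_gluing R h S" unfolding birational_gluing_iff using us bS by blast
qed

lemma sc_subintegral_subset_central_closure:
  assumes D: "D \<in> sc_subintegral_intermediates R h S"
  shows "D \<subseteq> B.central_closure"
proof -
  have DS: "subring D S" "K \<subseteq> D" and sc: "sc_subintegral R h (S\<lparr>carrier := D\<rparr>)"
    using D intermediate_domain_iff by (auto simp: sc_subintegral_intermediates_def)
  have DT: "subring D T" using DS(1) sc_subintegral_subset_birational[OF D] subring_T_iff by blast
  note spec = C_Spec_intermediate_iff[OF DT DS(2)]
  show ?thesis
  proof (rule B.central_closure_greatest[OF DT DS(2)])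
    fix q r assume q: "central_prime_on T D q" and r: "central_prime_on T D r" and qr: "q \<inter> K = r \<inter> K"
    have "h a \<in> q \<longleftrightarrow> h a \<in> r" if "a \<in> carrier R" for a using qr that by blast
    then have "contraction R h q = contraction R h r" by (auto simp: contraction_def)
    then show "q = r"
      using sc q r spec unfolding sc_subintegral_def bij_betw_def by (metis inj_onD)
  next
    fix r b assume r: "central_prime_on T D r" and b: "b \<in> D"
    show "\<exists>u\<in>K. \<exists>s\<in>K - r. s \<otimes>\<^bsub>T\<^esub> b \<ominus>\<^bsub>T\<^esub> u \<in> r"
      using residue_map_intermediate_iso_iff[OF DT DS(2), of r] sc r b spec
      unfolding sc_subintegral_def by blast
  qed
qed

lemma gluing_sequence:
  "\<exists>(n::nat) Bs p. 1 \<le> n \<and>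
    (\<forall>i\<in>{1..n}. intermediate_domain R h S (Bs i)) \<and>
    (\<forall>i\<in>{1..<n}. Bs (i + 1) \<subseteq> Bs i) \<and>
    (\<forall>i\<in>{1..<n}. p i \<in> C_Spec R) \<and>
    Bs 1 = birational_gluing R h S \<and>
    (\<forall>i\<in>{1..<n}. Bs (i + 1) = elementary_central_gluing R h (S\<lparr>carrier := Bs i\<rparr>) (p i)) \<and>
    is_central_seminormalization R h S (Bs n)"
proof -
  have "subring (birational_gluing R h S) T" using subring_T_iff subring_birational_gluing by blast
  moreover have "B.central_closure \<subseteq> birational_gluing R h S"
    using subringE(1)[OF B.subring_central_closure] by simp
  ultimately obtain n :: nat and Bs P where n: "1 \<le> n" "Bs 1 = birational_gluing R h S"
    "Bs n = B.central_closure"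
    and sub: "\<And>i. i \<in> {1..n} \<Longrightarrow> subring (Bs i) T \<and> K \<subseteq> Bs i"
    and glue: "\<And>i. i \<in> {1..<n} \<Longrightarrow> central_prime_on T K (P i) \<and> Bs (i + 1) = B.central_gluing (Bs i) (P i)"
    using B.gluing_chain by metis
  \<comment> \<open>The chain provides primes of the image K, whereas the conclusion asks for their
    preimages in R.\<close>
  define p where "p = (\<lambda>i. contraction R h (P i))"
  have p: "p i \<in> C_Spec R" "h ` p i = P i" if i: "i \<in> {1..<n}" for i
  proof -
    obtain p' where p': "p' \<in> C_Spec R" "P i = h ` p'" using glue[OF i] central_prime_on_KE by metis
    have "contraction R h (P i) = p'"
      using contraction_eq_iff[OF C_Spec_base_subset[OF p'(1)]] p'(2) C_Spec_base_subset[OF p'(1)] by blast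
    then show "p i \<in> C_Spec R" "h ` p i = P i" using p' by (simp_all add: p_def)
  qed
  have "intermediate_domain R h S (Bs i)" if "i \<in> {1..n}" for i
    using sub[OF that] intermediate_domain_iff subring_T_iff by blast
  moreover have "Bs (i + 1) \<subseteq> Bs i" if "i \<in> {1..<n}" for i
    using glue[OF that] by (auto simp: B.central_gluing_def)
  moreover have "Bs (i + 1) = elementary_central_gluing R h (S\<lparr>carrier := Bs i\<rparr>) (p i)"
    if i: "i \<in> {1..<n}" for i
  proof -
    have "i \<in> {1..n}" using i by simp
    then show ?thesis using elementary_central_gluing_eq[OF _ _ p(1)[OF i]] sub glue[OF i] p(2)[OF i] by metis
  qed
  moreover have "is_central_seminormalization R h S (Bs n)"
    unfolding n(3) using central_closure_sc_subintegral sc_subintegral_subset_central_closure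
    by (rule is_central_seminormalizationI)
  ultimately show ?thesis using n(1,2) p(1) by blast
qed

end

theorem theorem6p25:
  fixes A :: "('a, 'm) ring_scheme" and B :: "('b, 'n) ring_scheme" and \<phi> :: "'a \<Rightarrow> 'b"
  assumes "domain A" and "domain B"
    and "contains_rat A" and "contains_rat B"
    and "finite_extension A \<phi> B"
    and "noetherian_ring A"
  shows "(\<not> real_domain A \<longrightarrow> is_central_seminormalization A \<phi> B (carrier B)) \<and>
    (real_domain A \<longrightarrow>
      (\<exists>(n::nat) (Bs :: nat \<Rightarrow> 'b set) (p :: nat \<Rightarrow> 'a set).
         1 \<le> n \<and>
         (\<forall>i\<in>{1..n}. intermediate_domain A \<phi> B (Bs i)) \<and>
         (\<forall>i\<in>{1..<n}. Bs (i + 1) \<subseteq> Bs i) \<and>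
         (\<forall>i\<in>{1..<n}. p i \<in> C_Spec A) \<and>
         Bs 1 = birational_gluing A \<phi> B \<and>
         (\<forall>i\<in>{1..<n}. Bs (i + 1) =
            elementary_central_gluing A \<phi> (B\<lparr>carrier := Bs i\<rparr>) (p i)) \<and>
         is_central_seminormalization A \<phi> B (Bs n)))"
proof -
  interpret domain_embedding A B \<phi>
    using assms(1,2,5)
    by (intro domain_embedding.intro domain_embedding_axioms.intro)
      (auto simp: finite_extension_def ring_extension_def)
  obtain G where G: "finite G" "G \<subseteq> carrier B"
    and gen: "\<And>b. b \<in> carrier B \<Longrightarrow> \<exists>c \<in> G \<rightarrow> carrier A. b = (\<Oplus>\<^bsub>B\<^esub>g\<in>G. \<phi> (c g) \<otimes>\<^bsub>B\<^esub> g)"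
    using assms(5) unfolding finite_extension_def by blast
  have comb: "carrier B \<subseteq> combinations B K G"
  proof
    fix b assume "b \<in> carrier B"
    then obtain c where "c \<in> G \<rightarrow> carrier A" "b = (\<Oplus>\<^bsub>B\<^esub>g\<in>G. \<phi> (c g) \<otimes>\<^bsub>B\<^esub> g)" using gen by blast
    then show "b \<in> combinations B K G"
      using S.finsum_combinations[OF subring_K G, of "\<lambda>g. \<phi> (c g)"] by auto
  qed
  have "is_central_seminormalization A \<phi> B (carrier B)" if nr: "\<not> real_domain A"
  proof (rule is_central_seminormalizationI)
    have "integral_extension A \<phi> B"
      unfolding integral_extension_def ring_extension_def
      using hom inj finite_imp_integral_element[OF noetherian_on_K[OF assms(6)] G comb] by blast
    \<comment> \<open>Both central spectra are empty, so the conditions on primes and residue fields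
      hold vacuously.\<close>
    then have "sc_subintegral A \<phi> B"
      unfolding sc_subintegral_def R.C_Spec_not_real[OF nr] S.C_Spec_not_real[OF not_real_domain[OF nr]]
      by (simp add: bij_betw_def)
    moreover have "intermediate_domain A \<phi> B (carrier B)"
      unfolding intermediate_domain_iff using S.carrier_is_subring by auto
    ultimately show "carrier B \<in> sc_subintegral_intermediates A \<phi> B"
      by (simp add: sc_subintegral_intermediates_def)
    show "D \<subseteq> carrier B" if "D \<in> sc_subintegral_intermediates A \<phi> B" for D
      using that subringE(1) by (auto simp: sc_subintegral_intermediates_def intermediate_domain_iff)
  qed
  moreover have "\<exists>(n::nat) (Bs :: nat \<Rightarrow> 'b set) (p :: nat \<Rightarrow> 'a set).
      1 \<le> n \<and>
      (\<forall>i\<in>{1..n}. intermediate_domain A \<phi> B (Bs i)) \<and>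
      (\<forall>i\<in>{1..<n}. Bs (i + 1) \<subseteq> Bs i) \<and>
      (\<forall>i\<in>{1..<n}. p i \<in> C_Spec A) \<and>
      Bs 1 = birational_gluing A \<phi> B \<and>
      (\<forall>i\<in>{1..<n}. Bs (i + 1) = elementary_central_gluing A \<phi> (B\<lparr>carrier := Bs i\<rparr>) (p i)) \<and>
      is_central_seminormalization A \<phi> B (Bs n)" if r: "real_domain A"
  proof -
    have "\<exists>G. finite G \<and> G \<subseteq> carrier B \<and> carrier B \<subseteq> combinations B K G" using G comb by blast
    then interpret finite_real_extension A B \<phi>
      by (intro finite_real_extension.intro finite_real_extension_axioms.intro domain_embedding_axioms
          assms(6) r)
    show ?thesis by (rule gluing_sequence)
  qed
  ultimately show ?thesis by blast
qed

end
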